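(* Let $\varphi_0(x)=\sqrt2\,e^{-|x|}$, so that $M(\varphi_0)=2$. For each $\epsilon>0$ there exists $\delta_0>0$ such that the following holds. If $\psi(t)$ is an $H^1_x$ solution of $$i\partial_t\psi+\partial_x^2\psi+\delta|\psi|^2\psi=0,\qquad x\in\mathbb{R},$$ where $\delta=\delta(x)$ is the delta function at the origin, satisfying $$2=M(\varphi_0)<M(\psi)<M(\varphi_0)+\delta_0=2+\delta_0,$$ and $\psi(t)$ blows up at time $t=T_*>0$, $T_*<\infty$, then for all $t<T_*$ sufficiently close to $T_*$ there exist $\theta(t)\in\mathbb{R}$ and $\rho(t)>0$ such that $$\big\|e^{-i\theta(t)}\rho(t)^{1/2}\psi(\rho(t)x,t)-\varphi_0(x)\big\|_{H^1_x}\le\epsilon.$$ The parameters $\rho(t)$ and $\theta(t)$ can be chosen to be continuous in $t$.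
   Context: Mass: $M(u)=\|u\|_{L^2}^2$. For solutions, $M(\psi(t))$ and the energy $E(\psi(t))=\frac12\|\psi_x(t)\|_{L^2}^2-\frac14|\psi(0,t)|^4$ are independent of $t$, and are written $M(\psi)$, $E(\psi)$. Meaning of the equation: $i\partial_t\psi+\partial_x^2\psi=0$ for $x\ne0$, with $\psi(0,t)=\psi(0-,t)=\psi(0+,t)$ and $\partial_x\psi(0+,t)-\partial_x\psi(0-,t)=-|\psi(0,t)|^2\psi(0,t)$. $H^1_x$ solutions: for $\psi_0\in H^1(\mathbb{R})$ there is $T=T(\|\psi_0\|_{H^1})>0$ and a solution on $[0,T)$ with $\psi(0)=\psi_0$ such that $\psi\in C([0,T];H^1_x)$; $\psi\in L^q_{[0,T]}W^{1,r}_x$ for Strichartz admissible pairs $\frac2q+\frac1r=\frac12$; $\psi\in C(x\in\mathbb{R};H^{3/4}_{[0,T]})$; $\partial_x\psi\in C(x\in\mathbb{R}\setminus\{0\};H^{1/4}_{[0,T]})$; the one-sided limits $\partial_x\psi(0\pm,t)$ exist in $H^{1/4}_{[0,T]}$; and the derivative jump condition holds as an equality of $H^{1/4}_{[0,T]}$ functions. Such a solution is unique in this class and the data-to-solution map $H^1_x\to C([0,T];H^1_x)$ is continuous (known local well-posedness theory). If the maximal forward time of existence $T_*>0$ is finite, then $\lim_{t\nearrow T_*}\|\psi_x(t)\|_{L^2}=+\infty$, and one says that $\psi$ blows up at time $T_*$. *)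

theory Defs
  imports "HOL-Analysis.Analysis"
begin

section \<open>Test functions and weak derivatives\<close>

(* f is C-infinity iff all iterated directional derivatives exist and are differentiable. *)
coinductive smooth :: "('a::euclidean_space \<Rightarrow> real) \<Rightarrow> bool" where
  "(\<And>x. f differentiable (at x)) \<Longrightarrow>
   (\<And>v. smooth (\<lambda>x. frechet_derivative f (at x) v)) \<Longrightarrow> smooth f"

(* Real-valued test functions suffice: every distributional identity below is complex-linear
   in the test function. *)
definition test_function :: "'a::euclidean_space set \<Rightarrow> ('a \<Rightarrow> real) \<Rightarrow> bool" where
  "test_function \<Omega> \<phi> \<longleftrightarrow>
     smooth \<phi> \<and> compact (closure {x. \<phi> x \<noteq> 0}) \<and> closure {x. \<phi> x \<noteq> 0} \<subseteq> \<Omega>"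

definition weak_deriv :: "(real \<Rightarrow> complex) \<Rightarrow> (real \<Rightarrow> complex) \<Rightarrow> bool" where
  "weak_deriv u g \<longleftrightarrow>
     (\<forall>\<phi>. test_function UNIV \<phi> \<longrightarrow>
        (LINT x|lborel. u x * of_real (deriv \<phi> x)) = - (LINT x|lborel. g x * of_real (\<phi> x)))"

section \<open>Lebesgue and Sobolev spaces\<close>

(* The exponent ranges over extended reals, p = \<infinity> being the essential supremum. *)
definition in_Lp :: "'a measure \<Rightarrow> ennreal \<Rightarrow> ('a \<Rightarrow> 'b::{real_normed_vector,second_countable_topology}) \<Rightarrow> bool" where
  "in_Lp M p f \<longleftrightarrow> f \<in> borel_measurable M \<and>
     (if p = \<infinity> then \<exists>C::real. AE x in M. norm (f x) \<le> C
      else integrable M (\<lambda>x. norm (f x) powr enn2real p))"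

definition Lp_norm :: "'a measure \<Rightarrow> ennreal \<Rightarrow> ('a \<Rightarrow> 'b::{real_normed_vector,second_countable_topology}) \<Rightarrow> real" where
  "Lp_norm M p f =
     (if p = \<infinity> then Inf {C. 0 \<le> C \<and> (AE x in M. norm (f x) \<le> C)}
      else (LINT x|M. norm (f x) powr enn2real p) powr (1 / enn2real p))"

(* An element of H^1(R) is represented by its unique continuous representative, so that
   point values make sense. *)
definition in_H1 :: "(real \<Rightarrow> complex) \<Rightarrow> bool" where
  "in_H1 u \<longleftrightarrow> continuous_on UNIV u \<and> in_Lp lborel 2 u \<and> (\<exists>g. in_Lp lborel 2 g \<and> weak_deriv u g)"

(* Weak derivative of an H^1 function, determined up to a null set. *)
definition wderiv :: "(real \<Rightarrow> complex) \<Rightarrow> real \<Rightarrow> complex" where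
  "wderiv u = (SOME g. in_Lp lborel 2 g \<and> weak_deriv u g)"

definition H1_norm :: "(real \<Rightarrow> complex) \<Rightarrow> real" where
  "H1_norm u = sqrt ((Lp_norm lborel 2 u)\<^sup>2 + (Lp_norm lborel 2 (wderiv u))\<^sup>2)"

abbreviation interval_measure :: "real \<Rightarrow> real measure" where
  "interval_measure T \<equiv> restrict_space lborel {0..T}"

(* H^s on the time interval [0,T] for 0 < s < 1, in its intrinsic (Sobolev-Slobodeckij) form.
   On the diagonal the quotient is 0/0 = 0. *)
definition gagliardo :: "real \<Rightarrow> (real \<Rightarrow> complex) \<Rightarrow> real \<times> real \<Rightarrow> real" where
  "gagliardo s f = (\<lambda>(t, \<tau>). (cmod (f t - f \<tau>))\<^sup>2 / \<bar>t - \<tau>\<bar> powr (1 + 2 * s))"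

definition in_Hs :: "real \<Rightarrow> real \<Rightarrow> (real \<Rightarrow> complex) \<Rightarrow> bool" where
  "in_Hs s T f \<longleftrightarrow> in_Lp (interval_measure T) 2 f \<and>
     set_integrable lborel ({0..T} \<times> {0..T}) (gagliardo s f)"

definition Hs_norm :: "real \<Rightarrow> real \<Rightarrow> (real \<Rightarrow> complex) \<Rightarrow> real" where
  "Hs_norm s T f = sqrt ((Lp_norm (interval_measure T) 2 f)\<^sup>2 +
     (LINT p:{0..T} \<times> {0..T}|lborel. gagliardo s f p))"

section \<open>Solutions\<close>

text \<open>A function of time and space is curried as \<^term>\<open>\<psi> :: real \<Rightarrow> real \<Rightarrow> complex\<close>,
  with \<^term>\<open>\<psi> t\<close> the spatial profile at time \<^term>\<open>t\<close>; in space-time pairs time comes first.\<close>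

definition C_H1 :: "real \<Rightarrow> (real \<Rightarrow> real \<Rightarrow> complex) \<Rightarrow> bool" where
  "C_H1 T \<psi> \<longleftrightarrow> (\<forall>t\<in>{0..T}. in_H1 (\<psi> t) \<and>
     ((\<lambda>s. H1_norm (\<lambda>x. \<psi> s x - \<psi> t x)) \<longlongrightarrow> 0) (at t within {0..T}))"

definition Lq_W1r :: "ennreal \<Rightarrow> ennreal \<Rightarrow> real \<Rightarrow> (real \<Rightarrow> real \<Rightarrow> complex) \<Rightarrow> bool" where
  "Lq_W1r q r T \<psi> \<longleftrightarrow>
     (AE t in interval_measure T. in_Lp lborel r (\<psi> t) \<and> in_Lp lborel r (wderiv (\<psi> t))) \<and>
     in_Lp (interval_measure T) q (\<lambda>t. Lp_norm lborel r (\<psi> t) + Lp_norm lborel r (wderiv (\<psi> t)))"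

(* In ennreal, c / \<infinity> = 0, so the endpoints (\<infinity>, 2) and (4, \<infinity>) are included. *)
definition admissible :: "ennreal \<Rightarrow> ennreal \<Rightarrow> bool" where
  "admissible q r \<longleftrightarrow> 2 / q + 1 / r = 1 / 2"

(* x \<mapsto> w(., x) is a continuous map from X into H^s on [0,T]. *)
definition C_x_Hs :: "real set \<Rightarrow> real \<Rightarrow> real \<Rightarrow> (real \<Rightarrow> real \<Rightarrow> complex) \<Rightarrow> bool" where
  "C_x_Hs X s T w \<longleftrightarrow> (\<forall>x\<in>X. in_Hs s T (\<lambda>t. w t x) \<and>
     ((\<lambda>y. Hs_norm s T (\<lambda>t. w t y - w t x)) \<longlongrightarrow> 0) (at x within X))"

(* w(., y) tends to h in H^s on [0,T] along the filter F. *)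
definition Hs_limit :: "real \<Rightarrow> real \<Rightarrow> (real \<Rightarrow> real \<Rightarrow> complex) \<Rightarrow> (real \<Rightarrow> complex) \<Rightarrow> real filter \<Rightarrow> bool" where
  "Hs_limit s T w h F \<longleftrightarrow> in_Hs s T h \<and> ((\<lambda>y. Hs_norm s T (\<lambda>t. w t y - h t)) \<longlongrightarrow> 0) F"

abbreviation dir_deriv :: "'a::real_normed_vector \<Rightarrow> ('a \<Rightarrow> real) \<Rightarrow> 'a \<Rightarrow> real" where
  "dir_deriv v f \<equiv> (\<lambda>p. frechet_derivative f (at p) v)"

(* i psi_t + psi_xx = 0 in the sense of distributions on (0,T) x (R - {0}). *)
definition free_schrodinger_off_origin :: "real \<Rightarrow> (real \<Rightarrow> real \<Rightarrow> complex) \<Rightarrow> bool" where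
  "free_schrodinger_off_origin T \<psi> \<longleftrightarrow>
     (\<forall>\<phi>. test_function ({0<..<T} \<times> (- {0})) \<phi> \<longrightarrow>
        (LINT p|lborel. \<psi> (fst p) (snd p) *
           (- \<i> * of_real (dir_deriv (1, 0) \<phi> p)
            + of_real (dir_deriv (0, 1) (dir_deriv (0, 1) \<phi>) p))) = 0)"

(* v is a representative of the spatial derivative of psi, with traces vl = v(0-,.) and
   vr = v(0+,.); the equality of H^{1/4} functions is an equality almost everywhere. *)
definition derivative_jump :: "real \<Rightarrow> (real \<Rightarrow> real \<Rightarrow> complex) \<Rightarrow> bool" where
  "derivative_jump T \<psi> \<longleftrightarrow> (\<exists>v vl vr.
     (\<lambda>(t, x). v t x) \<in> borel_measurable borel \<and>
     (AE t in interval_measure T. AE x in lborel. v t x = wderiv (\<psi> t) x) \<and>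
     C_x_Hs (- {0}) (1/4) T v \<and>
     Hs_limit (1/4) T v vl (at_left 0) \<and>
     Hs_limit (1/4) T v vr (at_right 0) \<and>
     (AE t in interval_measure T. vr t - vl t = - of_real ((cmod (\<psi> t 0))\<^sup>2) * \<psi> t 0))"

definition solution_on_closed :: "real \<Rightarrow> (real \<Rightarrow> real \<Rightarrow> complex) \<Rightarrow> bool" where
  "solution_on_closed T \<psi> \<longleftrightarrow>
     C_H1 T \<psi> \<and>
     (\<forall>q r. admissible q r \<longrightarrow> Lq_W1r q r T \<psi>) \<and>
     C_x_Hs UNIV (3/4) T \<psi> \<and>
     free_schrodinger_off_origin T \<psi> \<and>
     derivative_jump T \<psi>"

(* H^1 solution on [0,S): the solution class holds on every compact subinterval [0,T]. *)
definition H1_solution :: "real \<Rightarrow> (real \<Rightarrow> real \<Rightarrow> complex) \<Rightarrow> bool" where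
  "H1_solution S \<psi> \<longleftrightarrow> 0 < S \<and> (\<forall>T. 0 < T \<and> T < S \<longrightarrow> solution_on_closed T \<psi>)"

definition maximal_forward_time :: "real \<Rightarrow> (real \<Rightarrow> real \<Rightarrow> complex) \<Rightarrow> bool" where
  "maximal_forward_time S \<psi> \<longleftrightarrow> H1_solution S \<psi> \<and>
     \<not> (\<exists>S' > S. \<exists>\<psi>'. H1_solution S' \<psi>' \<and> (\<forall>t\<in>{0..<S}. \<psi>' t = \<psi> t))"

(* Finiteness of S is implicit in its type. *)
definition blows_up_at :: "real \<Rightarrow> (real \<Rightarrow> real \<Rightarrow> complex) \<Rightarrow> bool" where
  "blows_up_at S \<psi> \<longleftrightarrow> maximal_forward_time S \<psi> \<and>
     filterlim (\<lambda>t. Lp_norm lborel 2 (wderiv (\<psi> t))) at_top (at_left S)"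

definition mass :: "(real \<Rightarrow> complex) \<Rightarrow> real" where
  "mass u = (Lp_norm lborel 2 u)\<^sup>2"

definition ground_state :: "real \<Rightarrow> complex" where
  "ground_state x = of_real (sqrt 2 * exp (- \<bar>x\<bar>))"

end

theory Submission
  imports Defs "HOL-Computational_Algebra.Polynomial" "HOL-Real_Asymp.Real_Asymp"
begin

text \<open>For $u \in H^1$ one has
  $\int u \varphi_0 + \int u' \varphi_0' = 2\sqrt 2\, u(0)$, because
  $\varphi_0 - \varphi_0'' = 2\sqrt 2\,\delta$. Hence, with $\rho = \sqrt 2 / \|\psi_x(t)\|$ and
  $\theta = \arg \psi(0,t)$, the squared distance in the theorem equals
  $M(\psi) + 6 - 4\sqrt 2\, \rho^{1/2} |\psi(0,t)|$, while conservation of energy gives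
  $\rho^2 |\psi(0,t)|^4 = 4 - 8 E(\psi) / \|\psi_x(t)\|^2 \to 4$ at blow-up. So the distance tends to
  $(M(\psi) - 2)^{1/2}$, and no compactness argument is needed.

  Mass and energy conservation come from the two-time kernels
  $B(t,r) = \langle \psi(t), \psi(r)\rangle$ and $A(t,r) = \langle \psi_x(t), \psi_x(r)\rangle$.
  With $w(t) = \psi(0,t)$, the equation says
  $i\,\partial_t B(t,r) = A(t,r) - |w(t)|^2 w(t) \overline{w(r)}$. As $A$ is Hermitian it drops out
  of $\frac{d}{dt} B(t,t+h)$; $h = 0$ gives the mass, and the first order in $h$ of the imaginary part
  gives the energy. The remainder is $O(\int |w(t+h) - w(t)|^2 dt)$, which is $o(h)$
  along a sequence $h \to 0$ since $w \in H^{3/4}$.\<close>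

section \<open>Smooth functions and cutoffs\<close>

text \<open>For an H^1 solution psi_t is only of class H^{-1}, so the textbook energy identity,
  which pairs the equation with psi_t, is not directly available; pairing with psi(r) at a fixed
  second time is, since psi(r) lies in H^1. Two obstacles remain. The equation is given only against
  test functions vanishing near x = 0, where psi(r) need not vanish; and the traces of psi_x at 0
  are H^{1/4} functions of time, without values at a given t. Both disappear after integrating in
  time first: V(x), the integral of psi_x(\<tau>,x) over \<tau> in [s,t], is locally absolutely
  continuous off the origin with derivative -i(psi(t) - psi(s)) and has genuine one-sided limits at
  0, so the nonlinearity enters as the boundary term of an integration by parts. This is why weak
  derivatives are turned into primitives at the outset. The choice \<delta>_0 = \<epsilon>^2/2
  splits the squared distance evenly: \<epsilon>^2/2 for the mass excess M - 2, and \<epsilon>^2/2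
  for the amount by which 4 sqrt 2 \<rho>^{1/2} |psi(0,t)| may fall short of its limit 8.\<close>

lemma smooth_differentiable: "smooth f \<Longrightarrow> f differentiable (at x)"
  by (erule smooth.cases) auto

lemma smooth_frechet_derivative: "smooth f \<Longrightarrow> smooth (\<lambda>x. frechet_derivative f (at x) v)"
  by (erule smooth.cases) auto

lemma smooth_const: "smooth (\<lambda>x. c)"
proof (coinduction arbitrary: c)
  case smooth
  have "(\<lambda>x. frechet_derivative (\<lambda>x. c) (at x) v) = (\<lambda>x::'a. 0)" for v by simp
  then show ?case by auto
qed

lemma smooth_add:
  assumes "smooth f" "smooth g"
  shows "smooth (\<lambda>x. f x + g x)"
  using assms
proof (coinduction arbitrary: f g)
  case (smooth f g)
  have d: "f differentiable (at x)" "g differentiable (at x)" for x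
    using smooth smooth_differentiable by auto
  have "frechet_derivative (\<lambda>x. f x + g x) (at x) =
     (\<lambda>v. frechet_derivative f (at x) v + frechet_derivative g (at x) v)" for x
    using d by (intro frechet_derivative_at[symmetric] has_derivative_add)
       (auto simp: frechet_derivative_works[symmetric])
  then have "\<exists>f' g'. (\<lambda>x. frechet_derivative (\<lambda>x. f x + g x) (at x) v) = (\<lambda>x. f' x + g' x) \<and>
      smooth f' \<and> smooth g'" for v
    using smooth
    by (intro exI[of _ "\<lambda>x. frechet_derivative f (at x) v"] exI[of _ "\<lambda>x. frechet_derivative g (at x) v"])
       (simp add: smooth_frechet_derivative)
  with d show ?case by auto
qed

text \<open>Sums of products of smooth functions are closed under differentiation: this is the coinduction
  invariant that makes products smooth.\<close>

inductive product_sum :: "('a::euclidean_space \<Rightarrow> real) \<Rightarrow> bool" where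
  prod: "smooth f \<Longrightarrow> smooth g \<Longrightarrow> product_sum (\<lambda>x. f x * g x)"
| add: "product_sum f \<Longrightarrow> product_sum g \<Longrightarrow> product_sum (\<lambda>x. f x + g x)"

lemma product_sum_derivative:
  assumes "product_sum f"
  shows "(\<forall>x. f differentiable (at x)) \<and> (\<forall>v. product_sum (\<lambda>x. frechet_derivative f (at x) v))"
  using assms
proof induction
  case (prod f g)
  have d: "f differentiable (at x)" "g differentiable (at x)" for x
    using prod smooth_differentiable by auto
  have "frechet_derivative (\<lambda>x. f x * g x) (at x) =
     (\<lambda>v. f x * frechet_derivative g (at x) v + frechet_derivative f (at x) v * g x)" for x
    using d by (intro frechet_derivative_at[symmetric] has_derivative_mult)
       (auto simp: frechet_derivative_works[symmetric])
  with prod d show ?case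
    by (auto intro!: product_sum.intros smooth_frechet_derivative)
next
  case (add f g)
  then have "frechet_derivative (\<lambda>x. f x + g x) (at x) =
     (\<lambda>v. frechet_derivative f (at x) v + frechet_derivative g (at x) v)" for x
    by (intro frechet_derivative_at[symmetric] has_derivative_add)
       (auto simp: frechet_derivative_works[symmetric])
  with add show ?case
    by (auto intro!: product_sum.intros)
qed

lemma smooth_mult:
  assumes "smooth f" "smooth g"
  shows "smooth (\<lambda>x. f x * g x)"
proof -
  have "product_sum f \<Longrightarrow> smooth f" for f :: "'a \<Rightarrow> real"
  proof (coinduction arbitrary: f)
    case smooth
    then show ?case using product_sum_derivative[of f] by auto
  qed
  with assms show ?thesis by (blast intro: product_sum.prod)
qed

lemma frechet_derivative_affine:
  assumes "\<And>x. f differentiable (at x)" "bounded_linear L"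
  shows "frechet_derivative (\<lambda>x. f (L x + c)) (at x) v = frechet_derivative f (at (L x + c)) (L v)"
    and "(\<lambda>x. f (L x + c)) differentiable (at x)"
proof -
  have "((\<lambda>x. L x + c) has_derivative L) (at x)"
    using assms(2) by (auto intro!: derivative_eq_intros bounded_linear_imp_has_derivative)
  moreover have "(f has_derivative frechet_derivative f (at (L x + c))) (at (L x + c))"
    using assms(1) by (simp add: frechet_derivative_works[symmetric])
  ultimately have "((\<lambda>x. f (L x + c)) has_derivative
      (\<lambda>v. frechet_derivative f (at (L x + c)) (L v))) (at x)"
    using has_derivative_compose by blast
  then show "frechet_derivative (\<lambda>x. f (L x + c)) (at x) v =
      frechet_derivative f (at (L x + c)) (L v)" "(\<lambda>x. f (L x + c)) differentiable (at x)"
    by (auto simp: frechet_derivative_at[symmetric] differentiable_def)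
qed

text \<open>The coinduction invariant keeps the affine map fixed: differentiating in direction
  \<open>v\<close> replaces \<open>f\<close> by its derivative in direction \<open>L v\<close> and
  composes with the same map.\<close>

lemma smooth_affine:
  assumes "smooth f" "bounded_linear L"
  shows "smooth (\<lambda>x. f (L x + c))"
  using assms(1)
proof (coinduction arbitrary: f)
  case (smooth f)
  then have d: "\<And>x. f differentiable (at x)" by (simp add: smooth_differentiable)
  show ?case
    using smooth_frechet_derivative[OF smooth] 
    by (intro exI[of _ "\<lambda>x. f (L x + c)"])
       (auto simp: frechet_derivative_affine[OF d assms(2)] 
         intro!: exI[of _ "\<lambda>x. frechet_derivative f (at x) (L _)"])
qed

lemma frechet_derivative_real:
  fixes f :: "real \<Rightarrow> real"
  assumes "(f has_real_derivative d) (at x)"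
  shows "frechet_derivative f (at x) v = d * v"
  using assms unfolding has_field_derivative_def by (simp add: frechet_derivative_at[symmetric])

lemma smooth_has_real_derivative:
  fixes f :: "real \<Rightarrow> real"
  assumes "smooth f"
  shows "(f has_real_derivative deriv f x) (at x)"
  using smooth_differentiable[OF assms, of x] DERIV_deriv_iff_real_differentiable by blast

lemma smooth_deriv:
  fixes f :: "real \<Rightarrow> real"
  assumes "smooth f"
  shows "smooth (deriv f)"
  using smooth_frechet_derivative[OF assms, of 1]
  by (simp add: frechet_derivative_real[OF smooth_has_real_derivative[OF assms]])

lemma smooth_realI:
  fixes f :: "real \<Rightarrow> real"
  assumes "\<And>x. (f has_real_derivative f' x) (at x)" "smooth f'"
  shows "smooth f"
proof (rule smooth.intros)
  show "f differentiable (at x)" for x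
    using assms(1) real_differentiable_def by blast
  show "smooth (\<lambda>x. frechet_derivative f (at x) v)" for v
    by (simp add: frechet_derivative_real[OF assms(1)] smooth_mult smooth_const assms(2))
qed

text \<open>The functions $p(1/x)\,e^{-1/x}$ with $p$ a polynomial are closed under differentiation, so all
  of them are smooth at once by coinduction.\<close>

definition flat :: "real poly \<Rightarrow> real \<Rightarrow> real" where
  "flat p x = (if x > 0 then poly p (1 / x) * exp (- 1 / x) else 0)"

lemma poly_exp_tendsto_0: "((\<lambda>y. poly p y * exp (- y)) \<longlongrightarrow> 0) at_top" for p :: "real poly"
proof -
  have "((\<lambda>y::real. \<Sum>i\<le>degree p. coeff p i * (y ^ i * exp (- y))) \<longlongrightarrow> (\<Sum>i\<le>degree p. coeff p i * 0)) at_top"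
    by (intro tendsto_sum tendsto_mult tendsto_const) real_asymp
  then show ?thesis by (simp add: poly_altdef sum_distrib_right mult.assoc)
qed

text \<open>This is the difference quotient at 0. With y = 1/x the division by x becomes one more
  factor y, hence the polynomial \<open>pCons 0 p\<close>, and the exponential still wins.\<close>

lemma flat_tendsto_0: "((\<lambda>x. flat p x / x) \<longlongrightarrow> 0) (at 0)"
proof -
  have "((\<lambda>y. poly (pCons 0 p) y * exp (- y)) \<longlongrightarrow> 0) at_top" by (rule poly_exp_tendsto_0)
  then have "((\<lambda>x. poly (pCons 0 p) (inverse x) * exp (- inverse x)) \<longlongrightarrow> 0) (at_right (0::real))"
    by (rule filterlim_compose[OF _ filterlim_inverse_at_top_right])
  then have r: "((\<lambda>x. flat p x / x) \<longlongrightarrow> 0) (at_right 0)"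
    by (rule Lim_transform_eventually)
      (auto simp: flat_def eventually_at_right_less field_simps intro!: eventually_at_rightI[of 0 1])
  have "((\<lambda>x. flat p x / x) \<longlongrightarrow> 0) (at_left 0)"
    by (rule Lim_transform_eventually[OF tendsto_const])
       (auto simp: flat_def intro!: eventually_at_leftI[of "-1" 0])
  with r show ?thesis by (simp add: filterlim_split_at)
qed

text \<open>With y = 1/x one has d/dx = -y^2 d/dy, and the y-derivative of p(y) e^{-y} is (p' -
  p)(y) e^{-y}; this produces the polynomial y^2 (p - p').\<close>

lemma flat_derivative:
  "(flat p has_real_derivative flat ([:0, 0, 1:] * (p - pderiv p)) x) (at x)"
proof (cases x "0::real" rule: linorder_cases)
  case less
  have "((\<lambda>x. 0) has_real_derivative 0) (at x)" by simp
  then have "(flat p has_real_derivative 0) (at x)"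
    by (rule DERIV_cong_ev[THEN iffD1, rotated 3, OF _ refl _ refl])
       (use less in \<open>auto simp: flat_def eventually_nhds intro!: exI[of _ "{..<0}"]\<close>)
  then show ?thesis using less by (simp add: flat_def)
next
  case equal
  then show ?thesis
    using flat_tendsto_0[of p] by (simp add: has_field_derivative_iff flat_def)
next
  case greater
  have "((\<lambda>x. poly p (1 / x) * exp (- 1 / x)) has_real_derivative
     flat ([:0, 0, 1:] * (p - pderiv p)) x) (at x)"
    using greater by (auto intro!: derivative_eq_intros DERIV_chain2[OF poly_DERIV]
      simp: flat_def field_simps power2_eq_square)
  then show ?thesis
    by (rule DERIV_cong_ev[THEN iffD1, rotated 3, OF _ refl _ refl])
       (use greater in \<open>auto simp: flat_def eventually_nhds intro!: exI[of _ "{0<..}"]\<close>)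
qed

lemma smooth_flat: "smooth (flat p)"
proof (coinduction arbitrary: p)
  case smooth
  \<comment> \<open>\<open>smult\<close> absorbs the direction \<open>v\<close> into the polynomial,
    so every directional derivative is again of the form \<open>flat q\<close>.\<close>
  have "(\<lambda>x. frechet_derivative (flat p) (at x) v) = flat (smult v ([:0, 0, 1:] * (p - pderiv p)))" for v
    by (auto simp: frechet_derivative_real[OF flat_derivative] flat_def fun_eq_iff)
  then show ?case 
    using flat_derivative real_differentiable_def by (auto simp del: smult_pCons mult_pCons_left)
qed

definition bump :: "real \<Rightarrow> real" where
  "bump x = flat 1 x * flat 1 (1 - x)"

lemma smooth_bump: "smooth bump"
proof -
  have "smooth (\<lambda>x. flat 1 (- x + 1))"
    by (intro smooth_affine[OF smooth_flat] bounded_linear_minus bounded_linear_ident)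
  then have "smooth (\<lambda>x. flat 1 x * flat 1 (- x + 1))"
    by (intro smooth_mult smooth_flat)
  then show ?thesis by (simp add: bump_def[abs_def] algebra_simps)
qed

lemma continuous_on_smooth:
  fixes f :: "real \<Rightarrow> real"
  shows "smooth f \<Longrightarrow> continuous_on S f"
  by (meson smooth_differentiable continuous_at_imp_continuous_on differentiable_imp_continuous_within)

lemma bump_nonneg: "0 \<le> bump x" and bump_pos: "0 < x \<Longrightarrow> x < 1 \<Longrightarrow> 0 < bump x"
  and bump_zero: "x \<le> 0 \<or> 1 \<le> x \<Longrightarrow> bump x = 0"
  by (auto simp: bump_def flat_def)

text \<open>\<open>\<Theta>\<close> is the primitive of \<open>bump\<close>, normalised to end at 1.
  Differences of translated and rescaled copies of \<open>\<Theta>\<close> are smoothed indicators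
  of intervals, and \<open>\<theta>\<close> is the one-sided mollifier that appears when they are
  differentiated.\<close>

lemma smooth_step:
  obtains \<Theta> \<theta> :: "real \<Rightarrow> real" where
    "smooth \<Theta>" "\<And>x. (\<Theta> has_real_derivative \<theta> x) (at x)" "continuous_on UNIV \<theta>" "\<And>x. 0 \<le> \<theta> x"
    "\<And>x. x \<le> 0 \<Longrightarrow> \<Theta> x = 0 \<and> \<theta> x = 0" "\<And>x. 1 \<le> x \<Longrightarrow> \<Theta> x = 1 \<and> \<theta> x = 0"
proof -
  define F where "F x = (LBINT y=0..x. bump y)" for x :: real
  have F: "(F has_real_derivative bump x) (at x)" for x
  proof -
    define a b where "a = min 0 x - 1" and "b = max 0 x + 1"
    have "(F has_vector_derivative bump x) (at x within {a..b})"
      unfolding F_def zero_ereal_def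
      by (rule interval_integral_FTC2) (auto simp: a_def b_def continuous_on_smooth smooth_bump)
    moreover have "at x within {a..b} = at x"
      by (rule at_within_interior) (auto simp: a_def b_def)
    ultimately show ?thesis by (simp add: has_real_derivative_iff_has_vector_derivative)
  qed
  have F0: "F 0 = 0" by (simp add: F_def zero_ereal_def)
  \<comment> \<open>On either side of [0,1] the derivative \<open>bump\<close> vanishes, so
    \<open>F\<close> is both nondecreasing and nonincreasing there.\<close>
  have le: "F x = F y" if "x \<le> y" "y \<le> 0 \<or> 1 \<le> x" for x y
  proof (rule antisym)
    show "F x \<le> F y"
      using F bump_nonneg by (intro DERIV_nonneg_imp_nondecreasing[OF that(1)]) blast
    show "F y \<le> F x"
      using F that(2) bump_zero
      by (intro DERIV_nonpos_imp_nonincreasing[OF that(1)]) fastforce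
  qed
  have "F 0 < F 1"
  proof (rule DERIV_pos_imp_increasing_open[where f = F])
    show "\<exists>y. (F has_real_derivative y) (at x) \<and> 0 < y" if "0 < x" "x < 1" for x
      using F bump_pos that by blast
    show "continuous_on {0..1} F"
      using F DERIV_isCont continuous_at_imp_continuous_on by blast
  qed simp
  with F0 have F1: "0 < F 1" by simp
  show ?thesis
  proof (rule that[of "\<lambda>x. 1 / F 1 * F x" "\<lambda>x. 1 / F 1 * bump x"])
    show "smooth (\<lambda>x. 1 / F 1 * F x)"
      using smooth_realI[OF F smooth_bump] by (intro smooth_mult smooth_const)
    show "((\<lambda>x. 1 / F 1 * F x) has_real_derivative 1 / F 1 * bump x) (at x)" for x
      by (intro DERIV_cmult F)
    show "continuous_on UNIV (\<lambda>x. 1 / F 1 * bump x)"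
      by (intro continuous_intros continuous_on_smooth smooth_bump)
      show "1 / F 1 * F x = 0 \<and> 1 / F 1 * bump x = 0" if "x \<le> 0" for x
      using le[of x 0] F0 that by (simp add: bump_zero)
    show "1 / F 1 * F x = 1 \<and> 1 / F 1 * bump x = 0" if "1 \<le> x" for x
      using le[of 1 x] F1 that by (simp add: bump_zero)
  qed (use F1 in \<open>simp add: bump_nonneg\<close>)
qed

section \<open>Primitives and weak derivatives\<close>

text \<open>Local absolute continuity of \<open>F\<close> with density \<open>f\<close>, phrased
  through integrals so that \<open>f\<close> matters only up to null sets. Only intervals inside
  \<open>S\<close> are tested: if \<open>S\<close> has several components, the values of
  \<open>F\<close> on them are unrelated, which leaves room for a jump at a removed point.\<close>

definition primitive_on :: "real set \<Rightarrow> (real \<Rightarrow> complex) \<Rightarrow> (real \<Rightarrow> complex) \<Rightarrow> bool" where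
  "primitive_on S F f \<longleftrightarrow> (\<forall>x y. x \<le> y \<and> {x..y} \<subseteq> S \<longrightarrow>
     set_integrable lborel {x..y} f \<and> F y - F x = (LINT z:{x..y}|lborel. f z))"

lemma primitive_on_integrable:
  "primitive_on S F f \<Longrightarrow> {x..y} \<subseteq> S \<Longrightarrow> set_integrable lborel {x..y} f"
  unfolding primitive_on_def by (cases "x \<le> y") (auto simp: set_integrable_def)

lemma primitive_on_integral:
  "primitive_on S F f \<Longrightarrow> x \<le> y \<Longrightarrow> {x..y} \<subseteq> S \<Longrightarrow> F y - F x = (LINT z:{x..y}|lborel. f z)"
  unfolding primitive_on_def by auto

lemma primitive_on_subset: "primitive_on S F f \<Longrightarrow> S' \<subseteq> S \<Longrightarrow> primitive_on S' F f"
  unfolding primitive_on_def by auto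

lemma primitive_on_continuous:
  assumes "primitive_on S F f" "{a..b} \<subseteq> S"
  shows "continuous_on {a..b} F"
proof (cases "a \<le> b")
  case True
  have int: "set_integrable lborel {a..b} f" using primitive_on_integrable[OF assms] .
  have "F x = F a + integral {a..x} f" if "x \<in> {a..b}" for x
  proof -
    have s: "{a..x} \<subseteq> S" using that assms(2) by auto
    then have "set_integrable lborel {a..x} f" using assms(1) primitive_on_integrable by blast
    then show ?thesis
      using primitive_on_integral[OF assms(1) _ s] that by (simp add: set_borel_integral_eq_integral(2) algebra_simps)
  qed
  moreover have "continuous_on {a..b} (\<lambda>x. F a + integral {a..x} f)"
    by (intro continuous_intros indefinite_integral_continuous_1 set_borel_integral_eq_integral(1) int)
  ultimately show ?thesis by (metis (no_types, lifting) continuous_on_cong)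
qed simp

lemma primitive_on_UNIV_continuous: "primitive_on UNIV F f \<Longrightarrow> continuous_on UNIV F"
proof -
  assume p: "primitive_on UNIV F f"
  have "isCont F x" for x
  proof -
    have "continuous_on {x-1..x+1} F" using primitive_on_continuous[OF p] by blast
    then show ?thesis by (rule continuous_on_interior) simp
  qed
  then show ?thesis by (simp add: continuous_at_imp_continuous_on)
qed

lemma integrable_tensor:
  fixes f g :: "real \<Rightarrow> complex"
  assumes f: "integrable lborel f" and g: "integrable lborel g"
  shows "integrable (lborel \<Otimes>\<^sub>M lborel) (\<lambda>(x, y). f x * g y)"
proof (rule lborel_pair.Fubini_integrable)
  have [measurable]: "f \<in> borel_measurable borel" "g \<in> borel_measurable borel"
    using f g by auto
  show "(\<lambda>(x, y). f x * g y) \<in> borel_measurable (lborel \<Otimes>\<^sub>M lborel)" by measurable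
  show "integrable lborel (\<lambda>x. LINT y|lborel. cmod (case (x, y) of (x, y) \<Rightarrow> f x * g y))"
    using f by (simp add: norm_mult)
  show "AE x in lborel. integrable lborel (\<lambda>y. case (x, y) of (x, y) \<Rightarrow> f x * g y)"
    using g by simp
qed

lemma set_integrable_continuous_mult:
  fixes F f :: "real \<Rightarrow> complex"
  assumes "continuous_on {a..b} F" "set_integrable lborel {a..b} f"
  shows "set_integrable lborel {a..b} (\<lambda>x. F x * f x)"
proof -
  have "compact (F ` {a..b})" using assms(1) compact_Icc by (rule compact_continuous_image)
  then obtain B where B: "\<And>x. x \<in> {a..b} \<Longrightarrow> cmod (F x) \<le> B"
    using compact_imp_bounded bounded_iff by (metis imageI)
  define F' where "F' x = indicator {a..b} x *\<^sub>R F x" for x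
  have [measurable]: "F' \<in> borel_measurable borel"
    unfolding F'_def by (rule borel_measurable_continuous_on_indicator) (use assms in auto)
  have f: "integrable lborel (\<lambda>x. indicator {a..b} x *\<^sub>R f x)"
    using assms(2) by (simp add: set_integrable_def)
  have [measurable]: "(\<lambda>x. indicator {a..b} x *\<^sub>R f x) \<in> borel_measurable borel"
    using f by auto
  have "integrable lborel (\<lambda>x. F' x * (indicator {a..b} x *\<^sub>R f x))"
  proof (rule Bochner_Integration.integrable_bound[OF integrable_scaleR_right[OF f, of B]])
    show "AE x in lborel. cmod (F' x * (indicator {a..b} x *\<^sub>R f x)) \<le> cmod (B *\<^sub>R (indicator {a..b} x *\<^sub>R f x))"
      using B by (auto simp: F'_def norm_mult indicator_def
          intro!: AE_I2 mult_right_mono order.trans[OF _ abs_ge_self])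
  qed measurable
  moreover have eq: "F' x * (indicator {a..b} x *\<^sub>R f x) = indicator {a..b} x *\<^sub>R (F x * f x)" for x
    by (auto simp: F'_def indicator_def)
  ultimately show ?thesis unfolding set_integrable_def eq by simp
qed

text \<open>The integrands need not be continuous, so this is Fubini on the triangle rather than the
  product rule.\<close>

lemma primitive_ibp:
  assumes F: "primitive_on {a..b} F f" and G: "primitive_on {a..b} G g" and ab: "a \<le> b"
  shows "(LINT x:{a..b}|lborel. F x * g x) + (LINT x:{a..b}|lborel. f x * G x) = F b * G b - F a * G a"
    and "set_integrable lborel {a..b} (\<lambda>x. F x * g x)" "set_integrable lborel {a..b} (\<lambda>x. f x * G x)"
proof -
  have intf: "set_integrable lborel {a..b} f" and intg: "set_integrable lborel {a..b} g"
    using primitive_on_integrable[OF F] primitive_on_integrable[OF G] by auto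
  show Fg: "set_integrable lborel {a..b} (\<lambda>x. F x * g x)"
    using set_integrable_continuous_mult[OF primitive_on_continuous[OF F] intg] by simp
  show fG: "set_integrable lborel {a..b} (\<lambda>x. f x * G x)"
    using set_integrable_continuous_mult[OF primitive_on_continuous[OF G] intf] by (simp add: mult.commute)
  define f' g' where "f' x = indicator {a..b} x *\<^sub>R f x" and "g' x = indicator {a..b} x *\<^sub>R g x" for x
  have i: "integrable lborel f'" "integrable lborel g'"
    using intf intg unfolding f'_def g'_def set_integrable_def by auto
  have [measurable]: "f' \<in> borel_measurable borel" "g' \<in> borel_measurable borel"
    using i by auto
  \<comment> \<open>On the triangle y \<le> x, integrating in y first leaves
    \<open>f x * (G x - G a)\<close>, integrating in x first leaves
    \<open>(F b - F y) * g y\<close>; equating the two is the claim up to boundary terms.\<close>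
  define H where "H x y = (if y \<le> x then f' x * g' y else 0)" for x y
  have iH: "integrable (lborel \<Otimes>\<^sub>M lborel) (\<lambda>(x, y). H x y)"
    by (rule Bochner_Integration.integrable_bound[OF integrable_tensor[OF i]])
       (auto simp: H_def split: prod.splits)
  have "(LINT x|lborel. LINT y|lborel. H x y) = (LINT y|lborel. LINT x|lborel. H x y)"
    using lborel_pair.Fubini_integral[OF iH] by simp
  moreover have "(LINT x|lborel. LINT y|lborel. H x y) = (LINT x:{a..b}|lborel. f x * G x - f x * G a)"
    unfolding set_lebesgue_integral_def
  proof (intro Bochner_Integration.integral_cong refl)
    fix x
    show "(LINT y|lborel. H x y) = indicator {a..b} x *\<^sub>R (f x * G x - f x * G a)"
    proof (cases "x \<in> {a..b}")
      case True
      have "(LINT y|lborel. H x y) = (LINT y|lborel. f x * (indicator {a..x} y *\<^sub>R g y))"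
        by (intro Bochner_Integration.integral_cong refl)
           (use True in \<open>auto simp: H_def f'_def g'_def indicator_def\<close>)
      also have "\<dots> = f x * (LINT y|lborel. indicator {a..x} y *\<^sub>R g y)"
        by (rule integral_mult_right_zero)
      also have "\<dots> = f x * (G x - G a)"
        using primitive_on_integral[OF G, of a x] True by (auto simp: set_lebesgue_integral_def)
      finally show ?thesis using True by (simp add: algebra_simps)
    next
      case False
      then have "f' x = 0" by (simp add: f'_def)
      with False show ?thesis by (simp add: H_def[abs_def] cong: if_cong)
    qed
  qed
  moreover have "(LINT y|lborel. LINT x|lborel. H x y) = (LINT y:{a..b}|lborel. F b * g y - F y * g y)"
    unfolding set_lebesgue_integral_def
  proof (intro Bochner_Integration.integral_cong refl)
    fix y
    show "(LINT x|lborel. H x y) = indicator {a..b} y *\<^sub>R (F b * g y - F y * g y)"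
    proof (cases "y \<in> {a..b}")
      case True
      have "(LINT x|lborel. H x y) = (LINT x|lborel. (indicator {y..b} x *\<^sub>R f x) * g y)"
        by (intro Bochner_Integration.integral_cong refl)
           (use True in \<open>auto simp: H_def f'_def g'_def indicator_def\<close>)
      also have "\<dots> = (LINT x|lborel. indicator {y..b} x *\<^sub>R f x) * g y"
        by (rule integral_mult_left_zero)
      also have "\<dots> = (F b - F y) * g y"
        using primitive_on_integral[OF F, of y b] True by (auto simp: set_lebesgue_integral_def)
      finally show ?thesis using True by (simp add: algebra_simps)
    next
      case False
      then have "g' y = 0" by (simp add: g'_def)
      with False show ?thesis by (simp add: H_def[abs_def] cong: if_cong)
    qed
  qed
  moreover have "(LINT x:{a..b}|lborel. f x * G x - f x * G a) = 
      (LINT x:{a..b}|lborel. f x * G x) - (F b - F a) * G a"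
    using primitive_on_integral[OF F, of a b] ab fG intf by (simp add: set_integral_diff)
  moreover have "(LINT x:{a..b}|lborel. F b * g x - F x * g x) = 
      F b * (G b - G a) - (LINT x:{a..b}|lborel. F x * g x)"
    using primitive_on_integral[OF G, of a b] ab Fg intg by (simp add: set_integral_diff)
  ultimately have "(LINT x:{a..b}|lborel. f x * G x) - (F b - F a) * G a =
      F b * (G b - G a) - (LINT x:{a..b}|lborel. F x * g x)" by argo
  then have "(LINT x:{a..b}|lborel. F x * g x) + (LINT x:{a..b}|lborel. f x * G x) =
      F b * (G b - G a) + (F b - F a) * G a" by (simp add: algebra_simps)
  then show "(LINT x:{a..b}|lborel. F x * g x) + (LINT x:{a..b}|lborel. f x * G x) = F b * G b - F a * G a"
    by (simp add: algebra_simps)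
qed

text \<open>Substituting z = a + (d/(n+1)) s turns the integral into an average of \<open>u\<close>
  over points shrinking to \<open>a\<close> from the right. The kernel is one-sided, so continuity
  of \<open>u\<close> on [a, a+d] is enough.\<close>

lemma approximate_identity:
  fixes u :: "real \<Rightarrow> complex" and \<theta> :: "real \<Rightarrow> real"
  assumes \<theta>: "continuous_on UNIV \<theta>" "\<And>s. s \<le> 0 \<or> 1 \<le> s \<Longrightarrow> \<theta> s = 0" "(LINT s|lborel. \<theta> s) = 1"
    and u: "continuous_on {a..a+d} u" and d: "0 < d"
  shows "(\<lambda>n. LINT z|lborel. u z * of_real (\<theta> ((z - a) / (d / Suc n)) / (d / Suc n))) \<longlonglongrightarrow> u a"
    and "integrable lborel (\<lambda>z. u z * of_real (\<theta> ((z - a) / (d / Suc n)) / (d / Suc n)))"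
proof -
  \<comment> \<open>Cutting \<open>u\<close> off makes it bounded and measurable on the whole line
    without changing any integrand, since the rescaled kernel lives inside [a, a+d].\<close>
  define U where "U z = indicator {a..a+d} z *\<^sub>R u z" for z
  have [measurable]: "U \<in> borel_measurable borel"
    unfolding U_def by (rule borel_measurable_continuous_on_indicator) (use u in auto)
  have [measurable]: "\<theta> \<in> borel_measurable borel"
    using \<theta>(1) by (rule borel_measurable_continuous_onI)
  have "compact (u ` {a..a+d})" using u compact_Icc by (rule compact_continuous_image)
  then obtain B where B: "\<And>x. x \<in> {a..a+d} \<Longrightarrow> cmod (u x) \<le> B"
    using compact_imp_bounded bounded_iff by (metis imageI)
  have B0: "0 \<le> B" using B[of a] d by (smt (verit) atLeastAtMost_iff norm_ge_zero)
  have BU: "cmod (U z) \<le> B" for z using B B0 by (auto simp: U_def indicator_def)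
  have "integrable lborel (\<lambda>x. indicator {0..1} x *\<^sub>R \<theta> x)"
    by (rule borel_integrable_compact) (use \<theta>(1) continuous_on_subset in auto)
  moreover have eq: "indicator {0..1} x *\<^sub>R \<theta> x = \<theta> x" for x
    using \<theta>(2)[of x] by (cases "x \<le> 0 \<or> 1 \<le> x") (auto simp: indicator_def)
  ultimately have i\<theta>: "integrable lborel \<theta>" unfolding eq by simp
  define e where "e n = d / Suc n" for n
  have e0: "e n > 0" for n using d by (simp add: e_def)
  have ed: "e n \<le> d" for n using d by (simp add: e_def field_simps)
  have e_lim: "e \<longlonglongrightarrow> 0"
    unfolding e_def using LIMSEQ_Suc[OF lim_const_over_n[of d]] by simp
  have eq: "u z * of_real (\<theta> ((z - a) / e n) / e n) = U z * of_real (\<theta> ((z - a) / e n) / e n)" for z n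
  proof (cases "\<theta> ((z - a) / e n) = 0")
    case False
    with \<theta>(2) have "0 < (z - a) / e n" "(z - a) / e n < 1" by (meson not_le)+
    then have "a < z" "z < a + e n" using e0[of n] by (auto simp: field_simps zero_less_divide_iff)
    with ed[of n] show ?thesis by (simp add: U_def)
  qed simp
  have int: "integrable lborel (\<lambda>s. U (a + e n * s) * of_real (\<theta> s))" for n
    by (rule Bochner_Integration.integrable_bound[OF integrable_mult_right[OF i\<theta>, of B]])
       (use BU B0 in \<open>auto simp: norm_mult abs_mult intro!: AE_I2 mult_right_mono\<close>)
  have resc: "(LINT z|lborel. U z * of_real (\<theta> ((z - a) / e n) / e n)) =
      (LINT s|lborel. U (a + e n * s) * of_real (\<theta> s))" for n
    using e0[of n] by (subst lborel_integral_real_affine[of "e n" _ a])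
      (auto simp flip: integral_scaleR_right intro!: Bochner_Integration.integral_cong simp: scaleR_conv_of_real)
  have "integrable lborel (\<lambda>z. U z * of_real (\<theta> ((z - a) / e n) / e n))"
  proof -
    have "integrable lborel (\<lambda>z. U z * of_real (\<theta> ((z - a) / e n) / e n)) \<longleftrightarrow>
       integrable lborel (\<lambda>s. U (a + e n * s) * of_real (\<theta> s / e n))"
      using e0[of n] by (subst lborel_integrable_real_affine_iff[of "e n" _ a, symmetric]) auto
    then show ?thesis using integrable_divide[OF int[of n], of "of_real (e n)"] by simp
  qed
  then show "integrable lborel (\<lambda>z. u z * of_real (\<theta> ((z - a) / (d / Suc n)) / (d / Suc n)))"
    unfolding e_def[symmetric] eq .
  have "(\<lambda>n. LINT s|lborel. U (a + e n * s) * of_real (\<theta> s)) \<longlonglongrightarrow> (LINT s|lborel. u a * of_real (\<theta> s))"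
  proof (rule integral_dominated_convergence[where w="\<lambda>s. B * \<bar>\<theta> s\<bar>"])
    show "integrable lborel (\<lambda>s. B * \<bar>\<theta> s\<bar>)" using i\<theta> by simp
    show "AE s in lborel. (\<lambda>n. U (a + e n * s) * of_real (\<theta> s)) \<longlonglongrightarrow> u a * of_real (\<theta> s)"
    proof (rule AE_I2)
      fix s
      show "(\<lambda>n. U (a + e n * s) * of_real (\<theta> s)) \<longlonglongrightarrow> u a * of_real (\<theta> s)"
      proof (cases "0 \<le> s \<and> s \<le> 1")
        case True
        have mem: "a + e n * s \<in> {a..a+d}" for n
        proof -
          have "e n * s \<le> d * 1" using True ed[of n] d by (intro mult_mono) auto
          then show ?thesis using True e0[of n] by simp
        qed
        have "(\<lambda>n. u (a + e n * s)) \<longlonglongrightarrow> u a"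
        proof (rule continuous_on_tendsto_compose[OF u])
          show "(\<lambda>n. a + e n * s) \<longlonglongrightarrow> a"
            using tendsto_add[OF tendsto_const tendsto_mult[OF e_lim tendsto_const], of a s] by simp
        qed (use mem d in auto)
        then have "(\<lambda>n. U (a + e n * s)) \<longlonglongrightarrow> u a" using mem by (simp add: U_def)
        then show ?thesis by (intro tendsto_intros)
      next
        case False
        then show ?thesis using \<theta>(2)[of s] by auto
      qed
    qed
  qed (use BU in \<open>auto simp: norm_mult intro!: mult_right_mono\<close>)
  moreover have "(LINT s|lborel. u a * of_real (\<theta> s)) = u a" using \<theta>(3) by simp
  ultimately show "(\<lambda>n. LINT z|lborel. u z * of_real (\<theta> ((z - a) / (d / Suc n)) / (d / Suc n))) \<longlonglongrightarrow> u a"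
    unfolding e_def[symmetric] eq resc by (simp only:)
qed


text \<open>Testing with a smoothed indicator of [x,y] gives the fundamental theorem in the limit:
  its derivative is the difference of two approximate identities, at x and at y, and the function
  itself tends to the indicator. It is applied both in space and in time.\<close>

lemma weak_derivative_imp_primitive:
  fixes u g :: "real \<Rightarrow> complex"
  assumes S: "open S" and u: "continuous_on S u"
    and g: "\<And>a b. {a..b} \<subseteq> S \<Longrightarrow> set_integrable lborel {a..b} g"
    and weak: "\<And>\<phi>. test_function S \<phi> \<Longrightarrow>
      (LINT z|lborel. u z * of_real (deriv \<phi> z)) = - (LINT z|lborel. g z * of_real (\<phi> z))"
  shows "primitive_on S u g"
  unfolding primitive_on_def
proof (intro allI impI conjI)
  fix x y assume xy: "x \<le> y \<and> {x..y} \<subseteq> S"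
  then show "set_integrable lborel {x..y} g" using g by blast
  have "y \<in> S" using xy by auto
  with S obtain e where "e > 0" "cball y e \<subseteq> S" using open_contains_cball by blast
  then obtain d where d: "0 < d" and "{y..y+d} \<subseteq> S"
    by (auto simp: cball_eq_atLeastAtMost intro!: that[of e])
  \<comment> \<open>The descending ramp starts at \<open>y\<close> and goes to the right, so the
    test functions need the extra room \<open>d\<close>, which openness of \<open>S\<close>
    provides.\<close>
  with xy have sub: "{x..y+d} \<subseteq> S" by force
  obtain \<Theta> \<theta> :: "real \<Rightarrow> real" where st: "smooth \<Theta>" "\<And>x. (\<Theta> has_real_derivative \<theta> x) (at x)"
    "continuous_on UNIV \<theta>" "\<And>x. 0 \<le> \<theta> x"
    "\<And>x. x \<le> 0 \<Longrightarrow> \<Theta> x = 0 \<and> \<theta> x = 0" "\<And>x. 1 \<le> x \<Longrightarrow> \<Theta> x = 1 \<and> \<theta> x = 0"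
    using smooth_step by blast
  have \<Theta>_le: "\<Theta> r \<le> \<Theta> s" if "r \<le> s" for r s
    using st(2,4) by (intro DERIV_nonneg_imp_nondecreasing[OF that]) blast
  have \<Theta>01: "0 \<le> \<Theta> r" "\<Theta> r \<le> 1" for r
    using \<Theta>_le[of "min r 0" r] \<Theta>_le[of r "max r 1"] st(5)[of "min r 0"] st(6)[of "max r 1"] by auto
  have \<theta>0: "s \<le> 0 \<or> 1 \<le> s \<Longrightarrow> \<theta> s = 0" for s using st(5,6) by auto
  have "has_bochner_integral lborel (\<lambda>x. \<theta> x * indicator {0..1} x) (\<Theta> 1 - \<Theta> 0)"
    by (rule has_bochner_integral_FTC_Icc_nonneg)
       (use st in \<open>auto intro: has_field_derivative_at_within borel_measurable_continuous_onI\<close>)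
  moreover have "\<theta> x * indicator {0..1} x = \<theta> x" for x
    using \<theta>0[of x] by (cases "x \<le> 0 \<or> 1 \<le> x") (auto simp: indicator_def)
  ultimately have \<theta>1: "(LINT s|lborel. \<theta> s) = 1"
    using st(5)[of 0] st(6)[of 1] by (simp add: has_bochner_integral_iff)
  define e where "e n = d / Suc n" for n
  have e0: "e n > 0" for n using d by (simp add: e_def)
  have ed: "e n \<le> d" for n using d by (simp add: e_def field_simps)
  \<comment> \<open>The factor \<open>(-1)\<close> instead of a subtraction fits
    \<open>smooth_add\<close> and \<open>smooth_mult\<close>.\<close>
  define \<phi> where "\<phi> n z = \<Theta> ((z - x) / e n) + (-1) * \<Theta> ((z - y) / e n)" for n z
  have sm: "smooth (\<phi> n)" for n
  proof -
    have "smooth (\<lambda>z. \<Theta> ((1 / e n) * z + (- a / e n)))" for a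
      by (rule smooth_affine[OF st(1)]) (rule bounded_linear_mult_right)
    then have "smooth (\<lambda>z. \<Theta> ((z - a) / e n))" for a
      by (simp add: diff_divide_distrib)
    then show ?thesis unfolding \<phi>_def by (intro smooth_add smooth_mult smooth_const)
  qed
  have dphi: "deriv (\<phi> n) z = \<theta> ((z - x) / e n) / e n - \<theta> ((z - y) / e n) / e n" for n z
  proof -
    have "((\<lambda>z. \<Theta> ((z - a) / e n)) has_real_derivative \<theta> ((z - a) / e n) / e n) (at z)" for a
    proof -
      have "((\<lambda>z. (z - a) / e n) has_real_derivative 1 / e n) (at z)"
        using e0[of n] by (auto intro!: derivative_eq_intros)
      from DERIV_chain2[OF st(2) this] show ?thesis by simp
    qed
    then show ?thesis unfolding \<phi>_def
      by (intro DERIV_imp_deriv) (auto intro!: derivative_eq_intros)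
  qed
  have zero: "\<phi> n z = 0" if "z \<notin> {x..y+d}" for n z
  proof (cases "z < x")
    case True
    then have "(z - x) / e n \<le> 0" "(z - y) / e n \<le> 0"
      using xy e0[of n] by (auto simp: divide_le_0_iff)
    then show ?thesis using st(5) by (simp add: \<phi>_def)
  next
    case False
    then have "1 \<le> (z - x) / e n" "1 \<le> (z - y) / e n"
      using xy e0[of n] ed[of n] that by (auto simp: field_simps)
    then show ?thesis using st(6) by (simp add: \<phi>_def)
  qed
  have cl: "closure {z. \<phi> n z \<noteq> 0} \<subseteq> {x..y+d}" for n
  proof (rule closure_minimal)
    show "{z. \<phi> n z \<noteq> 0} \<subseteq> {x..y+d}" using zero by blast
  qed simp
  then have "compact (closure {z. \<phi> n z \<noteq> 0})" for n
    by (metis bounded_closed_interval bounded_subset closed_closure compact_eq_bounded_closed)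
  with cl sm sub have "test_function S (\<phi> n)" for n
    unfolding test_function_def by blast
  then have id: "(LINT z|lborel. u z * of_real (deriv (\<phi> n) z)) = - (LINT z|lborel. g z * of_real (\<phi> n z))" for n
    by (rule weak)
  have ux: "continuous_on {x..x+d} u" and uy: "continuous_on {y..y+d} u"
    using xy sub by (auto intro!: continuous_on_subset[OF u])
  have l1: "(\<lambda>n. (LINT z|lborel. u z * of_real (deriv (\<phi> n) z))) \<longlonglongrightarrow> u x - u y"
  proof -
    have "(LINT z|lborel. u z * of_real (deriv (\<phi> n) z)) =
       (LINT z|lborel. u z * of_real (\<theta> ((z - x) / e n) / e n)) -
       (LINT z|lborel. u z * of_real (\<theta> ((z - y) / e n) / e n))" for n
      unfolding dphi of_real_diff right_diff_distrib e_def
      by (intro Bochner_Integration.integral_diff approximate_identity(2) st(3) \<theta>0 \<theta>1 ux uy d)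
    moreover have "(\<lambda>n. LINT z|lborel. u z * of_real (\<theta> ((z - x) / e n) / e n)) \<longlonglongrightarrow> u x"
      unfolding e_def by (intro approximate_identity(1) st(3) \<theta>0 \<theta>1 ux uy d)
    moreover have "(\<lambda>n. LINT z|lborel. u z * of_real (\<theta> ((z - y) / e n) / e n)) \<longlonglongrightarrow> u y"
      unfolding e_def by (intro approximate_identity(1) st(3) \<theta>0 \<theta>1 ux uy d)
    ultimately show ?thesis by (simp add: tendsto_diff)
  qed
  \<comment> \<open>The limit is the indicator of the half-open interval (x,y] because
    \<open>\<Theta> 0 = 0\<close> at both ramps; the endpoint x is discarded below as a null
    set.\<close>
  have l2: "(\<lambda>n. LINT z|lborel. g z * of_real (\<phi> n z)) \<longlonglongrightarrow> (LINT z|lborel. indicator {x<..y} z *\<^sub>R g z)"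
  proof -
    define G where "G z = indicator {x..y+d} z *\<^sub>R g z" for z
    have iG: "integrable lborel G"
      using g[OF sub] by (simp add: G_def[abs_def] set_integrable_def)
    have [measurable]: "G \<in> borel_measurable borel" using iG by auto
    have [measurable]: "\<phi> n \<in> borel_measurable borel" for n
      using continuous_on_smooth[OF sm] by (rule borel_measurable_continuous_onI)
    have b: "\<bar>\<phi> n z\<bar> \<le> 1" for n z
      using \<Theta>01[of "(z - x) / e n"] \<Theta>01[of "(z - y) / e n"] by (simp add: \<phi>_def abs_le_iff)
    have ev: "\<forall>\<^sub>F n in sequentially. \<Theta> ((z - a) / e n) = (if a < z then 1 else 0)" for a z
    proof (cases "a < z")
      case True
      have "\<forall>\<^sub>F n in sequentially. nat \<lceil>d / (z - a)\<rceil> \<le> n"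
        by (rule eventually_ge_at_top)
      then show ?thesis
      proof eventually_elim
        case (elim n)
        then have "d / (z - a) \<le> real n" by linarith
        then have "1 \<le> (z - a) / e n" using True d e0[of n]
          by (simp add: e_def field_simps)
        then show ?case using st(6) True by simp
      qed
    next
      case False
      then have "(z - a) / e n \<le> 0" for n using e0[of n] by (simp add: divide_le_0_iff)
      then show ?thesis using st(5) False by simp
    qed
    have "(\<lambda>n. LINT z|lborel. G z * of_real (\<phi> n z)) \<longlonglongrightarrow> (LINT z|lborel. indicator {x<..y} z *\<^sub>R G z)"
    proof (rule integral_dominated_convergence[where w="\<lambda>z. cmod (G z)"])
      show "AE z in lborel. (\<lambda>n. G z * of_real (\<phi> n z)) \<longlonglongrightarrow> indicator {x<..y} z *\<^sub>R G z"
      proof (rule AE_I2)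
        fix z
        have "\<forall>\<^sub>F n in sequentially. indicator {x<..y} z *\<^sub>R G z = G z * of_real (\<phi> n z)"
          using ev[of z x] ev[of z y]
          by eventually_elim (use xy in \<open>auto simp: \<phi>_def indicator_def\<close>)
        then show "(\<lambda>n. G z * of_real (\<phi> n z)) \<longlonglongrightarrow> indicator {x<..y} z *\<^sub>R G z"
          by (rule Lim_transform_eventually[OF tendsto_const])
      qed
      show "AE z in lborel. cmod (G z * of_real (\<phi> n z)) \<le> cmod (G z)" for n
        using b by (auto simp: norm_mult intro!: AE_I2 mult_left_le)
    qed (use iG in auto)
    moreover have "G z * of_real (\<phi> n z) = g z * of_real (\<phi> n z)" for n z
      using zero[of z n] by (cases "z \<in> {x..y+d}") (auto simp: G_def)
    moreover have "indicator {x<..y} z *\<^sub>R G z = indicator {x<..y} z *\<^sub>R g z" for z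
      using d by (auto simp: G_def indicator_def)
    ultimately show ?thesis by simp
  qed
  have "u x - u y = - (LINT z|lborel. indicator {x<..y} z *\<^sub>R g z)"
    using LIMSEQ_unique[OF l1[unfolded id] tendsto_minus[OF l2]] .
  moreover have "(LINT z:{x..y}|lborel. g z) = (LINT z|lborel. indicator {x<..y} z *\<^sub>R g z)"
    unfolding set_lebesgue_integral_def
  proof (rule integral_cong_AE)
    show "AE z in lborel. indicator {x..y} z *\<^sub>R g z = indicator {x<..y} z *\<^sub>R g z"
      using AE_lborel_singleton[of x] by eventually_elim (auto simp: indicator_def)
    have "integrable lborel (\<lambda>z. indicator {x..y} z *\<^sub>R g z)"
      using g xy by (auto simp: set_integrable_def)
    then have [measurable]: "(\<lambda>z. indicator {x..y} z *\<^sub>R g z) \<in> borel_measurable borel" by auto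
    then show "(\<lambda>z. indicator {x..y} z *\<^sub>R g z) \<in> borel_measurable lborel" by simp
    have "(\<lambda>z. indicator {x<..y} z *\<^sub>R (indicator {x..y} z *\<^sub>R g z)) \<in> borel_measurable lborel" by measurable
    then show "(\<lambda>z. indicator {x<..y} z *\<^sub>R g z) \<in> borel_measurable lborel"
      by (rule back_subst[of "\<lambda>f. f \<in> borel_measurable lborel"]) (auto simp: indicator_def)
  qed
  ultimately show "u y - u x = (LINT z:{x..y}|lborel. g z)"
    by (simp add: algebra_simps)
qed

section \<open>Square-integrable functions\<close>

lemma in_Lp_2_iff:
  "in_Lp M 2 f \<longleftrightarrow> f \<in> borel_measurable M \<and> integrable M (\<lambda>x. (norm (f x))\<^sup>2)"
  by (simp add: in_Lp_def)

lemma in_Lp_2D: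
  assumes "in_Lp M 2 f"
  shows "f \<in> borel_measurable M" "integrable M (\<lambda>x. (norm (f x))\<^sup>2)"
  using assms by (auto simp: in_Lp_2_iff)

lemma Lp_norm_2: "Lp_norm M 2 f = sqrt (LINT x|M. (norm (f x))\<^sup>2)"
  by (simp add: Lp_norm_def powr_half_sqrt)

lemma Lp_norm_2_power2: "(Lp_norm M 2 f)\<^sup>2 = (LINT x|M. (norm (f x))\<^sup>2)"
  by (simp add: Lp_norm_2)

lemma Lp_norm_2_nonneg: "0 \<le> Lp_norm M 2 f"
  by (simp add: Lp_norm_2)

lemma Cauchy_Schwarz_Lp_2:
  fixes f g :: "'a \<Rightarrow> complex"
  assumes f: "in_Lp M 2 f" and g: "in_Lp M 2 g"
  shows integrable_mult_Lp_2: "integrable M (\<lambda>x. f x * g x)"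
    and Cauchy_Schwarz_Lp_2_abs: "(LINT x|M. cmod (f x) * cmod (g x)) \<le> Lp_norm M 2 f * Lp_norm M 2 g"
    and Cauchy_Schwarz_Lp_2_norm: "cmod (LINT x|M. f x * g x) \<le> Lp_norm M 2 f * Lp_norm M 2 g"
proof -
  note [measurable] = in_Lp_2D(1)[OF f] in_Lp_2D(1)[OF g]
  have "integrable M (\<lambda>x. (cmod (f x))\<^sup>2 + (cmod (g x))\<^sup>2)"
    using f g by (auto dest: in_Lp_2D)
  then show int: "integrable M (\<lambda>x. f x * g x)"
  proof (rule Bochner_Integration.integrable_bound)
    show "AE x in M. cmod (f x * g x) \<le> norm ((cmod (f x))\<^sup>2 + (cmod (g x))\<^sup>2)"
    proof (rule AE_I2)
      fix x
      show "cmod (f x * g x) \<le> norm ((cmod (f x))\<^sup>2 + (cmod (g x))\<^sup>2)"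
        using sum_squares_bound[of "cmod (f x)" "cmod (g x)"]
          mult_nonneg_nonneg[OF norm_ge_zero[of "f x"] norm_ge_zero[of "g x"]]
        unfolding norm_mult real_norm_def by linarith
    qed
  qed measurable
  then have inta: "integrable M (\<lambda>x. cmod (f x) * cmod (g x))"
    using integrable_norm[OF int] by (simp add: norm_mult)
  define I where "I = (LINT x|M. cmod (f x) * cmod (g x))"
  have I0: "0 \<le> I" unfolding I_def by simp
  have "(\<integral>\<^sup>+x. ennreal (cmod (f x)) * ennreal (cmod (g x)) \<partial>M)\<^sup>2 \<le>
      (\<integral>\<^sup>+x. (ennreal (cmod (f x)))\<^sup>2 \<partial>M) * (\<integral>\<^sup>+x. (ennreal (cmod (g x)))\<^sup>2 \<partial>M)"
    by (rule Cauchy_Schwarz_nn_integral) measurable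
  also have "(\<integral>\<^sup>+x. ennreal (cmod (f x)) * ennreal (cmod (g x)) \<partial>M) = ennreal I"
    using nn_integral_eq_integral[OF inta] by (simp add: I_def ennreal_mult)
  also have "(\<integral>\<^sup>+x. (ennreal (cmod (f x)))\<^sup>2 \<partial>M) = ennreal ((Lp_norm M 2 f)\<^sup>2)"
    using nn_integral_eq_integral[OF in_Lp_2D(2)[OF f]] by (simp add: Lp_norm_2_power2 ennreal_power)
  also have "(\<integral>\<^sup>+x. (ennreal (cmod (g x)))\<^sup>2 \<partial>M) = ennreal ((Lp_norm M 2 g)\<^sup>2)"
    using nn_integral_eq_integral[OF in_Lp_2D(2)[OF g]] by (simp add: Lp_norm_2_power2 ennreal_power)
  finally have "I\<^sup>2 \<le> (Lp_norm M 2 f * Lp_norm M 2 g)\<^sup>2"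
    using I0 by (simp add: ennreal_power power_mult_distrib flip: ennreal_mult)
  then show le: "(LINT x|M. cmod (f x) * cmod (g x)) \<le> Lp_norm M 2 f * Lp_norm M 2 g"
    unfolding I_def by (rule power2_le_imp_le) (simp add: Lp_norm_2_nonneg)
  have "cmod (LINT x|M. f x * g x) \<le> (LINT x|M. cmod (f x * g x))"
    by (rule integral_norm_bound)
  with le show "cmod (LINT x|M. f x * g x) \<le> Lp_norm M 2 f * Lp_norm M 2 g"
    by (simp add: norm_mult)
qed

lemma in_Lp_2_add:
  fixes f g :: "'a \<Rightarrow> complex"
  assumes f: "in_Lp M 2 f" and g: "in_Lp M 2 g"
  shows "in_Lp M 2 (\<lambda>x. f x + g x)" "Lp_norm M 2 (\<lambda>x. f x + g x) \<le> Lp_norm M 2 f + Lp_norm M 2 g"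
proof -
  note [measurable] = in_Lp_2D(1)[OF f] in_Lp_2D(1)[OF g]
  have int: "integrable M (\<lambda>x. cmod (f x) * cmod (g x))"
    using integrable_norm[OF integrable_mult_Lp_2[OF f g]] by (simp add: norm_mult)
  have le: "(cmod (f x + g x))\<^sup>2 \<le> (cmod (f x))\<^sup>2 + 2 * (cmod (f x) * cmod (g x)) + (cmod (g x))\<^sup>2" for x
    using power_mono[OF norm_triangle_ineq[of "f x" "g x"], of 2] by (simp add: power2_sum)
  have int2: "integrable M (\<lambda>x. (cmod (f x))\<^sup>2 + 2 * (cmod (f x) * cmod (g x)) + (cmod (g x))\<^sup>2)"
    using int in_Lp_2D(2)[OF f] in_Lp_2D(2)[OF g] by simp
  have int3: "integrable M (\<lambda>x. (cmod (f x + g x))\<^sup>2)"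
    by (rule Bochner_Integration.integrable_bound[OF int2])
      (auto intro!: AE_I2 order.trans[OF le])
  then show "in_Lp M 2 (\<lambda>x. f x + g x)" by (simp add: in_Lp_2_iff)
  have "(Lp_norm M 2 (\<lambda>x. f x + g x))\<^sup>2 \<le> 
     (LINT x|M. (cmod (f x))\<^sup>2 + 2 * (cmod (f x) * cmod (g x)) + (cmod (g x))\<^sup>2)"
    unfolding Lp_norm_2_power2 by (rule integral_mono[OF int3 int2 le])
  also have "\<dots> = (Lp_norm M 2 f)\<^sup>2 + 2 * (LINT x|M. cmod (f x) * cmod (g x)) + (Lp_norm M 2 g)\<^sup>2"
    using int f g by (simp add: Lp_norm_2_power2 in_Lp_2D)
  also have "\<dots> \<le> (Lp_norm M 2 f + Lp_norm M 2 g)\<^sup>2"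
    using Cauchy_Schwarz_Lp_2_abs[OF f g] by (simp add: power2_sum)
  finally show "Lp_norm M 2 (\<lambda>x. f x + g x) \<le> Lp_norm M 2 f + Lp_norm M 2 g"
    by (rule power2_le_imp_le) (simp add: Lp_norm_2_nonneg)
qed

lemma in_Lp_2_cmult:
  fixes f :: "'a \<Rightarrow> complex"
  assumes "in_Lp M 2 f"
  shows "in_Lp M 2 (\<lambda>x. c * f x)" "Lp_norm M 2 (\<lambda>x. c * f x) = cmod c * Lp_norm M 2 f"
proof -
  note [measurable] = in_Lp_2D(1)[OF assms]
  show "in_Lp M 2 (\<lambda>x. c * f x)"
    using in_Lp_2D(2)[OF assms] by (simp add: in_Lp_2_iff norm_mult power_mult_distrib)
  show "Lp_norm M 2 (\<lambda>x. c * f x) = cmod c * Lp_norm M 2 f"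
    by (simp add: Lp_norm_2 norm_mult power_mult_distrib real_sqrt_mult)
qed

lemma in_Lp_2_diff:
  fixes f g :: "'a \<Rightarrow> complex"
  assumes f: "in_Lp M 2 f" and g: "in_Lp M 2 g"
  shows "in_Lp M 2 (\<lambda>x. f x - g x)" "Lp_norm M 2 (\<lambda>x. f x - g x) \<le> Lp_norm M 2 f + Lp_norm M 2 g"
  using in_Lp_2_add[OF f in_Lp_2_cmult(1)[OF g, of "-1"]] in_Lp_2_cmult(2)[OF g, of "-1"] by auto

lemma Lp_norm_2_minus_commute:
  "Lp_norm M 2 (\<lambda>x. f x - g x) = Lp_norm M 2 (\<lambda>x. g x - f x)"
  by (simp add: Lp_norm_2 norm_minus_commute)

lemma Lp_norm_2_diff_abs:
  fixes f g :: "'a \<Rightarrow> complex"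
  assumes f: "in_Lp M 2 f" and g: "in_Lp M 2 g"
  shows "\<bar>Lp_norm M 2 f - Lp_norm M 2 g\<bar> \<le> Lp_norm M 2 (\<lambda>x. f x - g x)"
  using in_Lp_2_add(2)[OF g in_Lp_2_diff(1)[OF f g]] in_Lp_2_add(2)[OF f in_Lp_2_diff(1)[OF g f]]
    Lp_norm_2_minus_commute[of M f g] by (simp add: abs_le_iff)

lemma in_Lp_2_cnj:
  "in_Lp M 2 (\<lambda>x. cnj (f x)) \<longleftrightarrow> in_Lp M 2 f"
proof -
  have "cnj \<in> borel_measurable borel"
    by (intro borel_measurable_continuous_onI continuous_intros)
  from measurable_compose[OF _ this, of f M] measurable_compose[OF _ this, of "\<lambda>x. cnj (f x)" M]
  have "(\<lambda>x. cnj (f x)) \<in> borel_measurable M \<longleftrightarrow> f \<in> borel_measurable M"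
    unfolding complex_cnj_cnj by blast
  then show ?thesis unfolding in_Lp_2_iff by simp
qed

lemma in_Lp_2_cong_AE:
  assumes "in_Lp M 2 f" "g \<in> borel_measurable M" "AE x in M. f x = g x"
  shows "in_Lp M 2 g" "Lp_norm M 2 g = Lp_norm M 2 f"
proof -
  note [measurable] = in_Lp_2D(1)[OF assms(1)] assms(2)
  have ae: "AE x in M. (norm (f x))\<^sup>2 = (norm (g x))\<^sup>2" using assms(3) by eventually_elim simp
  show "in_Lp M 2 g"
    using integrable_cong_AE[THEN iffD1, OF _ _ ae in_Lp_2D(2)[OF assms(1)]] by (simp add: in_Lp_2_iff)
  show "Lp_norm M 2 g = Lp_norm M 2 f"
    unfolding Lp_norm_2 using integral_cong_AE[OF _ _ ae] by simp
qed

section \<open>The L^2 inner product along a continuous curve of functions\<close>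

definition inner_L2 :: "(real \<Rightarrow> complex) \<Rightarrow> (real \<Rightarrow> complex) \<Rightarrow> complex" where
  "inner_L2 f g = (LINT x|lborel. f x * cnj (g x))"

lemma inner_L2_cnj: "inner_L2 g f = cnj (inner_L2 f g)"
proof -
  have "cnj (LINT x|lborel. f x * cnj (g x)) = (LINT x|lborel. cnj (f x * cnj (g x)))"
    by (rule Bochner_Integration.integral_cnj[symmetric])
  also have "\<dots> = (LINT x|lborel. g x * cnj (f x))"
    by (rule Bochner_Integration.integral_cong) auto
  finally show ?thesis unfolding inner_L2_def by (rule sym)
qed

lemma inner_L2_self: "inner_L2 f f = of_real ((Lp_norm lborel 2 f)\<^sup>2)"
  unfolding inner_L2_def Lp_norm_2_power2 complex_norm_square[symmetric]
  by (rule integral_complex_of_real)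

lemma Lp_norm_2_cnj: "Lp_norm M 2 (\<lambda>x. cnj (f x)) = Lp_norm M 2 f"
  by (simp add: Lp_norm_2)

lemma inner_L2_bound:
  "in_Lp lborel 2 f \<Longrightarrow> in_Lp lborel 2 g \<Longrightarrow> cmod (inner_L2 f g) \<le> Lp_norm lborel 2 f * Lp_norm lborel 2 g"
  unfolding inner_L2_def
  using Cauchy_Schwarz_Lp_2_norm[of lborel f "\<lambda>x. cnj (g x)"] by (simp add: in_Lp_2_cnj Lp_norm_2_cnj)

lemma inner_L2_diff:
  assumes "in_Lp lborel 2 f" "in_Lp lborel 2 g" "in_Lp lborel 2 h"
  shows "inner_L2 (\<lambda>x. f x - g x) h = inner_L2 f h - inner_L2 g h"
    "inner_L2 h (\<lambda>x. f x - g x) = inner_L2 h f - inner_L2 h g"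
  unfolding inner_L2_def using assms
  by (simp_all add: left_diff_distrib right_diff_distrib integrable_mult_Lp_2 in_Lp_2_cnj)

text \<open>Bilinearity splits the increment into one difference in each slot, and Cauchy-Schwarz
  bounds both. Continuity in the two times jointly, not separately, is what makes the kernel A(t,r)
  usable along the diagonal.\<close>

lemma continuous_on_inner_L2:
  fixes f :: "real \<Rightarrow> real \<Rightarrow> complex"
  assumes L2: "\<And>t. t \<in> S \<Longrightarrow> in_Lp lborel 2 (f t)"
    and cont: "\<And>t. t \<in> S \<Longrightarrow> ((\<lambda>s. Lp_norm lborel 2 (\<lambda>x. f s x - f t x)) \<longlongrightarrow> 0) (at t within S)"
  shows "continuous_on (S \<times> S) (\<lambda>(t, r). inner_L2 (f t) (f r))"
  unfolding continuous_on_def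
proof safe
  fix t r assume tr: "t \<in> S" "r \<in> S"
  let ?N = "\<lambda>t s. Lp_norm lborel 2 (\<lambda>x. f s x - f t x)"
  \<comment> \<open>\<open>?N t t\<close> is 0. Writing the limit this way makes it continuity at
    \<open>t\<close>, which composes with the projections even where the first coordinate of
    \<open>p\<close> equals \<open>t\<close>.\<close>
  have N: "(?N t \<longlongrightarrow> ?N t t) (at t within S)" if "t \<in> S" for t
    using cont[OF that] by (simp add: Lp_norm_2)
  have fst: "((\<lambda>p. ?N t (fst p)) \<longlongrightarrow> 0) (at (t, r) within S \<times> S)"
  proof -
    have "continuous (at t within S) (?N t)" using N[OF tr(1)] by (simp add: continuous_within)
    then have "continuous (at (t, r) within S \<times> S) (\<lambda>p. ?N t (fst p))"
      by (intro continuous_within_compose2[where f=fst and x="(t, r)" and g="?N t" and s="S\<times>S"])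
        (auto intro!: continuous_intros intro: continuous_within_subset)
    then show ?thesis by (simp add: continuous_within Lp_norm_2)
  qed
  have snd: "((\<lambda>p. ?N r (snd p)) \<longlongrightarrow> 0) (at (t, r) within S \<times> S)"
  proof -
    have "continuous (at r within S) (?N r)" using N[OF tr(2)] by (simp add: continuous_within)
    then have "continuous (at (t, r) within S \<times> S) (\<lambda>p. ?N r (snd p))"
      by (intro continuous_within_compose2[where f=snd and x="(t, r)" and g="?N r" and s="S\<times>S"])
        (auto intro!: continuous_intros intro: continuous_within_subset)
    then show ?thesis by (simp add: continuous_within Lp_norm_2)
  qed
  let ?n = "\<lambda>t. Lp_norm lborel 2 (f t)"
  have "((\<lambda>p. ?N t (fst p) * (?n r + ?N r (snd p)) + ?n t * ?N r (snd p)) \<longlongrightarrow> 0 * (?n r + 0) + ?n t * 0)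
      (at (t, r) within S \<times> S)"
    by (intro tendsto_intros fst snd)
  then have lim: "((\<lambda>p. ?N t (fst p) * (?n r + ?N r (snd p)) + ?n t * ?N r (snd p)) \<longlongrightarrow> 0)
      (at (t, r) within S \<times> S)" by simp
  have "((\<lambda>p. (case p of (t, r) \<Rightarrow> inner_L2 (f t) (f r)) - inner_L2 (f t) (f r)) \<longlongrightarrow> 0) (at (t, r) within S \<times> S)"
  proof (rule Lim_null_comparison[OF _ lim])
    show "\<forall>\<^sub>F p in at (t, r) within S \<times> S. 
      cmod ((case p of (t, r) \<Rightarrow> inner_L2 (f t) (f r)) - inner_L2 (f t) (f r))
       \<le> ?N t (fst p) * (?n r + ?N r (snd p)) + ?n t * ?N r (snd p)"
      unfolding eventually_at_topological
    proof (intro exI[of _ UNIV] conjI ballI impI open_UNIV UNIV_I)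
      fix p assume "p \<in> S \<times> S"
      then obtain a b where p: "p = (a, b)" "a \<in> S" "b \<in> S" by auto
      have eq: "inner_L2 (f a) (f b) - inner_L2 (f t) (f r) =
        inner_L2 (\<lambda>x. f a x - f t x) (f b) + inner_L2 (f t) (\<lambda>x. f b x - f r x)"
        using p tr L2 by (simp add: inner_L2_diff)
      have "cmod (inner_L2 (\<lambda>x. f a x - f t x) (f b)) \<le> ?N t a * ?n b"
        using p tr L2 by (intro inner_L2_bound in_Lp_2_diff) auto
      also have "\<dots> \<le> ?N t a * (?n r + ?N r b)"
        using Lp_norm_2_diff_abs[OF L2 L2, of b r] p tr by (intro mult_left_mono Lp_norm_2_nonneg) auto
      finally show "cmod ((case p of (t, r) \<Rightarrow> inner_L2 (f t) (f r)) - inner_L2 (f t) (f r))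
       \<le> ?N t (fst p) * (?n r + ?N r (snd p)) + ?n t * ?N r (snd p)"
        using inner_L2_bound[OF L2[OF tr(1)] in_Lp_2_diff(1)[OF L2[OF p(3)] L2[OF tr(2)]]]
        unfolding p(1) prod.case eq fst_conv snd_conv
        by (intro norm_triangle_le) linarith
    qed
  qed
  then show "((\<lambda>(t, r). inner_L2 (f t) (f r)) \<longlongrightarrow> (inner_L2 (f t) (f r))) (at (t, r) within S \<times> S)"
    by (simp add: LIM_zero_iff)
qed

section \<open>Sobolev functions on the line\<close>

lemma in_Lp_2_indicator:
  assumes "S \<in> sets borel" "emeasure lborel S < \<infinity>"
  shows "in_Lp lborel 2 (\<lambda>x. complex_of_real (indicator S x))"
proof -
  have "(cmod (complex_of_real (indicator S x)))\<^sup>2 = indicator S x" for x by (auto simp: indicator_def)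
  then show ?thesis using assms by (simp add: in_Lp_2_iff)
qed

lemma in_Lp_2_set_integrable:
  fixes f :: "real \<Rightarrow> complex"
  assumes "in_Lp lborel 2 f"
  shows "set_integrable lborel {a..b} f"
  using integrable_mult_Lp_2[OF in_Lp_2_indicator assms, of "{a..b}"]
  by (simp add: set_integrable_def scaleR_conv_of_real emeasure_lborel_Icc_eq)

text \<open>\<open>wderiv u\<close> is a Hilbert choice, so all that is known about it comes from
  its specification; continuity of \<open>u\<close> then makes the increments of \<open>u\<close>
  exact at every point, not merely almost everywhere.\<close>

lemma in_H1D:
  assumes "in_H1 u"
  shows "in_Lp lborel 2 u" "in_Lp lborel 2 (wderiv u)" "primitive_on UNIV u (wderiv u)"
    "weak_deriv u (wderiv u)"
proof -
  have "\<exists>g. in_Lp lborel 2 g \<and> weak_deriv u g" using assms by (simp add: in_H1_def)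
  then have "in_Lp lborel 2 (wderiv u) \<and> weak_deriv u (wderiv u)"
    unfolding wderiv_def by (rule someI_ex)
  then show L2: "in_Lp lborel 2 (wderiv u)" and w: "weak_deriv u (wderiv u)" by auto
  show "in_Lp lborel 2 u" using assms by (simp add: in_H1_def)
  show "primitive_on UNIV u (wderiv u)"
    by (rule weak_derivative_imp_primitive)
       (use assms w in \<open>auto simp: in_H1_def weak_deriv_def in_Lp_2_set_integrable[OF L2]\<close>)
qed

lemma primitive_onI_C1:
  assumes "\<And>x. x \<in> S \<Longrightarrow> (F has_vector_derivative f x) (at x)" "continuous_on S f"
  shows "primitive_on S F f"
  unfolding primitive_on_def
proof (intro allI impI conjI)
  fix x y :: real assume xy: "x \<le> y \<and> {x..y} \<subseteq> S"
  then have c: "continuous_on {x..y} f" using assms(2) continuous_on_subset by blast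
  then show "set_integrable lborel {x..y} f"
    unfolding set_integrable_def by (intro borel_integrable_compact) auto
  have "(LINT z|lborel. indicator {x..y} z *\<^sub>R f z) = F y - F x"
  proof (intro integral_FTC_Icc c)
    show "(F has_vector_derivative f z) (at z within {x..y})" if "x \<le> z" "z \<le> y" for z
      using xy that by (auto intro: has_vector_derivative_at_within[OF assms(1)])
  qed (use xy in simp)
  then show "F y - F x = (LINT z:{x..y}|lborel. f z)"
    by (simp add: set_lebesgue_integral_def)
qed

lemma compact_support_bound:
  fixes \<phi> :: "real \<Rightarrow> real"
  assumes "compact (closure {x. \<phi> x \<noteq> 0})"
  obtains R where "0 < R" "\<And>x. R \<le> \<bar>x\<bar> \<Longrightarrow> \<phi> x = 0 \<and> deriv \<phi> x = 0"
proof -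
  obtain R where R: "0 < R" "\<And>x. x \<in> closure {x. \<phi> x \<noteq> 0} \<Longrightarrow> \<bar>x\<bar> \<le> R"
    using compact_imp_bounded[OF assms] unfolding bounded_pos by auto
  have z: "\<phi> x = 0" if "R < \<bar>x\<bar>" for x
    using R(2)[of x] closure_subset[of "{x. \<phi> x \<noteq> 0}"] that by force
  \<comment> \<open>The bound is enlarged by 1 so that such an x has a whole neighbourhood where
    \<open>\<phi>\<close> vanishes, and the derivative vanishes with it.\<close>
  have "\<phi> x = 0 \<and> deriv \<phi> x = 0" if "R + 1 \<le> \<bar>x\<bar>" for x
  proof -
    have "open {y. R < \<bar>y\<bar>}" by (intro open_Collect_less continuous_intros)
    then have "\<forall>\<^sub>F y in nhds x. \<phi> y = 0"
      using that z by (auto simp: eventually_nhds intro!: exI[of _ "{y. R < \<bar>y\<bar>}"])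
    then have "deriv \<phi> x = deriv (\<lambda>_. 0) x" by (intro deriv_cong_ev) auto
    with z[of x] that show ?thesis by simp
  qed
  with R(1) show ?thesis by (intro that[of "R + 1"]) auto
qed

lemma primitive_on_test_function:
  assumes "smooth \<phi>"
  shows "primitive_on S (\<lambda>x. complex_of_real (\<phi> x)) (\<lambda>x. complex_of_real (deriv \<phi> x))"
proof (rule primitive_onI_C1)
  show "((\<lambda>x. complex_of_real (\<phi> x)) has_vector_derivative complex_of_real (deriv \<phi> x)) (at x)" for x
    using smooth_has_real_derivative[OF assms, of x]
    by (intro has_vector_derivative_of_real) (simp add: has_real_derivative_iff_has_vector_derivative)
  show "continuous_on S (\<lambda>x. complex_of_real (deriv \<phi> x))"
    by (intro continuous_intros continuous_on_smooth smooth_deriv assms)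
qed

lemma primitive_imp_weak_deriv:
  assumes u: "primitive_on UNIV u g"
  shows "weak_deriv u g"
  unfolding weak_deriv_def
proof (intro allI impI)
  fix \<phi> :: "real \<Rightarrow> real" assume "test_function UNIV \<phi>"
  then have sm: "smooth \<phi>" and co: "compact (closure {x. \<phi> x \<noteq> 0})"
    by (auto simp: test_function_def)
  obtain R where R: "0 < R" "\<And>x. R \<le> \<bar>x\<bar> \<Longrightarrow> \<phi> x = 0 \<and> deriv \<phi> x = 0"
    using compact_support_bound[OF co] by blast
  have "(LINT x:{-R..R}|lborel. u x * of_real (deriv \<phi> x)) + (LINT x:{-R..R}|lborel. g x * of_real (\<phi> x)) = 0"
    using primitive_ibp(1)[OF primitive_on_subset[OF u] primitive_on_test_function[OF sm], of "-R" R] R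
    by simp
  moreover have "(LINT x:{-R..R}|lborel. u x * of_real (deriv \<phi> x)) = (LINT x|lborel. u x * of_real (deriv \<phi> x))"
    unfolding set_lebesgue_integral_def
    by (rule Bochner_Integration.integral_cong) (use R(2) in \<open>force simp: indicator_def\<close>)+
  moreover have "(LINT x:{-R..R}|lborel. g x * of_real (\<phi> x)) = (LINT x|lborel. g x * of_real (\<phi> x))"
    unfolding set_lebesgue_integral_def
    by (rule Bochner_Integration.integral_cong) (use R(2) in \<open>force simp: indicator_def\<close>)+
  ultimately show "(LINT x|lborel. u x * of_real (deriv \<phi> x)) = - (LINT x|lborel. g x * of_real (\<phi> x))"
    by (simp add: add_eq_0_iff)
qed

text \<open>The difference of the two densities has integral zero over every interval, so Lebesgue
  differentiation makes it vanish almost everywhere.\<close>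

lemma primitive_on_unique_AE:
  assumes g: "primitive_on UNIV u g" and h: "primitive_on UNIV u h"
  shows "AE x in lborel. g x = h x"
proof -
  define k where "k x = g x - h x" for x
  have int: "k integrable_on {x..y} \<and> integral {x..y} k = 0" for x y
  proof (cases "x \<le> y")
    case True
    have s: "set_integrable lborel {x..y} g" "set_integrable lborel {x..y} h"
      using primitive_on_integrable[OF g] primitive_on_integrable[OF h] by auto
    then have "set_integrable lborel {x..y} k" unfolding k_def by (rule set_integral_diff)
    moreover have "(LINT z:{x..y}|lborel. k z) = 0"
      using primitive_on_integral[OF g True] primitive_on_integral[OF h True] s
      by (simp add: k_def set_integral_diff)
    ultimately show ?thesis by (simp add: set_borel_integral_eq_integral)
  qed (use integrable_on_empty in auto)
  obtain N where N: "negligible N" "\<And>x e. \<lbrakk>x \<notin> N; 0 < e\<rbrakk> \<Longrightarrow>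
      \<exists>d>0. \<forall>h. 0 < h \<and> h < d \<longrightarrow> norm (integral (cbox x (x + h *\<^sub>R One)) k /\<^sub>R h ^ DIM(real) - k x) < e"
    using integrable_ccontinuous_explicit[of k] int by (metis interval_cbox)
  have "k x = 0" if nN: "x \<notin> N" for x
  proof (rule ccontr)
    assume "k x \<noteq> 0"
    then obtain d where "d > 0" 
      "\<And>h. 0 < h \<and> h < d \<Longrightarrow> norm (integral (cbox x (x + h *\<^sub>R One)) k /\<^sub>R h ^ DIM(real) - k x) < norm (k x)"
      using N(2)[OF nN, of "norm (k x)"] by auto
    moreover have "integral (cbox x (x + (d / 2) *\<^sub>R One)) k = 0"
      using int[of x "x + d / 2"] by simp
    ultimately have "norm (0 /\<^sub>R (d / 2) ^ DIM(real) - k x) < norm (k x)"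
      by (metis half_gt_zero field_sum_of_halves less_add_same_cancel1)
    then show False by simp
  qed
  then have "AE x in lebesgue. k x = 0"
    using N(1) by (intro AE_I'[of N]) (auto simp: negligible_iff_null_sets)
  then have "AE x in lborel. k x = 0" by (simp add: AE_completion_iff)
  then show ?thesis by (simp add: k_def)
qed

text \<open>Replaces the chosen \<open>wderiv u\<close> by any explicit square-integrable density.
  This is how \<open>H1_norm\<close> is computed for differences, rescalings and the ground
  state.\<close>

lemma H1_primitive:
  assumes u: "in_Lp lborel 2 u" and g: "in_Lp lborel 2 g" and p: "primitive_on UNIV u g"
  shows "in_H1 u" "AE x in lborel. wderiv u x = g x"
    "Lp_norm lborel 2 (wderiv u) = Lp_norm lborel 2 g"
proof -
  show H: "in_H1 u"
    unfolding in_H1_def using primitive_on_UNIV_continuous[OF p] u g primitive_imp_weak_deriv[OF p] by blast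
  show ae: "AE x in lborel. wderiv u x = g x"
    using primitive_on_unique_AE[OF in_H1D(3)[OF H] p] .
  show "Lp_norm lborel 2 (wderiv u) = Lp_norm lborel 2 g"
    using in_Lp_2_cong_AE(2)[OF in_H1D(2)[OF H] in_Lp_2D(1)[OF g] ae] by simp
qed

lemma primitive_on_cmult:
  "primitive_on S u g \<Longrightarrow> primitive_on S (\<lambda>x. c * u x) (\<lambda>x. c * g x)"
  unfolding primitive_on_def by (auto simp flip: right_diff_distrib)

lemma primitive_on_diff:
  assumes "primitive_on S u g" "primitive_on S v h"
  shows "primitive_on S (\<lambda>x. u x - v x) (\<lambda>x. g x - h x)"
  unfolding primitive_on_def
proof (intro allI impI)
  fix x y :: real assume xy: "x \<le> y \<and> {x..y} \<subseteq> S"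
  then have i: "set_integrable lborel {x..y} g" "set_integrable lborel {x..y} h"
    using assms primitive_on_integrable by blast+
  have "u y - u x = (LINT z:{x..y}|lborel. g z)" "v y - v x = (LINT z:{x..y}|lborel. h z)"
    using assms xy primitive_on_integral by blast+
  then have "(u y - v y) - (u x - v x) = (LINT z:{x..y}|lborel. g z) - (LINT z:{x..y}|lborel. h z)"
    by (simp add: algebra_simps)
  with i show "set_integrable lborel {x..y} (\<lambda>x. g x - h x) \<and>
      (u y - v y) - (u x - v x) = (LINT z:{x..y}|lborel. g z - h z)"
    by (simp add: set_integral_diff)
qed

lemma primitive_on_cnj:
  assumes "primitive_on S u g"
  shows "primitive_on S (\<lambda>x. cnj (u x)) (\<lambda>x. cnj (g x))"
  unfolding primitive_on_def
proof (intro allI impI conjI)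
  fix x y :: real assume xy: "x \<le> y \<and> {x..y} \<subseteq> S"
  have eq: "indicator {x..y} z *\<^sub>R cnj (g z) = cnj (indicator {x..y} z *\<^sub>R g z)" for z by simp
  show "set_integrable lborel {x..y} (\<lambda>x. cnj (g x))"
    using primitive_on_integrable[OF assms, of x y] xy
    unfolding set_integrable_def eq by (intro integrable_bounded_linear[OF bounded_linear_cnj]) blast
  show "cnj (u y) - cnj (u x) = (LINT z:{x..y}|lborel. cnj (g z))"
    using primitive_on_integral[OF assms, of x y] xy
    unfolding set_lebesgue_integral_def eq Bochner_Integration.integral_cnj by (simp flip: complex_cnj_diff)
qed

lemma primitive_on_scale:
  assumes p: "primitive_on UNIV u g" and c: "0 < c"
  shows "primitive_on UNIV (\<lambda>x. u (c * x)) (\<lambda>x. of_real c * g (c * x))"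
  unfolding primitive_on_def
proof (intro allI impI conjI)
  fix x y :: real assume xy: "x \<le> y \<and> {x..y} \<subseteq> UNIV"
  have eq: "indicator {c * x..c * y} (0 + c * z) *\<^sub>R g (0 + c * z) = indicator {x..y} z *\<^sub>R g (c * z)" for z
    using c by (auto simp: indicator_def)
  have "integrable lborel (\<lambda>z. indicator {c * x..c * y} (0 + c * z) *\<^sub>R g (0 + c * z))"
    using primitive_on_integrable[OF p, of "c * x" "c * y"] c
    unfolding set_integrable_def by (intro lborel_integrable_real_affine) auto
  then have "set_integrable lborel {x..y} (\<lambda>z. g (c * z))"
    unfolding eq set_integrable_def .
  then show "set_integrable lborel {x..y} (\<lambda>x. of_real c * g (c * x))" by simp
  have "u (c * y) - u (c * x) = (LINT z|lborel. indicator {c * x..c * y} z *\<^sub>R g z)"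
    using primitive_on_integral[OF p, of "c * x" "c * y"] xy c by (simp add: set_lebesgue_integral_def)
  also have "\<dots> = c *\<^sub>R (LINT z|lborel. indicator {x..y} z *\<^sub>R g (c * z))"
    using c lborel_integral_real_affine[of c "\<lambda>z. indicator {c * x..c * y} z *\<^sub>R g z" 0]
    unfolding eq by simp
  also have "\<dots> = of_real c * (LINT z:{x..y}|lborel. g (c * z))"
    by (simp add: set_lebesgue_integral_def scaleR_conv_of_real)
  also have "\<dots> = (LINT z:{x..y}|lborel. of_real c * g (c * z))" by simp
  finally show "u (c * y) - u (c * x) = (LINT z:{x..y}|lborel. of_real c * g (c * z))" .
qed

lemma Lp_norm_2_scale:
  fixes f :: "real \<Rightarrow> complex"
  assumes "in_Lp lborel 2 f" "0 < c"
  shows "in_Lp lborel 2 (\<lambda>x. f (c * x))" "(Lp_norm lborel 2 f)\<^sup>2 = c * (Lp_norm lborel 2 (\<lambda>x. f (c * x)))\<^sup>2"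
proof -
  note [measurable] = in_Lp_2D(1)[OF assms(1)]
  have "integrable lborel (\<lambda>x. (cmod (f (0 + c * x)))\<^sup>2)"
    using assms in_Lp_2D(2) by (intro lborel_integrable_real_affine[where f="\<lambda>x. (cmod (f x))\<^sup>2"]) auto
  then show "in_Lp lborel 2 (\<lambda>x. f (c * x))"
    by (simp add: in_Lp_2_iff)
  show "(Lp_norm lborel 2 f)\<^sup>2 = c * (Lp_norm lborel 2 (\<lambda>x. f (c * x)))\<^sup>2"
    unfolding Lp_norm_2_power2 using assms(2)
    by (subst lborel_integral_real_affine[of c _ 0]) auto
qed

section \<open>Integration by parts across a jump at the origin\<close>

lemma primitive_exists:
  assumes "\<And>a b. set_integrable lborel {a..b} d"
  obtains P where "primitive_on UNIV P d"
proof
  show "primitive_on UNIV (\<lambda>x. LBINT z=0..x. d z) d"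
    unfolding primitive_on_def
  proof (intro allI impI conjI)
    fix x y :: real assume xy: "x \<le> y \<and> {x..y} \<subseteq> UNIV"
    show "set_integrable lborel {x..y} d" by (rule assms)
    have "interval_lebesgue_integrable lborel (ereal a) (ereal b) d" for a b
      unfolding interval_lebesgue_integrable_def
      by (auto intro: set_integrable_subset[OF assms[of a b]] set_integrable_subset[OF assms[of b a]])
    then have "(LBINT z=0..x. d z) + (LBINT z=x..y. d z) = (LBINT z=0..y. d z)"
      unfolding zero_ereal_def by (intro interval_integral_sum) (simp add: min_def max_def)
    then show "(LBINT z=0..y. d z) - (LBINT z=0..x. d z) = (LINT z:{x..y}|lborel. d z)"
      using xy interval_integral_Icc[of x y d] by (metis add_diff_cancel_left')
  qed
qed

lemma integrable_tendsto_at_top_eq_0: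
  fixes h :: "real \<Rightarrow> complex"
  assumes h: "integrable lborel h" and L: "(h \<longlongrightarrow> L) at_top"
  shows "L = 0"
proof (rule ccontr)
  assume "L \<noteq> 0"
  define c where "c = cmod L / 2"
  have c: "0 < c" "c < cmod L" using \<open>L \<noteq> 0\<close> by (auto simp: c_def)
  have "\<forall>\<^sub>F x in at_top. c < cmod (h x)"
    using order_tendstoD(1)[OF tendsto_norm[OF L] c(2)] .
  then obtain N where N: "\<And>x. N \<le> x \<Longrightarrow> c < cmod (h x)"
    by (auto simp: eventually_at_top_linorder)
  \<comment> \<open>On an interval of this length a function larger than \<open>c\<close> in modulus
    already has integral exceeding the L^1 norm, by \<open>c\<close>.\<close>
  define K where "K = (LINT x|lborel. cmod (h x)) / c + 1"
  have "0 \<le> (LINT x|lborel. cmod (h x))" by simp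
  then have "0 < K" using c by (auto simp: K_def intro: add_nonneg_pos)
  have "(LINT x|lborel. c * indicator {N..N+K} x) \<le> (LINT x|lborel. cmod (h x))"
  proof (rule integral_mono)
    show "integrable lborel (\<lambda>x. c * indicator {N..N+K} x)"
      using \<open>0 < K\<close> by (intro integrable_mult_right integrable_real_indicator) simp_all
    show "c * indicator {N..N+K} x \<le> cmod (h x)" for x
      using N[of x] by (auto simp: indicator_def)
  qed (use h in simp)
  moreover have "(LINT x|lborel. c * indicator {N..N+K} x) = c * K"
    using \<open>0 < K\<close> by simp
  moreover have "c * K = (LINT x|lborel. cmod (h x)) + c"
    using c by (simp add: K_def field_simps)
  ultimately show False using c by simp
qed

text \<open>Integration by parts on [-R,0] and [0,R] leaves the jump at 0 and the boundary term at
  distance R. No decay of \<open>V\<close> alone is assumed: the boundary term converges as R grows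
  and is an integrable function of R, so its limit is 0.\<close>

lemma integral_by_parts_jump:
  assumes V: "primitive_on {0<..} V d" "primitive_on {..<0} V d"
    and lim: "(V \<longlongrightarrow> Vr) (at_right 0)" "(V \<longlongrightarrow> Vl) (at_left 0)"
    and d: "\<And>a b. set_integrable lborel {a..b} d"
    and k: "primitive_on UNIV k k'"
    and int: "integrable lborel (\<lambda>x. V x * k' x)" "integrable lborel (\<lambda>x. V x * k x)"
      "integrable lborel (\<lambda>x. d x * k x)"
  shows "(LINT x|lborel. V x * k' x) = - (Vr - Vl) * k 0 - (LINT x|lborel. d x * k x)"
proof -
  \<comment> \<open>On each open half-line \<open>V\<close> and \<open>P\<close> differ by a
    constant, fixed by the one-sided limit of \<open>V\<close>. Hence \<open>V\<close> agrees there
    with a primitive that extends through 0, and \<open>primitive_ibp\<close> applies up to the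
    closed endpoint.\<close>
  obtain P where P: "primitive_on UNIV P d" using primitive_exists[OF d] by blast
  have contP: "isCont P 0"
    using primitive_on_UNIV_continuous[OF P] by (simp add: continuous_on_eq_continuous_at)
  have right: "V x = (Vr - P 0) + P x" if "0 < x" for x
  proof -
    have "\<forall>\<^sub>F z in at_right 0. V z - P z = V x - P x"
    proof (rule eventually_at_rightI)
      fix z assume "z \<in> {0<..<x}"
      then show "V z - P z = V x - P x"
        using primitive_on_integral[OF V(1), of z x] primitive_on_integral[OF P, of z x]
        by (simp add: subset_iff algebra_simps)
    qed fact
    then have "((\<lambda>z. V z - P z) \<longlongrightarrow> V x - P x) (at_right 0)" by (rule tendsto_eventually)
    moreover have "((\<lambda>z. V z - P z) \<longlongrightarrow> Vr - P 0) (at_right 0)"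
      using contP by (intro tendsto_intros lim) (auto simp: isCont_def filterlim_at_split)
    ultimately have "V x - P x = Vr - P 0" by (rule tendsto_unique[rotated]) simp
    then show ?thesis by (simp add: algebra_simps)
  qed
  have left: "V x = (Vl - P 0) + P x" if "x < 0" for x
  proof -
    have "\<forall>\<^sub>F z in at_left 0. V z - P z = V x - P x"
    proof (rule eventually_at_leftI)
      fix z assume "z \<in> {x<..<0}"
      then show "V z - P z = V x - P x"
        using primitive_on_integral[OF V(2), of x z] primitive_on_integral[OF P, of x z]
        by (simp add: subset_iff algebra_simps)
    qed fact
    then have "((\<lambda>z. V z - P z) \<longlongrightarrow> V x - P x) (at_left 0)" by (rule tendsto_eventually)
    moreover have "((\<lambda>z. V z - P z) \<longlongrightarrow> Vl - P 0) (at_left 0)"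
      using contP by (intro tendsto_intros lim) (auto simp: isCont_def filterlim_at_split)
    ultimately have "V x - P x = Vl - P 0" by (rule tendsto_unique[rotated]) simp
    then show ?thesis by (simp add: algebra_simps)
  qed
  have addc: "primitive_on S (\<lambda>x. c + P x) d" for c S
    using P unfolding primitive_on_def by auto
  let ?f = "\<lambda>x. V x * k' x + d x * k x"
  have intf: "integrable lborel ?f" using int by simp
  have half: "(LINT x:{a..b}|lborel. ?f x) = (c + P b) * k b - (c + P a) * k a"
    if ab: "a \<le> b" and V: "\<And>x. a < x \<Longrightarrow> x < b \<Longrightarrow> V x = c + P x" for a b c
  proof -
    note ibp = primitive_ibp[OF addc[where c=c] primitive_on_subset[OF k subset_UNIV] ab]
    have mV: "(\<lambda>x. indicator {a..b} x *\<^sub>R (V x * k' x)) \<in> borel_measurable lborel"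
      using borel_measurable_integrable[OF int(1)] by measurable
    have "(LINT x:{a..b}|lborel. V x * k' x) = (LINT x:{a..b}|lborel. (c + P x) * k' x)"
      unfolding set_lebesgue_integral_def
    proof (rule integral_cong_AE[OF mV])
      show "(\<lambda>x. indicator {a..b} x *\<^sub>R ((c + P x) * k' x)) \<in> borel_measurable lborel"
        using ibp(2) unfolding set_integrable_def by (intro borel_measurable_integrable) simp
      show "AE x in lborel. indicator {a..b} x *\<^sub>R (V x * k' x) = indicator {a..b} x *\<^sub>R ((c + P x) * k' x)"
        using AE_lborel_singleton[of a] AE_lborel_singleton[of b]
        by eventually_elim (auto simp: indicator_def V)
    qed
    moreover have "set_integrable lborel {a..b} (\<lambda>x. V x * k' x)" "set_integrable lborel {a..b} (\<lambda>x. d x * k x)"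
      using int unfolding set_integrable_def by (auto intro: integrable_mult_indicator)
    ultimately show ?thesis using ibp(1) by (simp add: set_integral_add)
  qed
  \<comment> \<open>The boundary term at distance R; its integrability comes from that of
    \<open>V x * k x\<close> and of its reflection.\<close>
  define h where "h R = V R * k R - V (- R) * k (- R)" for R
  have h: "h R = (LINT x:{-R..0}|lborel. ?f x) + (LINT x:{0..R}|lborel. ?f x) + (Vr - Vl) * k 0" if "R > 0" for R
  proof -
    have a: "(LINT x:{0..R}|lborel. ?f x) = V R * k R - Vr * k 0"
      unfolding right[OF that] using half[of 0 R "Vr - P 0"] right that by simp
    have b: "(LINT x:{-R..0}|lborel. ?f x) = Vl * k 0 - V (- R) * k (- R)"
      using half[of "-R" 0 "Vl - P 0"] left that left[of "-R"] by simp
    show ?thesis unfolding h_def a b by (simp add: algebra_simps)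
  qed
  have s: "set_integrable lborel {0..} ?f" "set_integrable lborel {..0} ?f"
    using intf unfolding set_integrable_def by (auto intro: integrable_mult_indicator)
  have "((\<lambda>R. LINT x:{0..R}|lborel. ?f x) \<longlongrightarrow> (LINT x:{0..}|lborel. ?f x)) at_top"
    by (rule tendsto_set_lebesgue_integral_at_top) (use s in auto)
  moreover have "((\<lambda>R. LINT x:{R..0}|lborel. ?f x) \<longlongrightarrow> (LINT x:{..0}|lborel. ?f x)) at_bot"
    by (rule tendsto_set_lebesgue_integral_at_bot) (use s in auto)
  then have "((\<lambda>R. LINT x:{-R..0}|lborel. ?f x) \<longlongrightarrow> (LINT x:{..0}|lborel. ?f x)) at_top"
    by (rule filterlim_compose[OF _ filterlim_uminus_at_bot_at_top])
  ultimately have "((\<lambda>R. (LINT x:{-R..0}|lborel. ?f x) + (LINT x:{0..R}|lborel. ?f x) + (Vr - Vl) * k 0) \<longlongrightarrow>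
      (LINT x:{..0}|lborel. ?f x) + (LINT x:{0..}|lborel. ?f x) + (Vr - Vl) * k 0) at_top"
    by (intro tendsto_intros)
  then have "(h \<longlongrightarrow> (LINT x:{..0}|lborel. ?f x) + (LINT x:{0..}|lborel. ?f x) + (Vr - Vl) * k 0) at_top"
  proof (rule Lim_transform_eventually)
    show "\<forall>\<^sub>F R in at_top. (LINT x:{-R..0}|lborel. ?f x) + (LINT x:{0..R}|lborel. ?f x) + (Vr - Vl) * k 0 = h R"
      using eventually_gt_at_top[of 0] by eventually_elim (simp only: h)
  qed
  moreover have "integrable lborel h"
  proof -
    have "integrable lborel (\<lambda>x. V (0 + (-1) * x) * k (0 + (-1) * x))"
      by (rule lborel_integrable_real_affine[OF int(2)]) simp
    then show ?thesis unfolding h_def using int(2) by simp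
  qed
  ultimately have zero: "(LINT x:{..0}|lborel. ?f x) + (LINT x:{0..}|lborel. ?f x) + (Vr - Vl) * k 0 = 0"
    using integrable_tendsto_at_top_eq_0 by blast
  have "(LINT x:{..0}|lborel. ?f x) + (LINT x:{0..}|lborel. ?f x) = (LINT x|lborel. ?f x)"
  proof -
    have "(LINT x:{..0}|lborel. ?f x) + (LINT x:{0..}|lborel. ?f x) = (LINT x:{..0} \<union> {0..}|lborel. ?f x)"
    proof (rule set_integral_Un_AE[symmetric])
      show "AE x in lborel. \<not> (x \<in> {..0::real} \<and> x \<in> {0..})"
        using AE_lborel_singleton[of "0::real"] by eventually_elim auto
    qed (use s in auto)
    also have "{..0} \<union> {0..} = (UNIV :: real set)" by auto
    finally show ?thesis by (simp add: set_lebesgue_integral_def)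
  qed
  also have "\<dots> = (LINT x|lborel. V x * k' x) + (LINT x|lborel. d x * k x)"
    using int by simp
  finally show ?thesis using zero by (simp add: algebra_simps eq_neg_iff_add_eq_0)
qed

section \<open>Conservation laws for kernels\<close>

text \<open>Otherwise the Gagliardo integral would dominate $\int_0 c\,h^{-3/2}\,dh = \infty$.\<close>

lemma Hs_small_increments:
  assumes hs: "in_Hs (3/4) T w" and w: "continuous_on {0..T} w"
    and ab: "0 < a" "a < b" "b < T" and c: "0 < c" and h0: "0 < h0"
  obtains h where "0 < h" "h < h0" "b + h < T" "integral {a..b} (\<lambda>\<tau>. (cmod (w (\<tau> + h) - w \<tau>))\<^sup>2) < c * h"
proof (rule ccontr)
  assume neg: "\<not> thesis"
  define h1 where "h1 = min h0 (T - b)"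
  have h1: "0 < h1" using ab h0 by (simp add: h1_def)
  define Q where "Q h = integral {a..b} (\<lambda>\<tau>. (cmod (w (\<tau> + h) - w \<tau>))\<^sup>2)" for h
  have nQ: "\<not> (0 < h \<and> h < h0 \<and> b + h < T \<and> Q h < c * h)" for h
    using that[of h] neg unfolding Q_def by blast
  have Q: "c * h \<le> Q h" if "0 < h" "h < h1" for h
    using nQ[of h] that unfolding h1_def by auto
  define f where "f p = indicator ({0..T} \<times> {0..T}) p *\<^sub>R gagliardo (3/4) w p" for p
  have int: "integrable lborel f"
    using hs unfolding in_Hs_def set_integrable_def f_def by auto
  have f0: "0 \<le> f p" for p by (auto simp: f_def gagliardo_def indicator_def split: prod.splits)
  have [measurable]: "f \<in> borel_measurable borel" using int by auto
  then have [measurable]: "f \<in> borel_measurable (borel \<Otimes>\<^sub>M borel)" by (simp add: borel_prod)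
  define K where "K = (LINT p|lborel. f p)"
  have K0: "0 \<le> K" unfolding K_def using f0 by simp
  have "ennreal K = (\<integral>\<^sup>+p. ennreal (f p) \<partial>lborel)"
    unfolding K_def using int f0 by (intro nn_integral_eq_integral[symmetric]) auto
  also have "\<dots> = (\<integral>\<^sup>+x. \<integral>\<^sup>+y. ennreal (f (x, y)) \<partial>lborel \<partial>lborel)"
    unfolding lborel_prod[symmetric] by (rule lborel.nn_integral_fst[symmetric]) simp
  also have "\<dots> = (\<integral>\<^sup>+x. \<integral>\<^sup>+h. ennreal (f (x, x + h)) \<partial>lborel \<partial>lborel)"
  proof (rule nn_integral_cong)
    fix x :: real
    show "(\<integral>\<^sup>+y. ennreal (f (x, y)) \<partial>lborel) = (\<integral>\<^sup>+h. ennreal (f (x, x + h)) \<partial>lborel)"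
      using nn_integral_real_affine[of "\<lambda>y. ennreal (f (x, y))" 1 x] by simp
  qed
  also have "\<dots> = (\<integral>\<^sup>+h. \<integral>\<^sup>+x. ennreal (f (x, x + h)) \<partial>lborel \<partial>lborel)"
    by (rule lborel_pair.Fubini'[symmetric]) simp
  finally have K: "(\<integral>\<^sup>+h. \<integral>\<^sup>+x. ennreal (f (x, x + h)) \<partial>lborel \<partial>lborel) = ennreal K" by simp
  \<comment> \<open>The Gagliardo denominator at separation h is h^{5/2}, since 1 + 2 * (3/4) = 5/2.
    With the assumed lower bound c h on the numerator this leaves c h^{-3/2}, which is at least its
    value at \<eta>.\<close>
  have inner: "ennreal (c * \<eta> powr (- 3/2)) \<le> (\<integral>\<^sup>+x. ennreal (f (x, x + h)) \<partial>lborel)"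
    if h: "0 < h" "h < \<eta>" "\<eta> < h1" for h \<eta>
  proof -
    let ?g = "\<lambda>x. (cmod (w (x + h) - w x))\<^sup>2"
    have bh: "b + h < T" using h by (simp add: h1_def)
    have cont: "continuous_on {a..b} ?g"
      using ab bh h by (intro continuous_intros continuous_on_compose2[OF w]) auto
    have i: "integrable lborel (\<lambda>x. indicator {a..b} x *\<^sub>R ?g x)"
      by (rule borel_integrable_compact[OF _ cont]) simp
    have "\<eta> powr (-3/2) \<le> h powr (-3/2)" using h by (intro powr_mono2') auto
    then have "c * \<eta> powr (-3/2) \<le> c * h powr (-3/2)" using c by simp
    also have "\<dots> = c * h * h powr (-5/2)"
      using h powr_mult_base[of h "-5/2"] by simp
    also have "\<dots> \<le> Q h * h powr (-5/2)"
      using Q[of h] h by (intro mult_right_mono) auto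
    also have "Q h = (LINT x|lborel. indicator {a..b} x *\<^sub>R ?g x)"
      unfolding Q_def using set_borel_integral_eq_integral(2)[of "{a..b}" ?g] i
      by (simp add: set_integrable_def set_lebesgue_integral_def)
    finally have "ennreal (c * \<eta> powr (-3/2)) \<le> ennreal ((LINT x|lborel. indicator {a..b} x *\<^sub>R ?g x) * h powr (-5/2))"
      by (rule ennreal_leI)
    also have "\<dots> = (\<integral>\<^sup>+x. ennreal (indicator {a..b} x *\<^sub>R ?g x * h powr (-5/2)) \<partial>lborel)"
      using i by (subst nn_integral_eq_integral) auto
    also have "\<dots> \<le> (\<integral>\<^sup>+x. ennreal (f (x, x + h)) \<partial>lborel)"
    proof (intro nn_integral_mono ennreal_leI)
      fix x
      show "indicator {a..b} x *\<^sub>R ?g x * h powr (-5/2) \<le> f (x, x + h)"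
      proof (cases "x \<in> {a..b}")
        case True
        then have "f (x, x + h) = ?g x / h powr (5/2)"
          using ab bh h by (simp add: f_def gagliardo_def norm_minus_commute)
        moreover have "h powr (- 5/2) = 1 / h powr (5/2)"
          using powr_minus_divide[of h "5/2"] by simp
        ultimately show ?thesis using True by simp
      qed (use f0 in simp)
    qed
    finally show ?thesis .
  qed
  \<comment> \<open>A rectangle of width \<eta> under h^{-3/2} already suffices: its area c
    \<eta>^{-1/2} is unbounded as \<eta> tends to 0.\<close>
  have bound: "c * \<eta> powr (- 3/2) * \<eta> \<le> K" if "0 < \<eta>" "\<eta> < h1" for \<eta>
  proof -
    have "ennreal (c * \<eta> powr (-3/2) * \<eta>) = (\<integral>\<^sup>+h. ennreal (c * \<eta> powr (-3/2)) * indicator {0<..<\<eta>} h \<partial>lborel)"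
      using that c by (subst nn_integral_cmult_indicator) (auto simp: ennreal_mult)
    also have "\<dots> \<le> (\<integral>\<^sup>+h. \<integral>\<^sup>+x. ennreal (f (x, x + h)) \<partial>lborel \<partial>lborel)"
      by (intro nn_integral_mono) (use inner that in \<open>auto simp: indicator_def\<close>)
    finally show ?thesis using K K0 by (simp add: ennreal_le_iff)
  qed
  \<comment> \<open>The second bound is exactly what makes c / sqrt \<eta> at least K + 1, against
    the upper bound K.\<close>
  define \<eta> where "\<eta> = min (h1 / 2) ((c / (K + 1))\<^sup>2)"
  have \<eta>: "0 < \<eta>" "\<eta> < h1" using h1 c K0 by (auto simp: \<eta>_def min_def)
  have "\<eta> \<le> (c / (K + 1))\<^sup>2" by (simp add: \<eta>_def)
  then have "sqrt \<eta> \<le> c / (K + 1)"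
    using c K0 by (intro real_le_lsqrt) (auto simp: \<eta>_def)
  then have "K + 1 \<le> c / sqrt \<eta>" using \<eta> K0 by (simp add: field_simps)
  also have "c / sqrt \<eta> = c * \<eta> powr (- 3/2) * \<eta>"
  proof -
    have "\<eta> powr (- 1/2) = 1 / sqrt \<eta>"
      using \<eta> powr_minus_divide[of \<eta> "1/2"] by (simp add: powr_half_sqrt)
    moreover have "\<eta> * \<eta> powr (- 3/2) = \<eta> powr (- 1/2)"
      using \<eta> powr_mult_base[of \<eta> "-3/2"] by simp
    ultimately have e: "\<eta> * \<eta> powr (- 3/2) = 1 / sqrt \<eta>" by simp
    have "c * \<eta> powr (- 3/2) * \<eta> = c * (\<eta> * \<eta> powr (- 3/2))" by (simp only: mult_ac)
    then show ?thesis unfolding e by simp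
  qed
  also have "\<dots> \<le> K" by (rule bound[OF \<eta>])
  finally show False by simp
qed

text \<open>The evolution is assumed in the first time only; Hermitian symmetry of \<open>B\<close>
  supplies the derivative in the second. The second conserved quantity is twice the energy when
  \<open>A a a\<close> is the squared norm of psi_x and \<open>w\<close> is the trace at 0.\<close>

lemma kernel_conservation:
  fixes A B :: "real \<Rightarrow> real \<Rightarrow> complex" and w :: "real \<Rightarrow> complex"
  assumes A: "continuous_on ({0..T} \<times> {0..T}) (\<lambda>(t, r). A t r)" "\<And>t r. A r t = cnj (A t r)"
    and B: "\<And>t r. B r t = cnj (B t r)"
    and w: "continuous_on {0..T} w" "in_Hs (3/4) T w"
    and eq: "\<And>s t r. 0 < s \<Longrightarrow> s \<le> t \<Longrightarrow> t < T \<Longrightarrow> r \<in> {0..T} \<Longrightarrow>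
      \<i> * (B t r - B s r) = integral {s..t} (\<lambda>\<tau>. A \<tau> r - of_real ((cmod (w \<tau>))\<^sup>2) * w \<tau> * cnj (w r))"
    and ab: "0 < a" "a < b" "b < T"
  shows "B a a = B b b" "Re (A a a) - (cmod (w a)) ^ 4 / 2 = Re (A b b) - (cmod (w b)) ^ 4 / 2"
proof -
  define P where "P t r = of_real ((cmod (w t))\<^sup>2) * w t * cnj (w r)" for t r
  define F where "F t r = A t r - P t r" for t r
  have wc: "continuous_on S (\<lambda>x. w (f x))" if "continuous_on S f" "f ` S \<subseteq> {0..T}" for S f
    using continuous_on_compose2[OF w(1) that(1)] that(2) by blast
  have F2: "continuous_on ({0..T} \<times> {0..T}) (\<lambda>(t, r). F t r)"
    unfolding F_def P_def case_prod_beta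
    by (intro continuous_intros A(1)[unfolded case_prod_beta] wc) auto
  have Fc: "continuous_on S (\<lambda>x. F (f x) (g x))"
    if "continuous_on S f" "continuous_on S g" "f ` S \<subseteq> {0..T}" "g ` S \<subseteq> {0..T}" for S :: "'x::topological_space set" and f g
    using continuous_on_compose2[OF F2, of S "\<lambda>x. (f x, g x)"] that by (auto intro: continuous_intros)
  have d1: "((\<lambda>t. B t r) has_vector_derivative - \<i> * F t r) (at t)" if t: "0 < t" "t < T" and r: "r \<in> {0..T}" for t r
  proof -
    \<comment> \<open>The lower limit must be positive, because \<open>eq\<close> is available only
      for 0 < s; any point strictly below t would do.\<close>
    define s b where "s = t / 2" and "b = (t + T) / 2"
    have sb: "0 < s" "s < t" "t < b" "b < T" using t by (auto simp: s_def b_def)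
    have "((\<lambda>u. integral {s..u} (\<lambda>\<tau>. F \<tau> r)) has_vector_derivative F t r) (at t within {s..b})"
      using sb r by (intro integral_has_vector_derivative Fc continuous_intros) auto
    moreover have "at t within {s..b} = at t" using sb by (intro at_within_interior) auto
    ultimately have "((\<lambda>u. B s r + (- \<i>) * integral {s..u} (\<lambda>\<tau>. F \<tau> r)) has_vector_derivative - \<i> * F t r) (at t)"
      by (auto intro!: derivative_eq_intros)
    then show ?thesis
    proof (rule has_vector_derivative_transform_within_open)
      show "open {s<..<b}" "t \<in> {s<..<b}" using sb by auto
      fix u assume "u \<in> {s<..<b}"
      then have "\<i> * (B u r - B s r) = integral {s..u} (\<lambda>\<tau>. F \<tau> r)"
        using eq[of s u r] sb r by (simp add: F_def P_def)
      then have "- \<i> * integral {s..u} (\<lambda>\<tau>. F \<tau> r) = B u r - B s r"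
        unfolding mult_minus_left by (metis complex_i_mult_minus minus_minus)
      then show "B s r + (- \<i>) * integral {s..u} (\<lambda>\<tau>. F \<tau> r) = B u r" by simp
    qed
  qed
  have d2: "((\<lambda>r. B t r) has_vector_derivative cnj (- \<i> * F r t)) (at r)" if "0 < r" "r < T" "t \<in> {0..T}" for t r
    using has_vector_derivative_cnj[OF d1[OF that]] by (simp flip: B)
  \<comment> \<open>The sum of the two partial derivatives, hence the derivative of B along the
    direction (1,1). In the next formula the contributions of A cancel and only the boundary kernel
    P survives.\<close>
  define D where "D t r = - \<i> * F t r + cnj (- \<i> * F r t)" for t r
  have D: "D t r = \<i> * (P t r - cnj (P r t))" for t r
    using A(2)[of t r] by (simp add: D_def F_def algebra_simps)
  \<comment> \<open>Separate differentiability does not give a derivative along the diagonal; one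
    partial must be continuous in both variables, and this follows from the joint continuity of
    F.\<close>
  have diag: "((\<lambda>\<tau>. B \<tau> (\<tau> + h)) has_vector_derivative D \<tau> (\<tau> + h)) (at \<tau>)"
    if h: "0 \<le> h" "0 < \<tau>" "\<tau> + h < T" for \<tau> h
  proof -
    let ?X = "{0<..<T}"
    let ?fy = "\<lambda>x y. blinfun_scaleR_left (cnj (- \<i> * F y x))"
    have "((\<lambda>(x, y). B x y) has_derivative (\<lambda>(tx, ty). tx *\<^sub>R (- \<i> * F \<tau> (\<tau> + h)) + ?fy \<tau> (\<tau> + h) ty))
        (at (\<tau>, \<tau> + h) within ?X \<times> ?X)"
    proof (rule has_derivative_partialsI)
      show "((\<lambda>x. B x (\<tau> + h)) has_derivative (\<lambda>tx. tx *\<^sub>R (- \<i> * F \<tau> (\<tau> + h)))) (at \<tau> within ?X)"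
        by (rule has_derivative_at_withinI)
          (use d1[of \<tau> "\<tau> + h"] h in \<open>simp add: has_vector_derivative_def\<close>)
      show "((\<lambda>y. B x y) has_derivative blinfun_apply (?fy x y)) (at y within ?X)"
        if "x \<in> ?X" "y \<in> ?X" for x y
        by (rule has_derivative_at_withinI)
          (use d2[of y x] that in \<open>simp add: has_vector_derivative_def\<close>)
      have "continuous_on (?X \<times> ?X) (\<lambda>p. ?fy (fst p) (snd p))"
        by (intro bounded_linear.continuous_on[OF bounded_linear_blinfun_scaleR_left] continuous_intros Fc) auto
      then show "continuous (at (\<tau>, \<tau> + h) within ?X \<times> ?X) (\<lambda>(x, y). ?fy x y)"
        using h unfolding continuous_on_eq_continuous_within case_prod_unfold by (elim ballE) auto
    qed (use h in auto)
    moreover have "at (\<tau>, \<tau> + h) within ?X \<times> ?X = at (\<tau>, \<tau> + h)"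
      using h by (intro at_within_open open_Times) auto
    ultimately have B': "((\<lambda>(x, y). B x y) has_derivative (\<lambda>(tx, ty). tx *\<^sub>R (- \<i> * F \<tau> (\<tau> + h)) + ?fy \<tau> (\<tau> + h) ty))
        (at (\<tau>, \<tau> + h))" by simp
    have "((\<lambda>\<tau>. (\<tau>, \<tau> + h)) has_derivative (\<lambda>d. (d, d))) (at \<tau>)"
      by (auto intro!: derivative_eq_intros)
    from has_derivative_compose[OF this B']
    show ?thesis by (simp add: has_vector_derivative_def D_def algebra_simps)
  qed
  have Dcont: "continuous_on {a..b} (\<lambda>\<tau>. D \<tau> (\<tau> + h))" if "0 \<le> h" "b + h < T" for h
    unfolding D_def using ab that by (intro continuous_intros Fc) auto
  have ftc: "((\<lambda>\<tau>. D \<tau> (\<tau> + h)) has_integral B b (b + h) - B a (a + h)) {a..b}" if h: "0 \<le> h" "b + h < T" for h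
    using ab h by (intro fundamental_theorem_of_calculus)
      (auto intro!: has_vector_derivative_at_within[OF diag])
  have "D \<tau> \<tau> = 0" for \<tau>
  proof -
    have "P \<tau> \<tau> = of_real ((cmod (w \<tau>))\<^sup>2 * (cmod (w \<tau>))\<^sup>2)"
      unfolding P_def by (simp only: mult.assoc of_real_mult complex_norm_square)
    then show ?thesis by (simp add: D)
  qed
  then have "((\<lambda>\<tau>. 0) has_integral B b b - B a a) {a..b}" using ftc[of 0] ab by simp
  then have "B b b - B a a = 0" using has_integral_unique[OF _ has_integral_0] by blast
  then show "B a a = B b b" by simp

  define W where "W t = (cmod (w t)) ^ 4" for t
  have Pdiag: "P t t = of_real (W t)" for t
    unfolding P_def W_def by (simp add: mult.assoc complex_norm_square[symmetric] power2_eq_square[symmetric])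
  \<comment> \<open>Starting at a/2 rather than a makes \<Phi> differentiable from both sides at
    a.\<close>
  define \<Phi> where "\<Phi> x = integral {a / 2..x} W" for x
  have Wc: "continuous_on {0..T} W" unfolding W_def by (intro continuous_intros w(1))
  have \<Phi>': "(\<Phi> has_real_derivative W x) (at x)" if "a / 2 < x" "x < T" for x
  proof -
    have "(\<Phi> has_real_derivative W x) (at x within {a / 2..T})"
      unfolding \<Phi>_def using that ab
      by (intro integral_has_real_derivative continuous_on_subset[OF Wc]) auto
    moreover have "at x within {a / 2..T} = at x" using that by (intro at_within_interior) auto
    ultimately show ?thesis by simp
  qed
  define Q where "Q h = integral {a..b} (\<lambda>\<tau>. (cmod (w (\<tau> + h) - w \<tau>))\<^sup>2)" for h
  have "compact (w ` {0..T})" using w(1) compact_Icc by (rule compact_continuous_image)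
  then obtain M where M: "0 < M" "\<And>t. t \<in> {0..T} \<Longrightarrow> cmod (w t) \<le> M"
    unfolding bounded_pos[symmetric] using compact_imp_bounded[of "w ` {0..T}"] by (auto simp: bounded_pos)
  \<comment> \<open>The leading part of Im D(\<tau>, \<tau>+h) is half the increment of |w|^4, an
    exact derivative whose integral involves only values of \<Phi> near a and b. What is left is
    quadratic in w(\<tau>+h) - w(\<tau>).\<close>
  have main: "\<bar>(Im (B b (b + h)) - Im (B a (a + h))) - (\<Phi> b - \<Phi> (b + h) + \<Phi> (a + h) - \<Phi> a) / 2\<bar> \<le> M\<^sup>2 * Q h"
    if h: "0 < h" "b + h < T" for h
  proof -
    have c1: "continuous_on {a..b} w" "continuous_on {a..b} (\<lambda>\<tau>. w (\<tau> + h))"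
      using ab h by (auto intro!: wc continuous_intros)
    have cW: "continuous_on {a..b} W" "continuous_on {a..b} (\<lambda>\<tau>. W (\<tau> + h))"
      unfolding W_def by (intro continuous_intros c1)+
    have iW: "(W has_integral \<Phi> b - \<Phi> a) {a..b}"
    proof (rule fundamental_theorem_of_calculus)
      fix x assume "x \<in> {a..b}"
      then show "(\<Phi> has_vector_derivative W x) (at x within {a..b})"
        using \<Phi>'[of x] ab by (simp add: has_real_derivative_iff_has_vector_derivative has_vector_derivative_at_within)
    qed (use ab in simp)
    have iWh: "((\<lambda>\<tau>. W (\<tau> + h)) has_integral \<Phi> (b + h) - \<Phi> (a + h)) {a..b}"
    proof (rule fundamental_theorem_of_calculus)
      fix x assume x: "x \<in> {a..b}"
      have "((\<lambda>x. \<Phi> (x + h)) has_real_derivative W (x + h)) (at x)"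
        using \<Phi>'[of "x + h"] x ab h unfolding DERIV_shift[symmetric] by (simp add: add.commute)
      then show "((\<lambda>x. \<Phi> (x + h)) has_vector_derivative W (x + h)) (at x within {a..b})"
        by (simp add: has_real_derivative_iff_has_vector_derivative has_vector_derivative_at_within)
    qed (use ab in simp)
    have "((\<lambda>\<tau>. Im (D \<tau> (\<tau> + h))) has_integral Im (B b (b + h) - B a (a + h))) {a..b}"
      using has_integral_linear[OF ftc bounded_linear_Im, of h] h by (simp add: o_def)
    moreover have "((\<lambda>\<tau>. (W \<tau> - W (\<tau> + h)) / 2) has_integral ((\<Phi> b - \<Phi> a) - (\<Phi> (b + h) - \<Phi> (a + h))) / 2) {a..b}"
      using has_integral_divide[OF has_integral_diff[OF iW iWh], of 2] .
    ultimately have i: "((\<lambda>\<tau>. Im (D \<tau> (\<tau> + h)) - (W \<tau> - W (\<tau> + h)) / 2) has_integral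
       Im (B b (b + h) - B a (a + h)) - ((\<Phi> b - \<Phi> a) - (\<Phi> (b + h) - \<Phi> (a + h))) / 2) {a..b}"
      by (rule has_integral_diff)
    have "((\<lambda>\<tau>. M\<^sup>2 * (cmod (w (\<tau> + h) - w \<tau>))\<^sup>2) has_integral M\<^sup>2 * Q h) {a..b}"
      unfolding Q_def by (intro has_integral_mult_right integrable_integral integrable_continuous_real continuous_intros c1)
    moreover have "norm (Im (D \<tau> (\<tau> + h)) - (W \<tau> - W (\<tau> + h)) / 2) \<le> M\<^sup>2 * (cmod (w (\<tau> + h) - w \<tau>))\<^sup>2"
      if "\<tau> \<in> {a..b}" for \<tau>
    proof -
      define z y where "z = w \<tau>" and "y = w (\<tau> + h)"
      \<comment> \<open>Polarisation, Re (z * cnj y) = (|z|^2 + |y|^2 - |y-z|^2)/2, multiplied by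
        |z|^2 - |y|^2 separates (|z|^4 - |y|^4)/2 from a remainder bounded by M^2 |y-z|^2.\<close>
      have zy: "cmod z \<le> M" "cmod y \<le> M" unfolding z_def y_def using that ab h by (auto intro!: M)
      have e1: "Im (D \<tau> (\<tau> + h)) = ((cmod z)\<^sup>2 - (cmod y)\<^sup>2) * Re (z * cnj y)"
        unfolding D P_def z_def[symmetric] y_def[symmetric] by (simp add: algebra_simps)
      have e2: "Re (z * cnj y) = ((cmod z)\<^sup>2 + (cmod y)\<^sup>2 - (cmod (y - z))\<^sup>2) / 2"
        unfolding cmod_power2 by (simp add: power2_eq_square field_simps)
      have e: "Im (D \<tau> (\<tau> + h)) - (W \<tau> - W (\<tau> + h)) / 2 = ((cmod y)\<^sup>2 - (cmod z)\<^sup>2) / 2 * (cmod (y - z))\<^sup>2"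
        unfolding e1 e2 W_def z_def[symmetric] y_def[symmetric]
        by (simp add: power2_eq_square power4_eq_xxxx field_simps)
      have "(cmod y)\<^sup>2 \<le> M\<^sup>2" "(cmod z)\<^sup>2 \<le> M\<^sup>2" using zy by (auto intro: power_mono)
      moreover have "\<bar>(Y - Z) / 2\<bar> \<le> K" if "0 \<le> Y" "0 \<le> Z" "Y \<le> K" "Z \<le> K" for Y Z K :: real
        using that by (auto simp: abs_le_iff)
      ultimately have bd: "\<bar>((cmod y)\<^sup>2 - (cmod z)\<^sup>2) / 2\<bar> \<le> M\<^sup>2" by simp
      then show ?thesis unfolding e y_def[symmetric] z_def[symmetric]
        using mult_right_mono[OF bd, of "(cmod (y - z))\<^sup>2"] by (simp add: abs_mult)
    qed
    ultimately have "norm (Im (B b (b + h) - B a (a + h)) - ((\<Phi> b - \<Phi> a) - (\<Phi> (b + h) - \<Phi> (a + h))) / 2) \<le> M\<^sup>2 * Q h"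
      using i by (metis (no_types, lifting) has_integral_integrable integral_norm_bound_integral integral_unique)
    then show ?thesis by (simp add: algebra_simps)
  qed

  have Bim: "Im (B t t) = 0" for t using B[of t t] by (simp add: complex_eq_iff)
  \<comment> \<open>Since B(t,t) is real, the quotient is a difference quotient in the second time;
    the imaginary part of cnj (-i F) is Re F, that is Re A - W on the diagonal.\<close>
  have dB: "((\<lambda>h. Im (B t (t + h)) / h) \<longlongrightarrow> Re (A t t) - W t) (at_right 0)" if "0 < t" "t < T" for t
  proof -
    have "((\<lambda>r. Im (B t r)) has_vector_derivative Im (cnj (- \<i> * F t t))) (at t)"
      using d2[of t t] that by (intro bounded_linear.has_vector_derivative[OF bounded_linear_Im]) auto
    then have "((\<lambda>r. Im (B t r)) has_real_derivative Re (A t t) - W t) (at t)"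
      by (simp add: has_real_derivative_iff_has_vector_derivative F_def Pdiag)
    then have "((\<lambda>h. Im (B t (t + h)) / h) \<longlongrightarrow> Re (A t t) - W t) (at 0)"
      by (simp add: DERIV_def Bim)
    then show ?thesis by (rule filterlim_mono) (auto simp: at_within_le_at)
  qed
  have d\<Phi>: "((\<lambda>h. (\<Phi> (t + h) - \<Phi> t) / h) \<longlongrightarrow> W t) (at_right 0)" if "a / 2 < t" "t < T" for t
  proof -
    have "((\<lambda>h. (\<Phi> (t + h) - \<Phi> t) / h) \<longlongrightarrow> W t) (at 0)"
      using \<Phi>'[OF that] by (simp add: DERIV_def)
    then show ?thesis by (rule filterlim_mono) (auto simp: at_within_le_at)
  qed
  \<comment> \<open>\<open>G h\<close> is the signed expression bounded in \<open>main\<close>,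
    divided by h. Its limit L is the change of Re A - |w|^4/2 from a to b, so it remains to show L =
    0.\<close>
  define G where "G h = Im (B b (b + h)) / h - Im (B a (a + h)) / h
     + (\<Phi> (b + h) - \<Phi> b) / h / 2 - (\<Phi> (a + h) - \<Phi> a) / h / 2" for h
  define L where "L = (Re (A b b) - W b) - (Re (A a a) - W a) + W b / 2 - W a / 2"
  have GL: "(G \<longlongrightarrow> L) (at_right 0)"
    unfolding G_def L_def using ab by (intro tendsto_intros dB d\<Phi>) auto
  have Gb: "\<bar>G h\<bar> * h \<le> M\<^sup>2 * Q h" if "0 < h" "b + h < T" for h
  proof -
    have "\<bar>G h\<bar> * h = \<bar>G h * h\<bar>" using that by (simp add: abs_mult)
    also have "G h * h = (Im (B b (b + h)) - Im (B a (a + h))) - (\<Phi> b - \<Phi> (b + h) + \<Phi> (a + h) - \<Phi> a) / 2"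
      using that by (simp add: G_def field_simps)
    finally show ?thesis using main[OF that] by simp
  qed
  have "L = 0"
  proof (rule ccontr)
    assume "L \<noteq> 0"
    then have "\<forall>\<^sub>F h in at_right 0. \<bar>L\<bar> / 2 < \<bar>G h\<bar>"
      by (intro order_tendstoD(1)[OF tendsto_rabs[OF GL]]) simp
    then obtain h0 where h0: "0 < h0" "\<And>h. 0 < h \<Longrightarrow> h < h0 \<Longrightarrow> \<bar>L\<bar> / 2 < \<bar>G h\<bar>"
      unfolding eventually_at_right_field by blast
    \<comment> \<open>This is the slope at which M^2 Q(h) falls below |L| h / 2, while |G h| stays
      above |L| / 2 near 0. The H^{3/4} regularity provides such an h arbitrarily close to 0, and
      one is enough.\<close>
    have "0 < \<bar>L\<bar> / 2 / M\<^sup>2" using \<open>L \<noteq> 0\<close> M by simp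
    then obtain h where h: "0 < h" "h < h0" "b + h < T" "Q h < \<bar>L\<bar> / 2 / M\<^sup>2 * h"
      using Hs_small_increments[OF w(2,1) ab _ h0(1)] unfolding Q_def by metis
    have "\<bar>L\<bar> / 2 * h < \<bar>G h\<bar> * h" using h0(2)[of h] h by simp
    also have "\<dots> \<le> M\<^sup>2 * Q h" using Gb h by simp
    also have "\<dots> < M\<^sup>2 * (\<bar>L\<bar> / 2 / M\<^sup>2 * h)"
      using h(4) M by (intro mult_strict_left_mono) auto
    finally show False using M by simp
  qed
  then show "Re (A a a) - (cmod (w a)) ^ 4 / 2 = Re (A b b) - (cmod (w b)) ^ 4 / 2"
    by (simp add: L_def W_def)
qed

section \<open>The ground state\<close>

text \<open>Comparison of u(x) with u(y) and averaging over y in [x, x+1]: the indicator of this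
  interval has L^2 norm 1, so Cauchy-Schwarz gives constant 1 in both terms.\<close>

lemma primitive_sup_bound:
  assumes u: "in_Lp lborel 2 u" and g: "in_Lp lborel 2 g" and p: "primitive_on UNIV u g"
  shows "cmod (u x) \<le> Lp_norm lborel 2 u + Lp_norm lborel 2 g"
proof -
  define J where "J y = complex_of_real (indicator {x..x+1} y)" for y
  have J2: "in_Lp lborel 2 J"
    unfolding J_def by (intro in_Lp_2_indicator) auto
  have "(cmod (J y))\<^sup>2 = indicator {x..x+1} y" for y by (auto simp: J_def indicator_def)
  then have Jn: "Lp_norm lborel 2 J = 1" by (simp add: Lp_norm_2)
  have CS: "(LINT y|lborel. cmod (J y) * cmod (f y)) \<le> Lp_norm lborel 2 f" if "in_Lp lborel 2 f" for f
    using Cauchy_Schwarz_Lp_2_abs[OF J2 that] Jn by simp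
  have iJ: "integrable lborel (\<lambda>y. cmod (J y) * cmod (f y))" if "in_Lp lborel 2 f" for f
    using integrable_norm[OF integrable_mult_Lp_2[OF J2 that]] by (simp add: norm_mult)
  have pt: "cmod (u x) \<le> cmod (u y) + Lp_norm lborel 2 g" if y: "y \<in> {x..x+1}" for y
  proof -
    have "cmod (u y - u x) \<le> (LINT z|lborel. cmod (indicator {x..y} z *\<^sub>R g z))"
      using primitive_on_integral[OF p, of x y] y integral_norm_bound[of lborel "\<lambda>z. indicator {x..y} z *\<^sub>R g z"]
      by (simp add: set_lebesgue_integral_def)
    also have "\<dots> \<le> (LINT z|lborel. cmod (J z) * cmod (g z))"
    proof (rule integral_mono)
      show "integrable lborel (\<lambda>z. cmod (indicator {x..y} z *\<^sub>R g z))"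
        using in_Lp_2_set_integrable[OF g, of x y] unfolding set_integrable_def by (rule integrable_norm)
    qed (use y iJ[OF g] in \<open>auto simp: J_def indicator_def\<close>)
    also have "\<dots> \<le> Lp_norm lborel 2 g" by (rule CS[OF g])
    finally show ?thesis using norm_triangle_sub[of "u x" "u y"] norm_minus_commute[of "u x" "u y"] by linarith
  qed
  have "(LINT y|lborel. (cmod (u x) - Lp_norm lborel 2 g) * indicator {x..x+1} y) \<le> (LINT y|lborel. cmod (J y) * cmod (u y))"
  proof (rule integral_mono)
    show "integrable lborel (\<lambda>y. (cmod (u x) - Lp_norm lborel 2 g) * indicator {x..x+1} y)"
      by (intro integrable_mult_right integrable_real_indicator) auto
    show "(cmod (u x) - Lp_norm lborel 2 g) * indicator {x..x+1} y \<le> cmod (J y) * cmod (u y)" for y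
      using pt[of y] by (auto simp: J_def indicator_def)
  qed (rule iJ[OF u])
  then show ?thesis using CS[OF u] by simp
qed

text \<open>Since \<open>sgn 0 = 0\<close>, the value at the corner is 0; its modulus therefore
  equals that of \<open>ground_state\<close> only almost everywhere.\<close>

definition ground_state_deriv :: "real \<Rightarrow> complex" where
  "ground_state_deriv x = of_real (- sgn x) * ground_state x"

lemma has_bochner_integral_exp_abs:
  "has_bochner_integral lborel (\<lambda>x::real. 2 * exp (- 2 * \<bar>x\<bar>)) 2"
proof -
  define e :: "real \<Rightarrow> real" where "e x = 2 * exp (- 2 * x) * indicator {0..} x" for x
  have "(\<integral>\<^sup>+x. ennreal (2 * exp (- 2 * x)) * indicator {0..} x \<partial>lborel) = ennreal (0 - (- exp (- 2 * 0)))"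
  proof (rule nn_integral_FTC_atLeast)
    show "((\<lambda>x::real. - exp (- 2 * x)) \<longlongrightarrow> 0) at_top" by real_asymp
    show "((\<lambda>x. - exp (- 2 * x)) has_real_derivative 2 * exp (- 2 * x)) (at x)" for x :: real
      by (auto intro!: derivative_eq_intros)
  qed auto
  moreover have "ennreal (2 * exp (- 2 * x)) * indicator {0..} x = ennreal (e x)" for x
    by (auto simp: e_def indicator_def)
  ultimately have nn: "(\<integral>\<^sup>+x. ennreal (e x) \<partial>lborel) = ennreal 1" by simp
  have e: "has_bochner_integral lborel e 1"
    by (rule has_bochner_integral_nn_integral[OF _ _ _ nn]) (auto simp: e_def)
  have e': "has_bochner_integral lborel (\<lambda>x. e (- x)) 1"
    using lborel_has_bochner_integral_real_affine_iff[of "-1" e 1 0] e by simp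
  have "has_bochner_integral lborel (\<lambda>x. e x + e (- x)) (1 + 1)"
    by (intro has_bochner_integral_add e e')
  moreover have "AE x in lborel. e x + e (- x) = 2 * exp (- 2 * \<bar>x\<bar>)"
    using AE_lborel_singleton[of "0::real"] by eventually_elim (auto simp: e_def indicator_def)
  ultimately show ?thesis
    by (subst (asm) has_bochner_integral_cong_AE[where g="\<lambda>x. 2 * exp (- 2 * \<bar>x\<bar>)"]) (auto simp: e_def)
qed

lemma ground_state_L2:
  "in_Lp lborel 2 ground_state" "Lp_norm lborel 2 ground_state = sqrt 2"
  "in_Lp lborel 2 ground_state_deriv" "Lp_norm lborel 2 ground_state_deriv = sqrt 2"
proof -
  have gs: "ground_state = (\<lambda>x. of_real (sqrt 2 * exp (- \<bar>x\<bar>)))" by (simp add: fun_eq_iff ground_state_def)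
  have gd: "ground_state_deriv = (\<lambda>x. of_real (- sgn x * (sqrt 2 * exp (- \<bar>x\<bar>))))"
    by (simp add: fun_eq_iff ground_state_def ground_state_deriv_def)
  have sq: "(cmod (ground_state x))\<^sup>2 = 2 * exp (- 2 * \<bar>x\<bar>)" for x
    unfolding gs norm_of_real power2_abs power_mult_distrib by (simp flip: exp_of_nat_mult exp_double)
  have meas: "ground_state \<in> borel_measurable lborel" "ground_state_deriv \<in> borel_measurable lborel"
    unfolding gs gd by measurable
  show g: "in_Lp lborel 2 ground_state" "Lp_norm lborel 2 ground_state = sqrt 2"
    using meas has_bochner_integral_exp_abs by (auto simp: in_Lp_2_iff Lp_norm_2 sq has_bochner_integral_iff)
  have ae: "AE x in lborel. (cmod (ground_state x))\<^sup>2 = (cmod (ground_state_deriv x))\<^sup>2"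
    using AE_lborel_singleton[of "0::real"]
    by eventually_elim (simp add: ground_state_deriv_def norm_mult abs_sgn_eq)
  have m2: "(\<lambda>x. (cmod (ground_state x))\<^sup>2) \<in> borel_measurable lborel"
    "(\<lambda>x. (cmod (ground_state_deriv x))\<^sup>2) \<in> borel_measurable lborel"
    using meas by measurable
  show "in_Lp lborel 2 ground_state_deriv" "Lp_norm lborel 2 ground_state_deriv = sqrt 2"
    using meas g integrable_cong_AE[OF m2 ae] integral_cong_AE[OF m2 ae] by (auto simp: in_Lp_2_iff Lp_norm_2)
qed

lemma ground_state_pos: "0 \<le> x \<Longrightarrow> ground_state x = of_real (sqrt 2 * exp (- x))"
  and ground_state_neg: "x \<le> 0 \<Longrightarrow> ground_state x = of_real (sqrt 2 * exp x)"
  by (auto simp: ground_state_def)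

lemma ground_state_has_derivative:
  assumes "x \<noteq> 0"
  shows "(ground_state has_vector_derivative ground_state_deriv x) (at x)"
    "(ground_state_deriv has_vector_derivative ground_state x) (at x)"
proof -
  have d1: "((\<lambda>x. complex_of_real (c * (sqrt 2 * exp (- x)))) has_vector_derivative of_real (- c * (sqrt 2 * exp (- x)))) (at x)"
    and d2: "((\<lambda>x. complex_of_real (c * (sqrt 2 * exp x))) has_vector_derivative of_real (c * (sqrt 2 * exp x))) (at x)" for c
    by (auto intro!: has_vector_derivative_of_real derivative_eq_intros
        simp flip: has_real_derivative_iff_has_vector_derivative)
  consider "x > 0" | "x < 0" using assms by linarith
  then have "(ground_state has_vector_derivative ground_state_deriv x) (at x) \<and>
    (ground_state_deriv has_vector_derivative ground_state x) (at x)"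
  proof cases
    case 1
    have "(ground_state has_vector_derivative of_real (- 1 * (sqrt 2 * exp (- x)))) (at x)"
      by (rule has_vector_derivative_transform_within_open[OF d1[of 1], of "{0<..}"])
         (use 1 in \<open>auto simp: ground_state_pos\<close>)
    moreover have "(ground_state_deriv has_vector_derivative of_real (- (-1) * (sqrt 2 * exp (- x)))) (at x)"
      by (rule has_vector_derivative_transform_within_open[OF d1[of "-1"], of "{0<..}"])
         (use 1 in \<open>auto simp: ground_state_pos ground_state_deriv_def\<close>)
    ultimately show ?thesis using 1 by (simp add: ground_state_pos ground_state_deriv_def)
  next
    case 2
    have "(ground_state has_vector_derivative of_real (1 * (sqrt 2 * exp x))) (at x)"
      by (rule has_vector_derivative_transform_within_open[OF d2[of 1], of "{..<0}"])
         (use 2 in \<open>auto simp: ground_state_neg\<close>)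
    moreover have "(ground_state_deriv has_vector_derivative of_real (1 * (sqrt 2 * exp x))) (at x)"
      by (rule has_vector_derivative_transform_within_open[OF d2[of 1], of "{..<0}"])
         (use 2 in \<open>auto simp: ground_state_neg ground_state_deriv_def\<close>)
    ultimately show ?thesis using 2 by (simp add: ground_state_neg ground_state_deriv_def)
  qed
  then show "(ground_state has_vector_derivative ground_state_deriv x) (at x)"
    "(ground_state_deriv has_vector_derivative ground_state x) (at x)" by auto
qed

lemma continuous_on_ground_state: "continuous_on S ground_state"
  unfolding ground_state_def[abs_def] by (intro continuous_intros)

lemma primitive_on_ground_state: "primitive_on UNIV ground_state ground_state_deriv"
  unfolding primitive_on_def
proof (intro allI impI conjI)
  fix x y :: real assume xy: "x \<le> y \<and> {x..y} \<subseteq> UNIV"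
  show s: "set_integrable lborel {x..y} ground_state_deriv"
    by (rule in_Lp_2_set_integrable[OF ground_state_L2(3)])
  have "(ground_state_deriv has_integral ground_state y - ground_state x) {x..y}"
    by (rule fundamental_theorem_of_calculus_interior_strong[of "{0}"])
       (use xy ground_state_has_derivative(1) continuous_on_ground_state in auto)
  then show "ground_state y - ground_state x = (LINT z:{x..y}|lborel. ground_state_deriv z)"
    using set_borel_integral_eq_integral(2)[OF s] by (simp add: integral_unique)
qed

text \<open>The reproducing kernel of H^1 at 0 is exp(-|x|)/2, and the ground state is 2 sqrt 2
  times it. In the proof \<open>ground_state_deriv\<close> is the function with a jump: its
  one-sided limits are -sqrt 2 and sqrt 2, and its derivative off 0 is the ground state
  itself.\<close>

lemma ground_state_reproducing:
  fixes u g :: "real \<Rightarrow> complex"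
  assumes u: "in_Lp lborel 2 u" and g: "in_Lp lborel 2 g" and p: "primitive_on UNIV u g"
  shows "inner_L2 u ground_state + inner_L2 g ground_state_deriv = 2 * sqrt 2 * u 0"
proof -
  have "(LINT x|lborel. ground_state_deriv x * g x) =
     - (- of_real (sqrt 2) - of_real (sqrt 2)) * u 0 - (LINT x|lborel. ground_state x * u x)"
  proof (rule integral_by_parts_jump)
    show "primitive_on {0<..} ground_state_deriv ground_state" "primitive_on {..<0} ground_state_deriv ground_state"
      by (auto intro!: primitive_onI_C1 ground_state_has_derivative continuous_on_ground_state)
    have "isCont ground_state 0"
      using continuous_on_ground_state[of UNIV] by (simp add: continuous_on_eq_continuous_at)
    then have l: "(ground_state \<longlongrightarrow> of_real (sqrt 2)) (at_right 0)" "(ground_state \<longlongrightarrow> of_real (sqrt 2)) (at_left 0)"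
      by (auto simp: isCont_def filterlim_at_split ground_state_def)
    show "(ground_state_deriv \<longlongrightarrow> - of_real (sqrt 2)) (at_right 0)"
      by (rule Lim_transform_eventually[OF tendsto_minus[OF l(1)]])
         (auto simp: ground_state_deriv_def intro!: eventually_at_rightI[of 0 1])
    show "(ground_state_deriv \<longlongrightarrow> of_real (sqrt 2)) (at_left 0)"
      by (rule Lim_transform_eventually[OF l(2)])
         (auto simp: ground_state_deriv_def intro!: eventually_at_leftI[of "-1" 0])
  qed (use p in_Lp_2_set_integrable integrable_mult_Lp_2 ground_state_L2 u g in auto)
  moreover have "cnj (ground_state x) = ground_state x" "cnj (ground_state_deriv x) = ground_state_deriv x" for x
    by (auto simp: ground_state_def ground_state_deriv_def)
  ultimately show ?thesis unfolding inner_L2_def by (simp add: mult.commute)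
qed

lemma Lp_norm_2_diff_power2:
  assumes "in_Lp lborel 2 f" "in_Lp lborel 2 g"
  shows "(Lp_norm lborel 2 (\<lambda>x. f x - g x))\<^sup>2 =
    (Lp_norm lborel 2 f)\<^sup>2 + (Lp_norm lborel 2 g)\<^sup>2 - 2 * Re (inner_L2 f g)"
proof -
  have "inner_L2 (\<lambda>x. f x - g x) (\<lambda>x. f x - g x) = inner_L2 f f + inner_L2 g g - inner_L2 f g - cnj (inner_L2 f g)"
    using assms by (simp add: inner_L2_diff in_Lp_2_diff inner_L2_cnj[of g f])
  then show ?thesis unfolding inner_L2_self by (simp add: complex_eq_iff)
qed

text \<open>Expanding the square, the cross term is the reproducing identity, and the constant 4 is
  the squared H^1 norm of the ground state. The distance thus depends on \<open>u\<close> only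
  through two norms and one point value.\<close>

lemma H1_norm_diff_ground_state:
  assumes u: "in_Lp lborel 2 u" and g: "in_Lp lborel 2 g" and p: "primitive_on UNIV u g"
  shows "(H1_norm (\<lambda>x. u x - ground_state x))\<^sup>2 =
    (Lp_norm lborel 2 u)\<^sup>2 + (Lp_norm lborel 2 g)\<^sup>2 + 4 - 4 * sqrt 2 * Re (u 0)"
proof -
  have "(H1_norm (\<lambda>x. u x - ground_state x))\<^sup>2 =
    (Lp_norm lborel 2 (\<lambda>x. u x - ground_state x))\<^sup>2 + (Lp_norm lborel 2 (\<lambda>x. g x - ground_state_deriv x))\<^sup>2"
    unfolding H1_norm_def
    using H1_primitive(3)[OF in_Lp_2_diff(1)[OF u ground_state_L2(1)] in_Lp_2_diff(1)[OF g ground_state_L2(3)]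
        primitive_on_diff[OF p primitive_on_ground_state]] by simp
  moreover have "Re (inner_L2 u ground_state) + Re (inner_L2 g ground_state_deriv) = 2 * sqrt 2 * Re (u 0)"
    using ground_state_reproducing[OF assms] by (simp add: complex_eq_iff)
  ultimately show ?thesis
    using u g ground_state_L2 by (simp add: Lp_norm_2_diff_power2)
qed

lemma mass_ground_state: "mass ground_state = 2"
  by (simp add: mass_def ground_state_L2)

section \<open>The equation tested away from the origin\<close>

lemma eventually_within_self: "\<forall>\<^sub>F s in at t within S. s \<in> S"
  by (simp add: eventually_at_filter)

lemma H1_norm_ge:
  assumes "in_H1 f" "in_H1 g"
  shows "Lp_norm lborel 2 (\<lambda>x. f x - g x) \<le> H1_norm (\<lambda>x. f x - g x)"
    "Lp_norm lborel 2 (\<lambda>x. wderiv f x - wderiv g x) \<le> H1_norm (\<lambda>x. f x - g x)"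
proof -
  have "Lp_norm lborel 2 (wderiv (\<lambda>x. f x - g x)) = Lp_norm lborel 2 (\<lambda>x. wderiv f x - wderiv g x)"
    using assms by (intro H1_primitive(3) in_Lp_2_diff primitive_on_diff in_H1D)
  then show "Lp_norm lborel 2 (\<lambda>x. f x - g x) \<le> H1_norm (\<lambda>x. f x - g x)"
    "Lp_norm lborel 2 (\<lambda>x. wderiv f x - wderiv g x) \<le> H1_norm (\<lambda>x. f x - g x)"
    unfolding H1_norm_def by (auto intro!: real_le_rsqrt)
qed

lemma C_H1D:
  assumes "C_H1 T \<psi>" "t \<in> {0..T}"
  shows "in_H1 (\<psi> t)"
    "((\<lambda>s. Lp_norm lborel 2 (\<lambda>x. \<psi> s x - \<psi> t x)) \<longlongrightarrow> 0) (at t within {0..T})"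
    "((\<lambda>s. Lp_norm lborel 2 (\<lambda>x. wderiv (\<psi> s) x - wderiv (\<psi> t) x)) \<longlongrightarrow> 0) (at t within {0..T})"
proof -
  have H: "in_H1 (\<psi> s)" if "s \<in> {0..T}" for s using assms(1) that by (auto simp: C_H1_def)
  then show "in_H1 (\<psi> t)" using assms(2) .
  have lim: "((\<lambda>s. H1_norm (\<lambda>x. \<psi> s x - \<psi> t x)) \<longlongrightarrow> 0) (at t within {0..T})"
    using assms by (auto simp: C_H1_def)
  have ev: "\<forall>\<^sub>F s in at t within {0..T}. s \<in> {0..T}" by (rule eventually_within_self)
  show "((\<lambda>s. Lp_norm lborel 2 (\<lambda>x. \<psi> s x - \<psi> t x)) \<longlongrightarrow> 0) (at t within {0..T})"
    by (rule tendsto_sandwich[OF _ _ tendsto_const lim])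
      (use ev in \<open>eventually_elim, use H assms(2) H1_norm_ge Lp_norm_2_nonneg in blast\<close>)+
  show "((\<lambda>s. Lp_norm lborel 2 (\<lambda>x. wderiv (\<psi> s) x - wderiv (\<psi> t) x)) \<longlongrightarrow> 0) (at t within {0..T})"
    by (rule tendsto_sandwich[OF _ _ tendsto_const lim])
      (use ev in \<open>eventually_elim, use H assms(2) H1_norm_ge Lp_norm_2_nonneg in blast\<close>)+
qed

lemma C_H1_L2:
  assumes "C_H1 T \<psi>" "t \<in> {0..T}"
  shows "in_Lp lborel 2 (\<psi> t)" "in_Lp lborel 2 (wderiv (\<psi> t))"
  using C_H1D(1)[OF assms] in_H1D by auto

lemma continuous_on_inner_L2_fixed:
  fixes f :: "real \<Rightarrow> real \<Rightarrow> complex"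
  assumes L2: "\<And>t. t \<in> S \<Longrightarrow> in_Lp lborel 2 (f t)" and h: "in_Lp lborel 2 h"
    and cont: "\<And>t. t \<in> S \<Longrightarrow> ((\<lambda>s. Lp_norm lborel 2 (\<lambda>x. f s x - f t x)) \<longlongrightarrow> 0) (at t within S)"
  shows "continuous_on S (\<lambda>t. LINT x|lborel. f t x * h x)"
  unfolding continuous_on_def
proof
  fix t assume t: "t \<in> S"
  have lim: "((\<lambda>s. Lp_norm lborel 2 (\<lambda>x. f s x - f t x) * Lp_norm lborel 2 h) \<longlongrightarrow> 0) (at t within S)"
    using tendsto_mult[OF cont[OF t] tendsto_const] by simp
  have "((\<lambda>s. (LINT x|lborel. f s x * h x) - (LINT x|lborel. f t x * h x)) \<longlongrightarrow> 0) (at t within S)"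
  proof (rule Lim_null_comparison[OF _ lim])
    show "\<forall>\<^sub>F s in at t within S. cmod ((LINT x|lborel. f s x * h x) - (LINT x|lborel. f t x * h x))
      \<le> Lp_norm lborel 2 (\<lambda>x. f s x - f t x) * Lp_norm lborel 2 h"
      using eventually_within_self
    proof eventually_elim
      case (elim s)
      have "(LINT x|lborel. f s x * h x) - (LINT x|lborel. f t x * h x) = (LINT x|lborel. (f s x - f t x) * h x)"
        using L2[OF t] L2[OF elim] h by (simp add: left_diff_distrib integrable_mult_Lp_2)
      then show ?case
        using Cauchy_Schwarz_Lp_2_norm[OF in_Lp_2_diff(1)[OF L2[OF elim] L2[OF t]] h] by simp
    qed
  qed
  then show "((\<lambda>t. LINT x|lborel. f t x * h x) \<longlongrightarrow> (LINT x|lborel. f t x * h x)) (at t within S)"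
    by (simp add: LIM_zero_iff)
qed

text \<open>Convergence in H^1 is uniform in x by \<open>primitive_sup_bound\<close>, and each time
  slice is continuous. This makes space-time integrands against compactly supported functions
  continuous on a compact box, hence integrable for Fubini.\<close>

lemma C_H1_jointly_continuous:
  assumes C: "C_H1 T \<psi>"
  shows "continuous_on ({0..T} \<times> UNIV) (\<lambda>p. \<psi> (fst p) (snd p))"
  unfolding continuous_on_def
proof safe
  fix t x :: real assume t: "t \<in> {0..T}"
  let ?N = "\<lambda>s. Lp_norm lborel 2 (\<lambda>x. \<psi> s x - \<psi> t x) + Lp_norm lborel 2 (\<lambda>x. wderiv (\<psi> s) x - wderiv (\<psi> t) x)"
  have "(?N \<longlongrightarrow> ?N t) (at t within {0..T})"
    using tendsto_add[OF C_H1D(2,3)[OF C t]] by (simp add: Lp_norm_2)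
  then have "continuous (at t within {0..T}) ?N" by (simp add: continuous_within)
  then have "continuous (at (t, x) within {0..T} \<times> UNIV) (\<lambda>p. ?N (fst p))"
    by (intro continuous_within_compose2[where f=fst and x="(t, x)" and g="?N" and s="{0..T} \<times> UNIV"])
      (auto intro!: continuous_intros intro: continuous_within_subset)
  then have l1: "((\<lambda>p. ?N (fst p)) \<longlongrightarrow> 0) (at (t, x) within {0..T} \<times> UNIV)"
    by (simp add: continuous_within Lp_norm_2)
  have "isCont (\<psi> t) x"
    using primitive_on_UNIV_continuous[OF in_H1D(3)[OF C_H1D(1)[OF C t]]] by (simp add: continuous_on_eq_continuous_at)
  then have "continuous (at (t, x) within {0..T} \<times> UNIV) (\<lambda>p. \<psi> t (snd p))"
    by (intro continuous_within_compose2[where f=snd and x="(t, x)" and g="\<psi> t" and s="{0..T} \<times> UNIV"])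
      (auto intro!: continuous_intros intro: continuous_at_imp_continuous_at_within)
  then have "((\<lambda>p. cmod (\<psi> t (snd p) - \<psi> t x)) \<longlongrightarrow> 0) (at (t, x) within {0..T} \<times> UNIV)"
    by (simp add: continuous_within tendsto_norm_zero_iff LIM_zero_iff)
  from tendsto_add[OF l1 this]
  have lim: "((\<lambda>p. ?N (fst p) + cmod (\<psi> t (snd p) - \<psi> t x)) \<longlongrightarrow> 0) (at (t, x) within {0..T} \<times> UNIV)" by simp
  have "((\<lambda>p. \<psi> (fst p) (snd p) - \<psi> t x) \<longlongrightarrow> 0) (at (t, x) within {0..T} \<times> UNIV)"
  proof (rule Lim_null_comparison[OF _ lim])
    have "\<forall>\<^sub>F p in at (t, x) within {0..T} \<times> UNIV. p \<in> {0..T} \<times> UNIV"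
      by (simp add: eventually_at_filter)
    then show "\<forall>\<^sub>F p in at (t, x) within {0..T} \<times> UNIV. cmod (\<psi> (fst p) (snd p) - \<psi> t x)
      \<le> ?N (fst p) + cmod (\<psi> t (snd p) - \<psi> t x)"
    proof eventually_elim
      case (elim p)
      then have s: "fst p \<in> {0..T}" by auto
      have "cmod (\<psi> (fst p) (snd p) - \<psi> t (snd p)) \<le> ?N (fst p)"
        using C_H1D(1)[OF C t] C_H1D(1)[OF C s]
        by (intro primitive_sup_bound[where u="\<lambda>x. \<psi> (fst p) x - \<psi> t x"] in_Lp_2_diff primitive_on_diff in_H1D)
      then show ?case
        using norm_triangle_ineq[of "\<psi> (fst p) (snd p) - \<psi> t (snd p)" "\<psi> t (snd p) - \<psi> t x"] by simp
    qed
  qed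
  then show "((\<lambda>p. \<psi> (fst p) (snd p)) \<longlongrightarrow> \<psi> (fst (t, x)) (snd (t, x))) (at (t, x) within {0..T} \<times> UNIV)"
    by (simp add: LIM_zero_iff)
qed

lemma C_H1_continuous_at_point:
  assumes C: "C_H1 T \<psi>"
  shows "continuous_on {0..T} (\<lambda>t. \<psi> t x)"
proof -
  have "continuous_on {0..T} (\<lambda>t. (t, x))" by (intro continuous_intros)
  from continuous_on_compose2[OF C_H1_jointly_continuous[OF C] this] show ?thesis by auto
qed

section \<open>Test functions and their tensor products\<close>

lemma test_function_vanishes:
  fixes \<phi> :: "real \<Rightarrow> real"
  assumes "test_function \<Omega> \<phi>" "x \<notin> \<Omega>"
  shows "\<phi> x = 0" "deriv \<phi> x = 0"
proof -
  have x: "x \<in> - closure {x. \<phi> x \<noteq> 0}" using assms by (auto simp: test_function_def)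
  have z: "\<phi> y = 0" if "y \<in> - closure {x. \<phi> x \<noteq> 0}" for y
    using that closure_subset[of "{x. \<phi> x \<noteq> 0}"] by blast
  show "\<phi> x = 0" using z x by blast
  have "open (- closure {x. \<phi> x \<noteq> 0})" by blast
  from eventually_nhds_in_open[OF this x] have "\<forall>\<^sub>F y in nhds x. \<phi> y = 0"
    by eventually_elim (rule z)
  then have "deriv \<phi> x = deriv (\<lambda>_. 0) x" by (rule deriv_cong_ev) simp
  then show "deriv \<phi> x = 0" by simp
qed

lemma test_function_deriv:
  fixes \<phi> :: "real \<Rightarrow> real"
  assumes "test_function \<Omega> \<phi>"
  shows "test_function \<Omega> (deriv \<phi>)"
proof -
  have "test_function (closure {x. \<phi> x \<noteq> 0}) \<phi>" using assms by (simp add: test_function_def)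
  then have "{x. deriv \<phi> x \<noteq> 0} \<subseteq> closure {x. \<phi> x \<noteq> 0}" using test_function_vanishes(2) by blast
  then have sub: "closure {x. deriv \<phi> x \<noteq> 0} \<subseteq> closure {x. \<phi> x \<noteq> 0}" by (intro closure_minimal) auto
  have "compact (closure {x. deriv \<phi> x \<noteq> 0})"
    using assms compact_Int_closed[of "closure {x. \<phi> x \<noteq> 0}" "closure {x. deriv \<phi> x \<noteq> 0}"] sub
    by (simp add: test_function_def inf.absorb2)
  then show ?thesis using assms sub by (auto simp: test_function_def smooth_deriv)
qed

lemma test_function_L2:
  fixes \<phi> :: "real \<Rightarrow> real"
  assumes "test_function \<Omega> \<phi>"
  shows "in_Lp lborel 2 (\<lambda>x. complex_of_real (\<phi> x))"
proof -
  obtain R where R: "0 < R" "\<And>x. R \<le> \<bar>x\<bar> \<Longrightarrow> \<phi> x = 0"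
    using compact_support_bound[of \<phi>] assms unfolding test_function_def by metis
  have c: "continuous_on S \<phi>" for S using assms by (intro continuous_on_smooth) (simp add: test_function_def)
  have "integrable lborel (\<lambda>x. indicator {-R..R} x *\<^sub>R (\<phi> x)\<^sup>2)"
    by (intro borel_integrable_compact continuous_intros c) auto
  moreover have eq: "indicator {-R..R} x *\<^sub>R (\<phi> x)\<^sup>2 = (cmod (complex_of_real (\<phi> x)))\<^sup>2" for x
    using R(2)[of x] by (cases "x \<in> {-R..R}") auto
  moreover have "(\<lambda>x. complex_of_real (\<phi> x)) \<in> borel_measurable lborel"
    using borel_measurable_continuous_onI[OF c] by simp
  ultimately show ?thesis unfolding in_Lp_2_iff eq by simp
qed

lemma frechet_derivative_tensor:
  assumes "smooth \<alpha>" "smooth \<beta>"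
  shows "frechet_derivative (\<lambda>p. \<alpha> (fst p) * \<beta> (snd p)) (at p) v =
    fst v * (deriv \<alpha> (fst p) * \<beta> (snd p)) + snd v * (\<alpha> (fst p) * deriv \<beta> (snd p))"
proof -
  have a: "((\<lambda>p. \<alpha> (fst p)) has_derivative (\<lambda>v. fst v * deriv \<alpha> (fst p))) (at p)"
    using has_derivative_compose[OF has_derivative_fst[OF has_derivative_ident]
        smooth_has_real_derivative[OF assms(1), unfolded has_field_derivative_def]] by (simp add: mult.commute)
  have b: "((\<lambda>p. \<beta> (snd p)) has_derivative (\<lambda>v. snd v * deriv \<beta> (snd p))) (at p)"
    using has_derivative_compose[OF has_derivative_snd[OF has_derivative_ident]
        smooth_has_real_derivative[OF assms(2), unfolded has_field_derivative_def]] by (simp add: mult.commute)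
  show ?thesis
    using frechet_derivative_at[OF has_derivative_mult[OF a b]]
    by (simp add: algebra_simps fun_eq_iff)
qed

lemma test_function_tensor:
  assumes \<alpha>: "test_function A \<alpha>" and \<beta>: "test_function B \<beta>"
  shows "test_function (A \<times> B) (\<lambda>p. \<alpha> (fst p) * \<beta> (snd p))"
proof -
  have "smooth (\<lambda>p. \<alpha> (fst p + 0))" "smooth (\<lambda>p. \<beta> (snd p + 0))" 
    using assms by (auto simp: test_function_def simp del: add_0_right intro!: smooth_affine bounded_linear_fst bounded_linear_snd)
  then have sm: "smooth (\<lambda>p. \<alpha> (fst p) * \<beta> (snd p))" by (intro smooth_mult) simp_all
  let ?K = "closure {x. \<alpha> x \<noteq> 0} \<times> closure {x. \<beta> x \<noteq> 0}"
  have K: "compact ?K" using assms by (intro compact_Times) (auto simp: test_function_def)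
  have sub: "closure {p. \<alpha> (fst p) * \<beta> (snd p) \<noteq> 0} \<subseteq> ?K"
    using closure_subset[of "{x. \<alpha> x \<noteq> 0}"] closure_subset[of "{x. \<beta> x \<noteq> 0}"]
    by (intro closure_minimal compact_imp_closed[OF K]) auto
  then have "compact (closure {p. \<alpha> (fst p) * \<beta> (snd p) \<noteq> 0})"
    using compact_Int_closed[OF K, of "closure {p. \<alpha> (fst p) * \<beta> (snd p) \<noteq> 0}"] by (simp add: inf.absorb2)
  with sm sub assms show ?thesis unfolding test_function_def by blast
qed

text \<open>Tensor products \<alpha>(t) \<beta>(x) turn the space-time identity into a weak time
  derivative of the pairing of psi(t) with \<beta>, to which
  \<open>weak_derivative_imp_primitive\<close> applies in the time variable. The equation lives on
  the open interval (0,T), hence 0 < s and t < T.\<close>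

lemma free_evolution_tested:
  assumes C: "C_H1 T \<psi>" and S: "free_schrodinger_off_origin T \<psi>" and \<beta>: "test_function (- {0}) \<beta>"
    and st: "0 < s" "s \<le> t" "t < T"
  shows "\<i> * ((LINT x|lborel. \<psi> t x * of_real (\<beta> x)) - (LINT x|lborel. \<psi> s x * of_real (\<beta> x))) =
    (LINT \<tau>:{s..t}|lborel. LINT x|lborel. wderiv (\<psi> \<tau>) x * of_real (deriv \<beta> x))"
proof -
  let ?b = "\<lambda>t. LINT x|lborel. \<psi> t x * of_real (\<beta> x)"
  let ?k = "\<lambda>t. LINT x|lborel. \<psi> t x * of_real (deriv (deriv \<beta>) x)"
  note t1 = test_function_deriv[OF \<beta>] and t2 = test_function_deriv[OF test_function_deriv[OF \<beta>]]
  have sm: "smooth \<beta>" "smooth (deriv \<beta>)" "smooth (deriv (deriv \<beta>))"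
    using \<beta> by (auto simp: test_function_def intro: smooth_deriv)
  have cb: "continuous_on {0..T} ?b" and ck: "continuous_on {0..T} ?k"
    by (rule continuous_on_inner_L2_fixed; use C_H1D[OF C] C_H1_L2[OF C] test_function_L2[OF \<beta>] test_function_L2[OF t2] in blast)+
  obtain R where R: "0 < R" "\<And>x. R \<le> \<bar>x\<bar> \<Longrightarrow> \<beta> x = 0 \<and> deriv \<beta> x = 0"
    using compact_support_bound[of \<beta>] \<beta> unfolding test_function_def by metis
  obtain R' where R': "0 < R'" "\<And>x. R' \<le> \<bar>x\<bar> \<Longrightarrow> deriv \<beta> x = 0 \<and> deriv (deriv \<beta>) x = 0"
    using compact_support_bound[of "deriv \<beta>"] t1 unfolding test_function_def by metis
  have "primitive_on {0<..<T} (\<lambda>t. - \<i> * ?b t) ?k"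
  proof (rule weak_derivative_imp_primitive)
    show "continuous_on {0<..<T} (\<lambda>t. - \<i> * ?b t)"
      by (intro continuous_intros continuous_on_subset[OF cb]) auto
    show "set_integrable lborel {a..b} ?k" if "{a..b} \<subseteq> {0<..<T}" for a b
      unfolding set_integrable_def
      by (intro borel_integrable_compact continuous_on_subset[OF ck]) (use that in force)+
    fix \<alpha> assume \<alpha>: "test_function {0<..<T} \<alpha>"
    then have sa: "smooth \<alpha>" "smooth (deriv \<alpha>)" by (auto simp: test_function_def intro: smooth_deriv)
    have out: "\<alpha> t = 0 \<and> deriv \<alpha> t = 0" if "t \<notin> {0..T}" for t
      using test_function_vanishes[OF \<alpha>, of t] that by auto
    have ca: "continuous_on X (\<lambda>t. complex_of_real (\<alpha> t))" "continuous_on X (\<lambda>t. complex_of_real (deriv \<alpha> t))" for X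
      by (intro continuous_intros continuous_on_smooth sa)+
    define J where "J p = \<psi> (fst p) (snd p) * (- \<i> * of_real (deriv \<alpha> (fst p) * \<beta> (snd p)) +
      of_real (\<alpha> (fst p) * deriv (deriv \<beta>) (snd p)))" for p
    define B where "B = max R R'"
    \<comment> \<open>The integrand is continuous only on [0,T] in time, and \<psi> is uncontrolled
      outside; the supports of \<alpha> and \<beta> confine everything to a compact box.\<close>
    have J0: "J p = indicator ({0..T} \<times> {-B..B}) p *\<^sub>R J p" for p
    proof (cases "p \<in> {0..T} \<times> {-B..B}")
      case False
      then have "fst p \<notin> {0..T} \<or> B \<le> \<bar>snd p\<bar>" by (cases p) (auto simp: not_le)
      then have "J p = 0" using out[of "fst p"] R(2)[of "snd p"] R'(2)[of "snd p"] by (auto simp: J_def B_def)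
      then show ?thesis by simp
    qed simp
    have "continuous_on ({0..T} \<times> {-B..B}) J"
      unfolding J_def
      by (intro continuous_intros continuous_on_subset[OF C_H1_jointly_continuous[OF C]]
          continuous_on_compose2[OF continuous_on_smooth[OF sa(1), of UNIV]]
          continuous_on_compose2[OF continuous_on_smooth[OF sa(2), of UNIV]]
          continuous_on_compose2[OF continuous_on_smooth[OF sm(1), of UNIV]]
          continuous_on_compose2[OF continuous_on_smooth[OF sm(3), of UNIV]]) auto
    then have "integrable lborel (\<lambda>p. indicator ({0..T} \<times> {-B..B}) p *\<^sub>R J p)"
      by (intro borel_integrable_compact compact_Times) auto
    then have Ji: "integrable (lborel \<Otimes>\<^sub>M lborel) J" unfolding J0[symmetric] lborel_prod .
    have "(LINT p|lborel. J p) = 0"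
    proof -
      let ?\<phi> = "\<lambda>p. \<alpha> (fst p) * \<beta> (snd p)"
      have d1: "dir_deriv (1, 0) ?\<phi> p = deriv \<alpha> (fst p) * \<beta> (snd p)" for p
        by (simp add: frechet_derivative_tensor sa sm)
      have d2: "dir_deriv (0, 1) ?\<phi> = (\<lambda>p. \<alpha> (fst p) * deriv \<beta> (snd p))"
        by (simp add: frechet_derivative_tensor sa sm)
      have d3: "dir_deriv (0, 1) (dir_deriv (0, 1) ?\<phi>) p = \<alpha> (fst p) * deriv (deriv \<beta>) (snd p)" for p
        unfolding d2 by (simp add: frechet_derivative_tensor sa sm)
      show ?thesis
        using S[unfolded free_schrodinger_off_origin_def, rule_format, OF test_function_tensor[OF \<alpha> \<beta>]]
        unfolding J_def d1 d3 .
    qed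
    also have "(LINT p|lborel. J p) = (LINT t|lborel. LINT x|lborel. J (t, x))"
      unfolding lborel_prod[symmetric] by (rule lborel_pair.integral_fst'[OF Ji, symmetric])
    also have "\<dots> = (LINT t|lborel. (- \<i> * ?b t) * of_real (deriv \<alpha> t) + ?k t * of_real (\<alpha> t))"
    proof (rule Bochner_Integration.integral_cong[OF refl])
      fix t
      show "(LINT x|lborel. J (t, x)) = (- \<i> * ?b t) * of_real (deriv \<alpha> t) + ?k t * of_real (\<alpha> t)"
      proof (cases "t \<in> {0..T}")
        case True
        have "(LINT x|lborel. J (t, x)) = (LINT x|lborel. (- \<i> * of_real (deriv \<alpha> t)) * (\<psi> t x * of_real (\<beta> x))
            + of_real (\<alpha> t) * (\<psi> t x * of_real (deriv (deriv \<beta>) x)))"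
          by (rule Bochner_Integration.integral_cong) (auto simp: J_def algebra_simps)
        also have "\<dots> = (- \<i> * of_real (deriv \<alpha> t)) * ?b t + of_real (\<alpha> t) * ?k t"
          using integrable_mult_Lp_2[OF C_H1_L2(1)[OF C True] test_function_L2[OF \<beta>]]
            integrable_mult_Lp_2[OF C_H1_L2(1)[OF C True] test_function_L2[OF t2]]
          by (subst Bochner_Integration.integral_add) (auto simp del: of_real_mult)
        finally show ?thesis by (simp add: algebra_simps)
      next
        case False
        then show ?thesis using out[of t] by (simp add: J_def)
      qed
    qed
    also have "\<dots> = (LINT t|lborel. (- \<i> * ?b t) * of_real (deriv \<alpha> t)) + (LINT t|lborel. ?k t * of_real (\<alpha> t))"
    proof (rule Bochner_Integration.integral_add)
      have "integrable lborel (\<lambda>t. indicator {0..T} t *\<^sub>R ((- \<i> * ?b t) * of_real (deriv \<alpha> t)))"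
        by (intro borel_integrable_compact continuous_intros cb ca) auto
      moreover have "indicator {0..T} t *\<^sub>R ((- \<i> * ?b t) * of_real (deriv \<alpha> t)) = (- \<i> * ?b t) * of_real (deriv \<alpha> t)" for t
        using out[of t] by (cases "t \<in> {0..T}") auto
      ultimately show "integrable lborel (\<lambda>t. (- \<i> * ?b t) * of_real (deriv \<alpha> t))" by (simp only:)
      have "integrable lborel (\<lambda>t. indicator {0..T} t *\<^sub>R (?k t * of_real (\<alpha> t)))"
        by (intro borel_integrable_compact continuous_intros ck ca) auto
      moreover have "indicator {0..T} t *\<^sub>R (?k t * of_real (\<alpha> t)) = ?k t * of_real (\<alpha> t)" for t
        using out[of t] by (cases "t \<in> {0..T}") auto
      ultimately show "integrable lborel (\<lambda>t. ?k t * of_real (\<alpha> t))" by (simp only:)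
    qed
    finally show "(LINT t|lborel. (- \<i> * ?b t) * of_real (deriv \<alpha> t)) = - (LINT t|lborel. ?k t * of_real (\<alpha> t))"
      by (simp add: eq_neg_iff_add_eq_0)
  qed auto
  from primitive_on_integral[OF this, of s t] st
  have "- \<i> * ?b t - - \<i> * ?b s = (LINT \<tau>:{s..t}|lborel. ?k \<tau>)" by (simp add: subset_iff)
  \<comment> \<open>One of the two derivatives on \<beta> moves to \<psi>(\<tau>), with deriv
    \<beta> as the test function. This is the form in which the time-integrated spatial derivative
    appears.\<close>
  also have "\<dots> = (LINT \<tau>:{s..t}|lborel. - (LINT x|lborel. wderiv (\<psi> \<tau>) x * of_real (deriv \<beta> x)))"
  proof (rule set_lebesgue_integral_cong)
    show "\<forall>\<tau>. \<tau> \<in> {s..t} \<longrightarrow> ?k \<tau> = - (LINT x|lborel. wderiv (\<psi> \<tau>) x * of_real (deriv \<beta> x))"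
    proof safe
      fix \<tau> assume "\<tau> \<in> {s..t}"
      then have "weak_deriv (\<psi> \<tau>) (wderiv (\<psi> \<tau>))" using st by (intro in_H1D(4) C_H1D(1)[OF C]) auto
      moreover have "test_function UNIV (deriv \<beta>)" using t1 by (simp add: test_function_def)
      ultimately show "?k \<tau> = - (LINT x|lborel. wderiv (\<psi> \<tau>) x * of_real (deriv \<beta> x))"
        unfolding weak_deriv_def by blast
    qed
  qed simp
  also have "\<dots> = - (LINT \<tau>:{s..t}|lborel. LINT x|lborel. wderiv (\<psi> \<tau>) x * of_real (deriv \<beta> x))"
    unfolding set_lebesgue_integral_def scaleR_minus_right by (rule Bochner_Integration.integral_minus)
  finally have "- \<i> * ?b t - - \<i> * ?b s = - (LINT \<tau>:{s..t}|lborel. LINT x|lborel. wderiv (\<psi> \<tau>) x * of_real (deriv \<beta> x))" .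
  then show ?thesis by (simp add: algebra_simps)
qed

section \<open>The jump condition and the weak form\<close>

lemma Lp_2_interval_integral:
  fixes f :: "real \<Rightarrow> complex"
  assumes f: "in_Lp (interval_measure T) 2 f" and st: "0 \<le> s" "s \<le> t" "t \<le> T"
  shows "set_integrable lborel {s..t} f"
    "cmod (LINT x:{s..t}|lborel. f x) \<le> sqrt T * Lp_norm (interval_measure T) 2 f"
proof -
  define J where "J x = complex_of_real (indicator {s..t} x)" for x
  have J2: "(cmod (J x))\<^sup>2 = indicator {s..t} x" for x by (auto simp: J_def indicator_def)
  have ind: "indicator {0..T} x *\<^sub>R (J x * f x) = indicator {s..t} x *\<^sub>R f x" for x
    using st by (auto simp: J_def indicator_def)
  have ind2: "indicator {0..T} x *\<^sub>R (indicator {s..t} x :: real) = indicator {s..t} x" for x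
    using st by (auto simp: indicator_def)
  have int: "integrable lborel (\<lambda>x. indicator {s..t} x :: real)"
    by (rule integrable_real_indicator) (auto simp: st)
  have \<Omega>: "{0..T} \<inter> space lborel \<in> sets lborel" by simp
  have J: "in_Lp (interval_measure T) 2 J"
    unfolding in_Lp_2_iff J2 integrable_restrict_space[OF \<Omega>] ind2
    using int by (auto simp: J_def[abs_def] intro!: measurable_restrict_space1)
  have "(Lp_norm (interval_measure T) 2 J)\<^sup>2 = t - s"
    unfolding Lp_norm_2_power2 J2 integral_restrict_space[OF \<Omega>] ind2 using st by simp
  then have JT: "Lp_norm (interval_measure T) 2 J \<le> sqrt T"
    using st by (intro real_le_rsqrt) simp
  have "integrable (interval_measure T) (\<lambda>x. J x * f x)"
    by (rule integrable_mult_Lp_2[OF J f])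
  then show "set_integrable lborel {s..t} f"
    unfolding integrable_restrict_space[OF \<Omega>] ind set_integrable_def .
  have eq: "(LINT x|interval_measure T. J x * f x) = (LINT x:{s..t}|lborel. f x)"
    unfolding integral_restrict_space[OF \<Omega>] ind set_lebesgue_integral_def ..
  have "cmod (LINT x|interval_measure T. J x * f x) \<le> Lp_norm (interval_measure T) 2 J * Lp_norm (interval_measure T) 2 f"
    by (rule Cauchy_Schwarz_Lp_2_norm[OF J f])
  also have "\<dots> \<le> sqrt T * Lp_norm (interval_measure T) 2 f"
    by (intro mult_right_mono JT Lp_norm_2_nonneg)
  finally show "cmod (LINT x:{s..t}|lborel. f x) \<le> sqrt T * Lp_norm (interval_measure T) 2 f" unfolding eq .
qed

lemma in_Hs_L2: "in_Hs s T f \<Longrightarrow> in_Lp (interval_measure T) 2 f"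
  by (simp add: in_Hs_def)

lemma Lp_norm_le_Hs_norm: "Lp_norm (interval_measure T) 2 f \<le> Hs_norm s T f"
proof -
  have "0 \<le> (LINT p:{0..T} \<times> {0..T}|lborel. gagliardo s f p)"
    unfolding set_lebesgue_integral_def
    by (rule Bochner_Integration.integral_nonneg) (auto simp: gagliardo_def indicator_def split: prod.splits)
  then show ?thesis unfolding Hs_norm_def by (intro real_le_rsqrt) simp
qed

text \<open>The H^s topology in time is used only through its L^2 part: Cauchy-Schwarz on [s,t]
  turns L^2 convergence into convergence of time integrals. Membership is required only along the
  filter, as suits one-sided limits at 0.\<close>

lemma tendsto_interval_integral_Hs:
  fixes w :: "real \<Rightarrow> real \<Rightarrow> complex"
  assumes w: "\<forall>\<^sub>F y in F. in_Hs \<sigma> T (\<lambda>\<tau>. w \<tau> y)" and h: "in_Hs \<sigma> T h"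
    and lim: "((\<lambda>y. Hs_norm \<sigma> T (\<lambda>\<tau>. w \<tau> y - h \<tau>)) \<longlongrightarrow> 0) F"
    and st: "0 \<le> s" "s \<le> t" "t \<le> T"
  shows "((\<lambda>y. LINT \<tau>:{s..t}|lborel. w \<tau> y) \<longlongrightarrow> (LINT \<tau>:{s..t}|lborel. h \<tau>)) F"
proof -
  have lim': "((\<lambda>y. sqrt T * Hs_norm \<sigma> T (\<lambda>\<tau>. w \<tau> y - h \<tau>)) \<longlongrightarrow> 0) F"
    using tendsto_mult[OF tendsto_const lim] by simp
  have "((\<lambda>y. (LINT \<tau>:{s..t}|lborel. w \<tau> y) - (LINT \<tau>:{s..t}|lborel. h \<tau>)) \<longlongrightarrow> 0) F"
  proof (rule Lim_null_comparison[OF _ lim'])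
    show "\<forall>\<^sub>F y in F. cmod ((LINT \<tau>:{s..t}|lborel. w \<tau> y) - (LINT \<tau>:{s..t}|lborel. h \<tau>))
      \<le> sqrt T * Hs_norm \<sigma> T (\<lambda>\<tau>. w \<tau> y - h \<tau>)"
      using w
    proof eventually_elim
      case (elim y)
      note L = in_Hs_L2[OF elim] in_Hs_L2[OF h]
      have "(LINT \<tau>:{s..t}|lborel. w \<tau> y) - (LINT \<tau>:{s..t}|lborel. h \<tau>) = (LINT \<tau>:{s..t}|lborel. w \<tau> y - h \<tau>)"
        by (rule set_integral_diff(2)[symmetric, OF Lp_2_interval_integral(1)[OF L(1) st]
            Lp_2_interval_integral(1)[OF L(2) st]])
      then have "cmod ((LINT \<tau>:{s..t}|lborel. w \<tau> y) - (LINT \<tau>:{s..t}|lborel. h \<tau>))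
          \<le> sqrt T * Lp_norm (interval_measure T) 2 (\<lambda>\<tau>. w \<tau> y - h \<tau>)"
        using Lp_2_interval_integral(2)[OF in_Lp_2_diff(1)[OF L] st] by simp
      also have "\<dots> \<le> sqrt T * Hs_norm \<sigma> T (\<lambda>\<tau>. w \<tau> y - h \<tau>)"
        using st by (intro mult_left_mono Lp_norm_le_Hs_norm) auto
      finally show ?case .
    qed
  qed
  then show ?thesis by (simp add: LIM_zero_iff)
qed

lemma continuous_on_Lp_norm_2:
  fixes f :: "real \<Rightarrow> real \<Rightarrow> complex"
  assumes L2: "\<And>t. t \<in> S \<Longrightarrow> in_Lp lborel 2 (f t)"
    and cont: "\<And>t. t \<in> S \<Longrightarrow> ((\<lambda>s. Lp_norm lborel 2 (\<lambda>x. f s x - f t x)) \<longlongrightarrow> 0) (at t within S)"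
  shows "continuous_on S (\<lambda>t. Lp_norm lborel 2 (f t))"
  unfolding continuous_on_def
proof
  fix t assume t: "t \<in> S"
  have "((\<lambda>s. Lp_norm lborel 2 (f s) - Lp_norm lborel 2 (f t)) \<longlongrightarrow> 0) (at t within S)"
  proof (rule Lim_null_comparison[OF _ cont[OF t]])
    show "\<forall>\<^sub>F s in at t within S. norm (Lp_norm lborel 2 (f s) - Lp_norm lborel 2 (f t)) \<le> Lp_norm lborel 2 (\<lambda>x. f s x - f t x)"
      using eventually_within_self
      by eventually_elim (use Lp_norm_2_diff_abs L2 t in auto)
  qed
  then show "((\<lambda>t. Lp_norm lborel 2 (f t)) \<longlongrightarrow> Lp_norm lborel 2 (f t)) (at t within S)"
    by (simp add: LIM_zero_iff)
qed

text \<open>\<open>wderiv (\<psi> t)\<close> is chosen separately for each t, so its joint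
  measurability in (t,x) is not known. Fubini is therefore run on the jointly measurable
  representative \<open>v\<close>, and the result is translated back slice by slice.\<close>

lemma tested_derivative_Fubini:
  assumes C: "C_H1 T \<psi>" and v: "(\<lambda>(t, x). v t x) \<in> borel_measurable borel"
    and ae: "AE t in interval_measure T. AE x in lborel. v t x = wderiv (\<psi> t) x"
    and h: "in_Lp lborel 2 h" and st: "0 \<le> s" "t \<le> T"
  shows "integrable lborel (\<lambda>x. (LINT \<tau>:{s..t}|lborel. v \<tau> x) * h x)"
    "(LINT x|lborel. (LINT \<tau>:{s..t}|lborel. v \<tau> x) * h x) =
      (LINT \<tau>:{s..t}|lborel. LINT x|lborel. wderiv (\<psi> \<tau>) x * h x)"
proof -
  have vm: "(\<lambda>(t, x). v t x) \<in> borel_measurable (borel \<Otimes>\<^sub>M borel)" using v by (simp add: borel_prod)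
  have vx[measurable]: "(\<lambda>x. v \<tau> x) \<in> borel_measurable borel" for \<tau>
    using measurable_compose[OF measurable_Pair1' vm, of \<tau>] by simp
  have hm[measurable]: "h \<in> borel_measurable borel" using in_Lp_2D(1)[OF h] by simp
  \<comment> \<open>A uniform bound M on the norms of psi_x makes the L^1 norm of every good slice
    at most M times the norm of \<open>h\<close>, which is integrable over a bounded time
    interval.\<close>
  have "continuous_on {0..T} (\<lambda>t. Lp_norm lborel 2 (wderiv (\<psi> t)))"
    by (rule continuous_on_Lp_norm_2; use C_H1D[OF C] C_H1_L2[OF C] in blast)
  then have "bounded ((\<lambda>t. Lp_norm lborel 2 (wderiv (\<psi> t))) ` {0..T})"
    by (intro compact_imp_bounded compact_continuous_image) auto
  then obtain M where "\<forall>y\<in>(\<lambda>t. Lp_norm lborel 2 (wderiv (\<psi> t))) ` {0..T}. norm y \<le> M"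
    unfolding bounded_iff by blast
  then have M: "Lp_norm lborel 2 (wderiv (\<psi> t)) \<le> M" if "t \<in> {0..T}" for t
    using that by (auto intro: order.trans[OF abs_ge_self])
  have "AE \<tau> in lborel. \<tau> \<in> {0..T} \<longrightarrow> (AE x in lborel. v \<tau> x = wderiv (\<psi> \<tau>) x)"
    using ae by (subst (asm) AE_restrict_space_iff) auto
  then have ae': "AE \<tau> in lborel. \<tau> \<in> {s..t} \<longrightarrow> (AE x in lborel. v \<tau> x = wderiv (\<psi> \<tau>) x)"
    by eventually_elim (use st in auto)
  have slice: "integrable lborel (\<lambda>x. v \<tau> x * h x)"
      "(LINT x|lborel. v \<tau> x * h x) = (LINT x|lborel. wderiv (\<psi> \<tau>) x * h x)"
      "(LINT x|lborel. cmod (v \<tau> x * h x)) \<le> M * Lp_norm lborel 2 h"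
    if \<tau>: "\<tau> \<in> {s..t}" "AE x in lborel. v \<tau> x = wderiv (\<psi> \<tau>) x" for \<tau>
  proof -
    have T: "\<tau> \<in> {0..T}" using \<tau>(1) st by auto
    have wm[measurable]: "wderiv (\<psi> \<tau>) \<in> borel_measurable borel"
      using in_Lp_2D(1)[OF C_H1_L2(2)[OF C T]] by simp
    have e1: "AE x in lborel. v \<tau> x * h x = wderiv (\<psi> \<tau>) x * h x" using \<tau>(2) by eventually_elim simp
    have e2: "AE x in lborel. cmod (v \<tau> x * h x) = cmod (wderiv (\<psi> \<tau>) x) * cmod (h x)"
      using \<tau>(2) by eventually_elim (simp add: norm_mult)
    have i: "integrable lborel (\<lambda>x. wderiv (\<psi> \<tau>) x * h x)"
      by (rule integrable_mult_Lp_2[OF C_H1_L2(2)[OF C T] h])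
    show "integrable lborel (\<lambda>x. v \<tau> x * h x)"
      by (rule integrable_cong_AE[THEN iffD2, OF _ _ e1 i]) measurable
    show "(LINT x|lborel. v \<tau> x * h x) = (LINT x|lborel. wderiv (\<psi> \<tau>) x * h x)"
      by (rule integral_cong_AE[OF _ _ e1]) measurable
    have "(LINT x|lborel. cmod (v \<tau> x * h x)) = (LINT x|lborel. cmod (wderiv (\<psi> \<tau>) x) * cmod (h x))"
      by (rule integral_cong_AE[OF _ _ e2]) measurable
    also have "\<dots> \<le> Lp_norm lborel 2 (wderiv (\<psi> \<tau>)) * Lp_norm lborel 2 h"
      by (rule Cauchy_Schwarz_Lp_2_abs[OF C_H1_L2(2)[OF C T] h])
    also have "\<dots> \<le> M * Lp_norm lborel 2 h" by (intro mult_right_mono M T Lp_norm_2_nonneg)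
    finally show "(LINT x|lborel. cmod (v \<tau> x * h x)) \<le> M * Lp_norm lborel 2 h" .
  qed
  define H where "H \<tau> x = indicator {s..t} \<tau> *\<^sub>R (v \<tau> x * h x)" for \<tau> x
  have Hm: "(\<lambda>(\<tau>, x). H \<tau> x) \<in> borel_measurable (lborel \<Otimes>\<^sub>M lborel)"
  proof -
    have "(\<lambda>p. indicator {s..t} (fst p) *\<^sub>R ((\<lambda>(t, x). v t x) p * h (snd p))) \<in> borel_measurable (borel \<Otimes>\<^sub>M borel)"
      using vm by measurable
    moreover have "borel_measurable (lborel \<Otimes>\<^sub>M lborel) =
        (borel_measurable (borel \<Otimes>\<^sub>M borel) :: (real \<times> real \<Rightarrow> complex) set)"
      by (intro measurable_cong_sets sets_pair_measure_cong) simp_all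
    ultimately show ?thesis by (simp add: H_def case_prod_beta)
  qed
  have Hint: "integrable (lborel \<Otimes>\<^sub>M lborel) (\<lambda>(\<tau>, x). H \<tau> x)"
  proof (rule lborel_pair.Fubini_integrable[OF Hm])
    show "AE \<tau> in lborel. integrable lborel (\<lambda>x. case (\<tau>, x) of (\<tau>, x) \<Rightarrow> H \<tau> x)"
      using ae'
    proof eventually_elim
      case (elim \<tau>)
      then show ?case using slice(1)[of \<tau>] by (cases "\<tau> \<in> {s..t}") (auto simp: H_def)
    qed
    have bint: "integrable lborel (\<lambda>\<tau>. indicator {s..t} \<tau> * (M * Lp_norm lborel 2 h))"
      by (intro integrable_mult_left integrable_real_indicator) (auto simp: emeasure_lborel_Icc_eq)
    show "integrable lborel (\<lambda>\<tau>. LINT x|lborel. cmod (case (\<tau>, x) of (\<tau>, x) \<Rightarrow> H \<tau> x))"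
    proof (rule Bochner_Integration.integrable_bound[OF bint])
      show "(\<lambda>\<tau>. LINT x|lborel. cmod (case (\<tau>, x) of (\<tau>, x) \<Rightarrow> H \<tau> x)) \<in> borel_measurable lborel"
        using Hm by (intro lborel.borel_measurable_lebesgue_integral) simp
      show "AE \<tau> in lborel. norm (LINT x|lborel. cmod (case (\<tau>, x) of (\<tau>, x) \<Rightarrow> H \<tau> x))
        \<le> norm (indicator {s..t} \<tau> * (M * Lp_norm lborel 2 h))"
        using ae'
      proof eventually_elim
        case (elim \<tau>)
        show ?case
        proof (cases "\<tau> \<in> {s..t}")
          case True
          then show ?thesis
            using slice(3)[OF True] elim by (simp add: H_def order.trans[OF _ abs_ge_self])
        qed (simp add: H_def)
      qed
    qed
  qed
  have inner: "(LINT \<tau>|lborel. H \<tau> x) = (LINT \<tau>:{s..t}|lborel. v \<tau> x) * h x" for x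
  proof -
    have "(LINT \<tau>|lborel. H \<tau> x) = (LINT \<tau>|lborel. (indicator {s..t} \<tau> *\<^sub>R v \<tau> x) * h x)"
      by (simp add: H_def)
    also have "\<dots> = (LINT \<tau>|lborel. indicator {s..t} \<tau> *\<^sub>R v \<tau> x) * h x"
      by (rule integral_mult_left_zero)
    finally show ?thesis by (simp add: set_lebesgue_integral_def)
  qed
  show "integrable lborel (\<lambda>x. (LINT \<tau>:{s..t}|lborel. v \<tau> x) * h x)"
    using lborel_pair.integrable_snd[OF Hint] unfolding inner .
  have "(LINT x|lborel. (LINT \<tau>:{s..t}|lborel. v \<tau> x) * h x) = (LINT \<tau>|lborel. LINT x|lborel. H \<tau> x)"
    using lborel_pair.Fubini_integral[OF Hint] unfolding inner .
  also have "\<dots> = (LINT \<tau>:{s..t}|lborel. LINT x|lborel. wderiv (\<psi> \<tau>) x * h x)"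
    unfolding set_lebesgue_integral_def
  proof (rule integral_cong_AE)
    show m: "(\<lambda>\<tau>. LINT x|lborel. H \<tau> x) \<in> borel_measurable lborel"
      using lborel_pair.integrable_fst[OF Hint] by (rule borel_measurable_integrable)
    have "set_integrable lborel {s..t} (\<lambda>\<tau>. LINT x|lborel. wderiv (\<psi> \<tau>) x * h x)"
      unfolding set_integrable_def
    proof (intro borel_integrable_compact)
      have "continuous_on {0..T} (\<lambda>\<tau>. LINT x|lborel. wderiv (\<psi> \<tau>) x * h x)"
        by (rule continuous_on_inner_L2_fixed; use C_H1D[OF C] C_H1_L2[OF C] h in blast)
      then show "continuous_on {s..t} (\<lambda>\<tau>. LINT x|lborel. wderiv (\<psi> \<tau>) x * h x)"
        by (rule continuous_on_subset) (use st in auto)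
    qed simp
    then show "(\<lambda>\<tau>. indicator {s..t} \<tau> *\<^sub>R (LINT x|lborel. wderiv (\<psi> \<tau>) x * h x)) \<in> borel_measurable lborel"
      unfolding set_integrable_def by (rule borel_measurable_integrable)
    show "AE \<tau> in lborel. (LINT x|lborel. H \<tau> x) = indicator {s..t} \<tau> *\<^sub>R (LINT x|lborel. wderiv (\<psi> \<tau>) x * h x)"
      using ae'
    proof eventually_elim
      case (elim \<tau>)
      then show ?case using slice(2)[of \<tau>] by (cases "\<tau> \<in> {s..t}") (auto simp: H_def)
    qed
  qed
  finally show "(LINT x|lborel. (LINT \<tau>:{s..t}|lborel. v \<tau> x) * h x) =
      (LINT \<tau>:{s..t}|lborel. LINT x|lborel. wderiv (\<psi> \<tau>) x * h x)" .
qed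

text \<open>The test function \<psi>(r) need not vanish at the origin, so the equation off the
  origin is first solved for the time-integrated derivative V, and V is then integrated by parts
  against the conjugate of \<psi>(r), collecting the jump at 0.\<close>

lemma solution_weak_form:
  assumes sol: "solution_on_closed T \<psi>" and st: "0 < s" "s \<le> t" "t < T" and r: "r \<in> {0..T}"
  shows "\<i> * (inner_L2 (\<psi> t) (\<psi> r) - inner_L2 (\<psi> s) (\<psi> r)) =
    integral {s..t} (\<lambda>\<tau>. inner_L2 (wderiv (\<psi> \<tau>)) (wderiv (\<psi> r)) -
      of_real ((cmod (\<psi> \<tau> 0))\<^sup>2) * \<psi> \<tau> 0 * cnj (\<psi> r 0))"
proof -
  have C: "C_H1 T \<psi>" and S: "free_schrodinger_off_origin T \<psi>" and J: "derivative_jump T \<psi>"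
    using sol by (auto simp: solution_on_closed_def)
  have st': "0 \<le> s" "s \<le> t" "t \<le> T" and t: "t \<in> {0..T}" and s: "s \<in> {0..T}" using st by auto
  obtain v vl vr where v: "(\<lambda>(t, x). v t x) \<in> borel_measurable borel"
    and ae: "AE t in interval_measure T. AE x in lborel. v t x = wderiv (\<psi> t) x"
    and Cv: "C_x_Hs (- {0}) (1/4) T v"
    and l: "Hs_limit (1/4) T v vl (at_left 0)" and rr: "Hs_limit (1/4) T v vr (at_right 0)"
    and jump: "AE t in interval_measure T. vr t - vl t = - of_real ((cmod (\<psi> t 0))\<^sup>2) * \<psi> t 0"
    using J unfolding derivative_jump_def by blast
  \<comment> \<open>V inherits continuity off 0 and limits at 0 from the H^{1/4}-valued map x to
    \<open>v\<close>, since integrating over [s,t] is continuous on that space.\<close>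
  define V where "V x = (LINT \<tau>:{s..t}|lborel. v \<tau> x)" for x
  note Fub = tested_derivative_Fubini[OF C v ae _ st'(1,3), folded V_def]
  have vH: "in_Hs (1/4) T (\<lambda>\<tau>. v \<tau> x)" if "x \<noteq> 0" for x
    using Cv that by (auto simp: C_x_Hs_def)
  have "(V \<longlongrightarrow> V x) (at x within - {0})" if "x \<noteq> 0" for x
    unfolding V_def
  proof (rule tendsto_interval_integral_Hs[OF _ vH[OF that] _ st'])
    show "\<forall>\<^sub>F y in at x within - {0}. in_Hs (1/4) T (\<lambda>\<tau>. v \<tau> y)"
      using eventually_within_self by eventually_elim (auto intro: vH)
    show "((\<lambda>y. Hs_norm (1/4) T (\<lambda>\<tau>. v \<tau> y - v \<tau> x)) \<longlongrightarrow> 0) (at x within - {0})"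
      using Cv that by (auto simp: C_x_Hs_def)
  qed
  then have contV: "continuous_on (- {0}) V" by (auto simp: continuous_on_def)
  define Vl Vr where "Vl = (LINT \<tau>:{s..t}|lborel. vl \<tau>)" and "Vr = (LINT \<tau>:{s..t}|lborel. vr \<tau>)"
  have ev: "\<forall>\<^sub>F y in at_left 0. in_Hs (1/4) T (\<lambda>\<tau>. v \<tau> y)" "\<forall>\<^sub>F y in at_right 0. in_Hs (1/4) T (\<lambda>\<tau>. v \<tau> y)"
    using vH by (auto intro!: eventually_at_leftI[of "-1"] eventually_at_rightI[of 0 1])
  have limV: "(V \<longlongrightarrow> Vr) (at_right 0)" "(V \<longlongrightarrow> Vl) (at_left 0)"
    unfolding V_def Vl_def Vr_def using l rr
    by (auto simp: Hs_limit_def intro!: tendsto_interval_integral_Hs st' ev)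
  \<comment> \<open>The expected derivative of V: psi_xx = -i psi_t, integrated in time.\<close>
  define D where "D x = - \<i> * (\<psi> t x - \<psi> s x)" for x
  note L2t = C_H1_L2(1)[OF C t] and L2s = C_H1_L2(1)[OF C s] and L2r = C_H1_L2[OF C r]
  have D2: "in_Lp lborel 2 D"
    unfolding D_def by (intro in_Lp_2_cmult in_Lp_2_diff L2t L2s)
  have prim: "primitive_on X V D" if X: "open X" "X \<subseteq> - {0}" for X
  proof (rule weak_derivative_imp_primitive[OF X(1)])
    show "continuous_on X V" using contV X(2) by (rule continuous_on_subset)
    show "set_integrable lborel {a..b} D" for a b by (rule in_Lp_2_set_integrable[OF D2])
    fix \<phi> assume "test_function X \<phi>"
    then have \<phi>: "test_function (- {0}) \<phi>" using X(2) by (auto simp: test_function_def)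
    note \<phi>2 = test_function_L2[OF \<phi>]
    have "(LINT x|lborel. V x * of_real (deriv \<phi> x)) =
        \<i> * ((LINT x|lborel. \<psi> t x * of_real (\<phi> x)) - (LINT x|lborel. \<psi> s x * of_real (\<phi> x)))"
      unfolding Fub(2)[OF test_function_L2[OF test_function_deriv[OF \<phi>]]]
      using free_evolution_tested[OF C S \<phi> st] by simp
    also have "\<dots> = - (LINT x|lborel. D x * of_real (\<phi> x))"
    proof -
      have "(LINT x|lborel. D x * of_real (\<phi> x)) = (LINT x|lborel. - \<i> * (\<psi> t x * of_real (\<phi> x) - \<psi> s x * of_real (\<phi> x)))"
        by (rule Bochner_Integration.integral_cong) (auto simp: D_def algebra_simps)
      also have "\<dots> = - \<i> * (LINT x|lborel. \<psi> t x * of_real (\<phi> x) - \<psi> s x * of_real (\<phi> x))"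
        by (rule integral_mult_right_zero)
      also have "(LINT x|lborel. \<psi> t x * of_real (\<phi> x) - \<psi> s x * of_real (\<phi> x)) =
          (LINT x|lborel. \<psi> t x * of_real (\<phi> x)) - (LINT x|lborel. \<psi> s x * of_real (\<phi> x))"
        by (intro Bochner_Integration.integral_diff integrable_mult_Lp_2 L2t L2s \<phi>2)
      finally show ?thesis by simp
    qed
    finally show "(LINT x|lborel. V x * of_real (deriv \<phi> x)) = - (LINT x|lborel. D x * of_real (\<phi> x))" .
  qed
  have r2: "in_Lp lborel 2 (\<lambda>x. cnj (\<psi> r x))" "in_Lp lborel 2 (\<lambda>x. cnj (wderiv (\<psi> r) x))"
    using L2r by (auto simp: in_Lp_2_cnj)
  have ibp: "(LINT x|lborel. V x * cnj (wderiv (\<psi> r) x)) =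
     - (Vr - Vl) * cnj (\<psi> r 0) - (LINT x|lborel. D x * cnj (\<psi> r x))"
  proof (rule integral_by_parts_jump)
    show "primitive_on {0<..} V D" "primitive_on {..<0} V D" by (auto intro!: prim)
    show "primitive_on UNIV (\<lambda>x. cnj (\<psi> r x)) (\<lambda>x. cnj (wderiv (\<psi> r) x))"
      by (intro primitive_on_cnj in_H1D C_H1D(1)[OF C r])
  qed (use limV in_Lp_2_set_integrable[OF D2] Fub(1)[OF r2(1)] Fub(1)[OF r2(2)] integrable_mult_Lp_2[OF D2 r2(1)] in auto)
  have Dint: "(LINT x|lborel. D x * cnj (\<psi> r x)) = - \<i> * (inner_L2 (\<psi> t) (\<psi> r) - inner_L2 (\<psi> s) (\<psi> r))"
  proof -
    have "(LINT x|lborel. D x * cnj (\<psi> r x)) = (LINT x|lborel. - \<i> * ((\<psi> t x - \<psi> s x) * cnj (\<psi> r x)))"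
      by (rule Bochner_Integration.integral_cong) (auto simp: D_def)
    also have "\<dots> = - \<i> * (LINT x|lborel. (\<psi> t x - \<psi> s x) * cnj (\<psi> r x))"
      by (rule integral_mult_right_zero)
    finally show ?thesis
      using inner_L2_diff(1)[OF L2t L2s L2r(1)] by (simp only: inner_L2_def)
  qed
  define A where "A \<tau> = inner_L2 (wderiv (\<psi> \<tau>)) (wderiv (\<psi> r))" for \<tau>
  define g where "g \<tau> = of_real ((cmod (\<psi> \<tau> 0))\<^sup>2) * \<psi> \<tau> 0" for \<tau>
  have cA: "continuous_on {s..t} A"
  proof (rule continuous_on_subset)
    show "continuous_on {0..T} A"
      unfolding A_def inner_L2_def
      by (rule continuous_on_inner_L2_fixed; use C_H1D[OF C] C_H1_L2[OF C] r2 in blast)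
  qed (use st in auto)
  have cg: "continuous_on {s..t} g"
    unfolding g_def using st by (intro continuous_intros continuous_on_subset[OF C_H1_continuous_at_point[OF C]]) auto
  have i: "set_integrable lborel {s..t} A" "set_integrable lborel {s..t} g"
    unfolding set_integrable_def by (intro borel_integrable_compact cA cg compact_Icc)+
  \<comment> \<open>The jump condition holds for almost every time, which is sufficient once
    integrated; it gives minus the integral of |w|^2 w with w the trace of \<psi> at 0.\<close>
  have "Vr - Vl = (LINT \<tau>:{s..t}|lborel. vr \<tau> - vl \<tau>)"
    unfolding Vr_def Vl_def using l rr
    by (intro set_integral_diff(2)[symmetric] Lp_2_interval_integral(1)[OF _ st'] in_Hs_L2) (auto simp: Hs_limit_def)
  also have "\<dots> = (LINT \<tau>:{s..t}|lborel. - g \<tau>)"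
    unfolding set_lebesgue_integral_def
  proof (rule integral_cong_AE)
    have "set_integrable lborel {s..t} vr" "set_integrable lborel {s..t} vl"
      using l rr by (auto simp: Hs_limit_def intro!: Lp_2_interval_integral(1)[OF _ st'] in_Hs_L2)
    then have "set_integrable lborel {s..t} (\<lambda>\<tau>. vr \<tau> - vl \<tau>)" by (rule set_integral_diff(1))
    then show "(\<lambda>\<tau>. indicator {s..t} \<tau> *\<^sub>R (vr \<tau> - vl \<tau>)) \<in> borel_measurable lborel"
      unfolding set_integrable_def by (rule borel_measurable_integrable)
    have "integrable lborel (\<lambda>\<tau>. - (indicator {s..t} \<tau> *\<^sub>R g \<tau>))"
      using i(2) unfolding set_integrable_def by (rule Bochner_Integration.integrable_minus)
    then show "(\<lambda>\<tau>. indicator {s..t} \<tau> *\<^sub>R (- g \<tau>)) \<in> borel_measurable lborel"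
      unfolding scaleR_minus_right by (rule borel_measurable_integrable)
    have "AE \<tau> in lborel. \<tau> \<in> {0..T} \<longrightarrow> vr \<tau> - vl \<tau> = - g \<tau>"
      using jump unfolding g_def by (subst (asm) AE_restrict_space_iff) auto
    then show "AE \<tau> in lborel. indicator {s..t} \<tau> *\<^sub>R (vr \<tau> - vl \<tau>) = indicator {s..t} \<tau> *\<^sub>R (- g \<tau>)"
      by eventually_elim (use st in \<open>auto simp: indicator_def\<close>)
  qed
  also have "\<dots> = - (LINT \<tau>:{s..t}|lborel. g \<tau>)"
    unfolding set_lebesgue_integral_def scaleR_minus_right by (rule Bochner_Integration.integral_minus)
  finally have jumpV: "Vr - Vl = - integral {s..t} g"
    using set_borel_integral_eq_integral(2)[OF i(2)] by simp
  have "(LINT x|lborel. V x * cnj (wderiv (\<psi> r) x)) = (LINT \<tau>:{s..t}|lborel. A \<tau>)"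
    unfolding A_def inner_L2_def by (rule Fub(2)[OF r2(2)])
  also have "\<dots> = integral {s..t} A" by (rule set_borel_integral_eq_integral(2)[OF i(1)])
  finally have VA: "(LINT x|lborel. V x * cnj (wderiv (\<psi> r) x)) = integral {s..t} A" .
  have solve: "z = x - y * c" if "x = - (- y) * c - - \<i> * X" "z = \<i> * X" for x y z c X :: complex
    using that by (simp add: algebra_simps)
  have "\<i> * (inner_L2 (\<psi> t) (\<psi> r) - inner_L2 (\<psi> s) (\<psi> r)) =
      integral {s..t} A - integral {s..t} g * cnj (\<psi> r 0)"
    by (rule solve[OF ibp[unfolded VA Dint jumpV] refl])
  also have "\<dots> = integral {s..t} (\<lambda>\<tau>. A \<tau> - g \<tau> * cnj (\<psi> r 0))"
    using integrable_continuous_real[OF cA] integrable_continuous_real[OF cg]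
    by (subst integral_diff) (auto intro: integrable_on_mult_left)
  finally show ?thesis unfolding A_def g_def .
qed

lemma solution_conservation:
  assumes sol: "solution_on_closed T \<psi>" and ab: "0 < a" "a < b" "b < T"
  shows "Lp_norm lborel 2 (\<psi> a) = Lp_norm lborel 2 (\<psi> b)"
    "(Lp_norm lborel 2 (wderiv (\<psi> a)))\<^sup>2 - (cmod (\<psi> a 0)) ^ 4 / 2 =
     (Lp_norm lborel 2 (wderiv (\<psi> b)))\<^sup>2 - (cmod (\<psi> b 0)) ^ 4 / 2"
proof -
  have C: "C_H1 T \<psi>" and H: "C_x_Hs UNIV (3/4) T \<psi>"
    using sol by (auto simp: solution_on_closed_def)
  have A: "continuous_on ({0..T} \<times> {0..T}) (\<lambda>(t, r). inner_L2 (wderiv (\<psi> t)) (wderiv (\<psi> r)))"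
    by (rule continuous_on_inner_L2; use C_H1D[OF C] C_H1_L2[OF C] in blast)
  have w: "in_Hs (3/4) T (\<lambda>t. \<psi> t 0)" using H by (auto simp: C_x_Hs_def)
  note K = kernel_conservation[OF A inner_L2_cnj inner_L2_cnj C_H1_continuous_at_point[OF C] w
      solution_weak_form[OF sol] ab]
  have "(Lp_norm lborel 2 (\<psi> a))\<^sup>2 = (Lp_norm lborel 2 (\<psi> b))\<^sup>2"
    using K(1) unfolding inner_L2_self of_real_eq_iff .
  then show "Lp_norm lborel 2 (\<psi> a) = Lp_norm lborel 2 (\<psi> b)"
    by (rule power2_eq_imp_eq) (simp_all add: Lp_norm_2_nonneg)
  show "(Lp_norm lborel 2 (wderiv (\<psi> a)))\<^sup>2 - (cmod (\<psi> a 0)) ^ 4 / 2 =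
     (Lp_norm lborel 2 (wderiv (\<psi> b)))\<^sup>2 - (cmod (\<psi> b 0)) ^ 4 / 2"
    using K(2) unfolding inner_L2_self Re_complex_of_real .
qed

section \<open>Blow-up profile\<close>

text \<open>The scaling preserves the mass, and \<open>\<rho>\<close> is chosen so that the rescaled
  derivative has the norm sqrt 2 of \<open>ground_state_deriv\<close>; hence 6 = 2 + 4. The phase
  makes the value at 0 real and nonnegative, so its real part is its modulus.\<close>

lemma H1_norm_rescaled_diff_ground_state:
  assumes u: "in_H1 u" and N: "0 < Lp_norm lborel 2 (wderiv u)" "\<rho> = sqrt 2 / Lp_norm lborel 2 (wderiv u)"
    and phase: "exp (- \<i> * of_real \<theta>) * u 0 = of_real (cmod (u 0))"
  shows "(H1_norm (\<lambda>x. exp (- \<i> * of_real \<theta>) * of_real (\<rho> powr (1/2)) * u (\<rho> * x) - ground_state x))\<^sup>2 =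
    (Lp_norm lborel 2 u)\<^sup>2 + 6 - 4 * sqrt 2 * (sqrt \<rho> * cmod (u 0))"
proof -
  have \<rho>: "0 < \<rho>" using N by simp
  define c where "c = exp (- \<i> * of_real \<theta>) * of_real (\<rho> powr (1/2))"
  have nc: "(cmod c)\<^sup>2 = \<rho>"
    using \<rho> by (simp add: c_def norm_mult powr_half_sqrt)
  note s0 = Lp_norm_2_scale[OF in_H1D(1)[OF u] \<rho>] and s1 = Lp_norm_2_scale[OF in_H1D(2)[OF u] \<rho>]
  have p: "primitive_on UNIV (\<lambda>x. c * u (\<rho> * x)) (\<lambda>x. c * (of_real \<rho> * wderiv u (\<rho> * x)))"
    by (intro primitive_on_cmult primitive_on_scale[OF in_H1D(3)[OF u] \<rho>])
  have L: "in_Lp lborel 2 (\<lambda>x. c * u (\<rho> * x))" "in_Lp lborel 2 (\<lambda>x. c * (of_real \<rho> * wderiv u (\<rho> * x)))"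
    by (intro in_Lp_2_cmult s0 s1)+
  have "(Lp_norm lborel 2 (\<lambda>x. c * u (\<rho> * x)))\<^sup>2 = (Lp_norm lborel 2 u)\<^sup>2"
    unfolding in_Lp_2_cmult(2)[OF s0(1)] power_mult_distrib nc s0(2) ..
  moreover have "(Lp_norm lborel 2 (\<lambda>x. c * (of_real \<rho> * wderiv u (\<rho> * x))))\<^sup>2 = 2"
  proof -
    have "(Lp_norm lborel 2 (\<lambda>x. c * (of_real \<rho> * wderiv u (\<rho> * x))))\<^sup>2 = \<rho>\<^sup>2 * (Lp_norm lborel 2 (wderiv u))\<^sup>2"
      unfolding in_Lp_2_cmult(2)[OF in_Lp_2_cmult(1)[OF s1(1)]] in_Lp_2_cmult(2)[OF s1(1)] power_mult_distrib nc s1(2)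
      using \<rho> by (simp add: power2_eq_square)
    also have "\<dots> = 2" using N by (simp add: power_divide)
    finally show ?thesis .
  qed
  moreover have "Re (c * u (\<rho> * 0)) = sqrt \<rho> * cmod (u 0)"
  proof -
    have "c * u (\<rho> * 0) = of_real (\<rho> powr (1/2)) * (exp (- \<i> * of_real \<theta>) * u 0)" by (simp add: c_def)
    also have "\<dots> = of_real (sqrt \<rho> * cmod (u 0))"
      unfolding phase using \<rho> by (simp add: powr_half_sqrt)
    finally show ?thesis by simp
  qed
  ultimately show ?thesis
    using H1_norm_diff_ground_state[OF L p] unfolding c_def by simp
qed

lemma continuous_on_atLeastLessThan:
  fixes f :: "real \<Rightarrow> 'a::topological_space"
  assumes "\<And>T'. 0 < T' \<Longrightarrow> T' < T \<Longrightarrow> continuous_on {0..T'} f"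
  shows "continuous_on {0..<T} f"
  unfolding continuous_on_eq_continuous_within
proof
  fix t assume t: "t \<in> {0..<T}"
  define T' where "T' = (t + T) / 2"
  have T': "t < T'" "T' < T" "0 < T'" using t by (auto simp: T'_def)
  have "continuous (at t within {0..T'}) f"
    using assms[OF T'(3,2)] t T' unfolding continuous_on_eq_continuous_within by auto
  moreover have "at t within {0..T'} = at t within {0..<T}"
    by (rule at_within_nhd[of _ "{..<T'}"]) (use T' in auto)
  ultimately show "continuous (at t within {0..<T}) f" by simp
qed

text \<open>A pointwise principal argument would jump at the branch cut. On a convex set a
  nonvanishing function has a continuous logarithm, and its imaginary part is a continuous
  phase.\<close>

lemma continuous_phase:
  fixes f :: "real \<Rightarrow> complex"
  assumes "continuous_on S f" "convex S" "\<And>t. t \<in> S \<Longrightarrow> f t \<noteq> 0"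
  obtains \<theta> where "continuous_on S \<theta>" "\<And>t. t \<in> S \<Longrightarrow> exp (- \<i> * of_real (\<theta> t)) * f t = of_real (cmod (f t))"
proof -
  obtain g where g: "continuous_on S g" "\<And>t. t \<in> S \<Longrightarrow> f t = exp (g t)"
    using continuous_logarithm_on_contractible[OF assms(1) convex_imp_contractible[OF assms(2)] assms(3)] by blast
  show ?thesis
  proof (rule that)
    show "continuous_on S (\<lambda>t. Im (g t))" using g(1) by (intro continuous_intros)
    fix t assume "t \<in> S"
    have "exp (- \<i> * of_real (Im (g t))) * exp (g t) = exp (of_real (Re (g t)))"
      unfolding exp_add[symmetric] by (intro arg_cong[of _ _ exp]) (simp add: complex_eq_iff)
    then show "exp (- \<i> * of_real (Im (g t))) * f t = of_real (cmod (f t))"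
      using g(2)[OF \<open>t \<in> S\<close>] by (simp add: exp_of_real)
  qed
qed

text \<open>Every time before T lies in a closed interval ending strictly before T, such as the
  midpoint with T, where the previous results apply.\<close>

lemma H1_solution_conservation:
  assumes sol: "H1_solution T \<psi>"
  shows "continuous_on {0..<T} (\<lambda>t. Lp_norm lborel 2 (\<psi> t))"
    "continuous_on {0..<T} (\<lambda>t. Lp_norm lborel 2 (wderiv (\<psi> t)))"
    "continuous_on {0..<T} (\<lambda>t. \<psi> t 0)"
    "\<And>t. t \<in> {0..<T} \<Longrightarrow> in_H1 (\<psi> t)"
    "\<And>t. t \<in> {0..<T} \<Longrightarrow> Lp_norm lborel 2 (\<psi> t) = Lp_norm lborel 2 (\<psi> 0)"
    "\<And>a b. 0 < a \<Longrightarrow> a < b \<Longrightarrow> b < T \<Longrightarrow>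
      (Lp_norm lborel 2 (wderiv (\<psi> a)))\<^sup>2 - (cmod (\<psi> a 0)) ^ 4 / 2 =
      (Lp_norm lborel 2 (wderiv (\<psi> b)))\<^sup>2 - (cmod (\<psi> b 0)) ^ 4 / 2"
proof -
  have sc: "solution_on_closed T' \<psi>" if "0 < T'" "T' < T" for T'
    using sol that by (simp add: H1_solution_def)
  then have C: "C_H1 T' \<psi>" if "0 < T'" "T' < T" for T'
    using that by (auto simp: solution_on_closed_def)
  have T: "0 < T" using sol by (simp add: H1_solution_def)
  show cM: "continuous_on {0..<T} (\<lambda>t. Lp_norm lborel 2 (\<psi> t))"
  proof (rule continuous_on_atLeastLessThan)
    fix T' assume T': "0 < T'" "T' < T"
    show "continuous_on {0..T'} (\<lambda>t. Lp_norm lborel 2 (\<psi> t))"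
      by (rule continuous_on_Lp_norm_2; use C_H1D[OF C[OF T']] C_H1_L2[OF C[OF T']] in blast)
  qed
  show "continuous_on {0..<T} (\<lambda>t. Lp_norm lborel 2 (wderiv (\<psi> t)))"
  proof (rule continuous_on_atLeastLessThan)
    fix T' assume T': "0 < T'" "T' < T"
    show "continuous_on {0..T'} (\<lambda>t. Lp_norm lborel 2 (wderiv (\<psi> t)))"
      by (rule continuous_on_Lp_norm_2; use C_H1D[OF C[OF T']] C_H1_L2[OF C[OF T']] in blast)
  qed
  show "continuous_on {0..<T} (\<lambda>t. \<psi> t 0)"
    by (intro continuous_on_atLeastLessThan C_H1_continuous_at_point C)
  show "in_H1 (\<psi> t)" if "t \<in> {0..<T}" for t
    using C_H1D(1)[OF C[of "(t + T) / 2"], of t] that by auto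
  have between: "0 < (b + T) / 2" "b < (b + T) / 2" "(b + T) / 2 < T" if "0 < b" "b < T" for b
    using that by auto
  show "(Lp_norm lborel 2 (wderiv (\<psi> a)))\<^sup>2 - (cmod (\<psi> a 0)) ^ 4 / 2 =
      (Lp_norm lborel 2 (wderiv (\<psi> b)))\<^sup>2 - (cmod (\<psi> b 0)) ^ 4 / 2" if "0 < a" "a < b" "b < T" for a b
    using that between[of b] by (intro solution_conservation(2)[of "(b + T) / 2"] sc) auto
  have const: "Lp_norm lborel 2 (\<psi> a) = Lp_norm lborel 2 (\<psi> b)" if "0 < a" "a < b" "b < T" for a b
    using that between[of b] by (intro solution_conservation(1)[of "(b + T) / 2"] sc) auto
  show "Lp_norm lborel 2 (\<psi> t) = Lp_norm lborel 2 (\<psi> 0)" if t: "t \<in> {0..<T}" for t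
  proof (cases "t = 0")
    case False
    then have t: "0 < t" "t < T" using t by auto
    \<comment> \<open>The conservation law is proved only between positive times; continuity at 0
      brings in the initial mass.\<close>
    have "((\<lambda>a. Lp_norm lborel 2 (\<psi> a)) \<longlongrightarrow> Lp_norm lborel 2 (\<psi> 0)) (at 0 within {0..<T})"
      using cM T by (auto simp: continuous_on_def)
    moreover have "at 0 within {0..<T} = at_right 0"
      by (rule at_within_nhd[of _ "{..<T}"]) (use T in auto)
    ultimately have "((\<lambda>a. Lp_norm lborel 2 (\<psi> a)) \<longlongrightarrow> Lp_norm lborel 2 (\<psi> 0)) (at_right 0)"
      by simp
    moreover have "\<forall>\<^sub>F a in at_right 0. Lp_norm lborel 2 (\<psi> a) = Lp_norm lborel 2 (\<psi> t)"
      using const t by (auto intro!: eventually_at_rightI[of 0 t])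
    then have "((\<lambda>a. Lp_norm lborel 2 (\<psi> a)) \<longlongrightarrow> Lp_norm lborel 2 (\<psi> t)) (at_right 0)"
      by (rule tendsto_eventually)
    ultimately show ?thesis by (metis tendsto_unique trivial_limit_at_right_real)
  qed simp
qed

lemma blowup_profile:
  assumes sol: "H1_solution T \<psi>" and T: "0 < T"
    and blowup: "filterlim (\<lambda>t. Lp_norm lborel 2 (wderiv (\<psi> t))) at_top (at_left T)"
    and \<epsilon>: "0 < \<epsilon>" and M: "mass (\<psi> 0) < 2 + \<epsilon>\<^sup>2 / 2"
  shows "\<exists>t\<^sub>0. 0 \<le> t\<^sub>0 \<and> t\<^sub>0 < T \<and>
     (\<exists>\<theta> \<rho> :: real \<Rightarrow> real.
        continuous_on {t\<^sub>0..<T} \<theta> \<and> continuous_on {t\<^sub>0..<T} \<rho> \<and>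
        (\<forall>t\<in>{t\<^sub>0..<T}. 0 < \<rho> t \<and>
           H1_norm (\<lambda>x. exp (- \<i> * of_real (\<theta> t)) * of_real (\<rho> t powr (1/2)) * \<psi> t (\<rho> t * x)
                         - ground_state x) \<le> \<epsilon>))"
proof -
  note cons = H1_solution_conservation[OF sol]
  define N where "N t = Lp_norm lborel 2 (wderiv (\<psi> t))" for t
  \<comment> \<open>A positive reference time for the energy; only times between it and T are
    considered.\<close>
  define a where "a = T / 2"
  have a: "0 < a" "a < T" using T by (auto simp: a_def)
  \<comment> \<open>This is twice the energy, so the 4 * E below matches the 8 E of the
    overview.\<close>
  define E where "E = (N a)\<^sup>2 - (cmod (\<psi> a 0)) ^ 4 / 2"
  have energy: "(cmod (\<psi> t 0)) ^ 4 = 2 * ((N t)\<^sup>2 - E)" if "a < t" "t < T" for t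
    using cons(6)[OF a(1) that] by (simp add: E_def N_def field_simps)
  \<comment> \<open>Lower target for sqrt \<rho> |psi(0,t)|, whose limit is sqrt 2: the allowed
    deficit, times 4 sqrt 2, is \<epsilon>^2/2. The maximum with 0 permits comparison of fourth
    powers and also keeps psi(0,t) away from 0.\<close>
  define y where "y = max 0 (sqrt 2 - \<epsilon>\<^sup>2 / 2 / (4 * sqrt 2))"
  have y: "0 \<le> y" "y < sqrt 2" using \<epsilon> by (auto simp: y_def)
  have "y ^ 4 < (sqrt 2) ^ 4" using y by (intro power_strict_mono) auto
  also have "(sqrt 2) ^ 4 = (4::real)" by (simp add: power4_eq_xxxx)
  finally have y4: "y ^ 4 < 4" .
  have Nlim: "filterlim N at_top (at_left T)" using blowup by (simp add: N_def[abs_def])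
  have "((\<lambda>t. inverse (N t)) \<longlongrightarrow> 0) (at_left T)"
    by (rule tendsto_inverse_0_at_top[OF Nlim])
  then have "((\<lambda>t. 4 - 4 * E * (inverse (N t))\<^sup>2) \<longlongrightarrow> 4 - 4 * E * 0\<^sup>2) (at_left T)"
    by (intro tendsto_intros)
  then have "\<forall>\<^sub>F t in at_left T. y ^ 4 < 4 - 4 * E * (inverse (N t))\<^sup>2"
    by (rule order_tendstoD(1)) (use y4 in simp)
  moreover have "\<forall>\<^sub>F t in at_left T. 0 < N t"
    using Nlim by (auto simp: filterlim_at_top_dense)
  moreover have "\<forall>\<^sub>F t in at_left T. a < t \<and> t < T"
    using a by (auto intro!: eventually_at_leftI[of a])
  ultimately have "\<forall>\<^sub>F t in at_left T. y ^ 4 < 4 - 4 * E * (inverse (N t))\<^sup>2 \<and> 0 < N t \<and> a < t \<and> t < T"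
    by eventually_elim blast
  then obtain t1 where t1: "t1 < T" 
    "\<And>t. t1 < t \<Longrightarrow> t < T \<Longrightarrow> y ^ 4 < 4 - 4 * E * (inverse (N t))\<^sup>2 \<and> 0 < N t \<and> a < t \<and> t < T"
    unfolding eventually_at_left_field by blast
  \<comment> \<open>The eventual bounds hold for t > t1 strictly, so the left endpoint of [t0,T)
    must lie beyond both t1 and a.\<close>
  define t0 where "t0 = (max a t1 + T) / 2"
  have t0: "t1 < t0" "a < t0" "t0 < T" using t1(1) a by (auto simp: t0_def)
  define \<rho> where "\<rho> t = sqrt 2 / N t" for t
  have good: "0 < N t" "y < sqrt (\<rho> t) * cmod (\<psi> t 0)" if "t \<in> {t0..<T}" for t
  proof -
    have t: "t1 < t" "t < T" "a < t" using that t0 by auto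
    show N0: "0 < N t" using t1(2) t by blast
    \<comment> \<open>The fourth power of sqrt \<rho> is 2 / N^2, and the energy law turns
      |psi(0,t)|^4 into 2 (N^2 - E); the product is 4 - 4 E / N^2.\<close>
    have "(sqrt (\<rho> t) * cmod (\<psi> t 0)) ^ 4 = (sqrt (\<rho> t)) ^ 4 * (cmod (\<psi> t 0)) ^ 4"
      by (rule power_mult_distrib)
    also have "(sqrt (\<rho> t)) ^ 4 = ((sqrt (\<rho> t))\<^sup>2)\<^sup>2" by (simp flip: power_mult)
    also have "\<dots> = 2 / (N t)\<^sup>2" using N0 by (simp add: \<rho>_def power_divide)
    also have "2 / (N t)\<^sup>2 * (cmod (\<psi> t 0)) ^ 4 = 4 - 4 * E * (inverse (N t))\<^sup>2"
      unfolding energy[OF t(3,2)] using N0 by (simp add: field_simps)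
    finally have "y ^ 4 < (sqrt (\<rho> t) * cmod (\<psi> t 0)) ^ 4" using t1(2) t by simp
    then show "y < sqrt (\<rho> t) * cmod (\<psi> t 0)"
      by (rule power_less_imp_less_base) (use N0 in \<open>simp add: \<rho>_def\<close>)
  qed
  have sub: "{t0..<T} \<subseteq> {0..<T}" using t0 a by auto
  have nz: "\<psi> t 0 \<noteq> 0" if "t \<in> {t0..<T}" for t
    using good(2)[OF that] y(1) by auto
  obtain \<theta> where \<theta>: "continuous_on {t0..<T} \<theta>"
    "\<And>t. t \<in> {t0..<T} \<Longrightarrow> exp (- \<i> * of_real (\<theta> t)) * \<psi> t 0 = of_real (cmod (\<psi> t 0))"
    using continuous_phase[OF continuous_on_subset[OF cons(3) sub] _ nz] by auto
  have c\<rho>: "continuous_on {t0..<T} \<rho>"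
    unfolding \<rho>_def
  proof (intro continuous_intros continuous_on_subset[OF cons(2)[folded N_def] sub] ballI)
    show "N t \<noteq> 0" if "t \<in> {t0..<T}" for t using good(1)[OF that] by simp
  qed
  have "H1_norm (\<lambda>x. exp (- \<i> * of_real (\<theta> t)) * of_real (\<rho> t powr (1/2)) * \<psi> t (\<rho> t * x) - ground_state x) \<le> \<epsilon>"
    (is "?n \<le> \<epsilon>") if t: "t \<in> {t0..<T}" for t
  proof (rule power2_le_imp_le)
    have t': "t \<in> {0..<T}" using t sub by blast
    have n: "?n\<^sup>2 = (Lp_norm lborel 2 (\<psi> t))\<^sup>2 + 6 - 4 * sqrt 2 * (sqrt (\<rho> t) * cmod (\<psi> t 0))"
      by (rule H1_norm_rescaled_diff_ground_state[OF cons(4)[OF t'] _ _ \<theta>(2)[OF t]])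
         (use good(1)[OF t] in \<open>auto simp: N_def \<rho>_def\<close>)
    have m: "(Lp_norm lborel 2 (\<psi> t))\<^sup>2 < 2 + \<epsilon>\<^sup>2 / 2"
      using M cons(5)[OF t'] by (simp add: mass_def)
    have "4 * sqrt 2 * (sqrt 2 - \<epsilon>\<^sup>2 / 2 / (4 * sqrt 2)) \<le> 4 * sqrt 2 * (sqrt (\<rho> t) * cmod (\<psi> t 0))"
      using good(2)[OF t] by (intro mult_left_mono) (auto simp: y_def)
    moreover have "4 * sqrt 2 * (sqrt 2 - \<epsilon>\<^sup>2 / 2 / (4 * sqrt 2)) = 8 - \<epsilon>\<^sup>2 / 2"
      by (simp add: field_simps)
    ultimately have q: "8 - \<epsilon>\<^sup>2 / 2 \<le> 4 * sqrt 2 * (sqrt (\<rho> t) * cmod (\<psi> t 0))" by (simp only:)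
    \<comment> \<open>With h = \<epsilon>^2/2 the two halves add up: (2 + h) + 6 - (8 - h) = 2
      h.\<close>
    have "n \<le> 2 * h" if "n = m + 6 - q" "m < 2 + h" "8 - h \<le> q" for n m q h :: real
      using that by simp
    from this[OF n m q] show "?n\<^sup>2 \<le> \<epsilon>\<^sup>2" by simp
  qed (use \<epsilon> in simp)
  moreover have "0 < \<rho> t" if "t \<in> {t0..<T}" for t using good(1)[OF that] by (simp add: \<rho>_def)
  ultimately show ?thesis
    using \<theta>(1) c\<rho> t0 a by (intro exI[of _ t0] conjI exI[of _ \<theta>] exI[of _ \<rho>] ballI) auto
qed

theorem theorem1p8:
  shows "mass ground_state = 2 \<and>
    (\<forall>\<epsilon>::real. 0 < \<epsilon> \<longrightarrow>
      (\<exists>\<delta>\<^sub>0::real. 0 < \<delta>\<^sub>0 \<and>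
        (\<forall>(\<psi> :: real \<Rightarrow> real \<Rightarrow> complex) (T::real).
          0 < T \<and> H1_solution T \<psi> \<and>
          mass ground_state < mass (\<psi> 0) \<and> mass (\<psi> 0) < mass ground_state + \<delta>\<^sub>0 \<and>
          blows_up_at T \<psi> \<longrightarrow>
          (\<exists>t\<^sub>0. 0 \<le> t\<^sub>0 \<and> t\<^sub>0 < T \<and>
            (\<exists>\<theta> \<rho> :: real \<Rightarrow> real.
              continuous_on {t\<^sub>0..<T} \<theta> \<and> continuous_on {t\<^sub>0..<T} \<rho> \<and>
              (\<forall>t\<in>{t\<^sub>0..<T}. 0 < \<rho> t \<and>
                H1_norm (\<lambda>x. exp (- \<i> * of_real (\<theta> t)) * of_real (\<rho> t powr (1/2)) * \<psi> t (\<rho> t * x)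
                              - ground_state x) \<le> \<epsilon>))))))"
proof (intro conjI allI impI)
  show "mass ground_state = 2" by (rule mass_ground_state)
  fix \<epsilon> :: real assume "0 < \<epsilon>"
  then show "\<exists>\<delta>\<^sub>0::real. 0 < \<delta>\<^sub>0 \<and>
        (\<forall>(\<psi> :: real \<Rightarrow> real \<Rightarrow> complex) (T::real).
          0 < T \<and> H1_solution T \<psi> \<and>
          mass ground_state < mass (\<psi> 0) \<and> mass (\<psi> 0) < mass ground_state + \<delta>\<^sub>0 \<and>
          blows_up_at T \<psi> \<longrightarrow>
          (\<exists>t\<^sub>0. 0 \<le> t\<^sub>0 \<and> t\<^sub>0 < T \<and>
            (\<exists>\<theta> \<rho> :: real \<Rightarrow> real.
              continuous_on {t\<^sub>0..<T} \<theta> \<and> continuous_on {t\<^sub>0..<T} \<rho> \<and>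
              (\<forall>t\<in>{t\<^sub>0..<T}. 0 < \<rho> t \<and>
                H1_norm (\<lambda>x. exp (- \<i> * of_real (\<theta> t)) * of_real (\<rho> t powr (1/2)) * \<psi> t (\<rho> t * x)
                              - ground_state x) \<le> \<epsilon>))))"
    \<comment> \<open>The witness \<epsilon>^2/2 is chosen before the solution, so \<delta>_0
      depends on \<epsilon> alone; only the starting time t_0 depends on \<psi>.\<close>
    unfolding mass_ground_state blows_up_at_def
    by (intro exI[of _ "\<epsilon>\<^sup>2 / 2"] conjI allI impI blowup_profile) auto
qed

end
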